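(* Let $A$ be a semi-real (commutative, unital) ring. Assume that there exist a (commutative, unital) ring $B$ and a multiplicative subset $S\subseteq B$ such that $Q(A)\cong B/_mS$ as multirings. Then $Q(A)\cong V(A)/_m\left(1+\sum V(A)^2\right)$; thus $Q(A)$ is represented by the von Neumann regular ring $V(A)$.
   Context: A multiring is a tuple $(A,+,-,\cdot,0,1)$ where $(A,\cdot,1)$ is a commutative monoid, $+\colon A\times A\to\{\text{nonempty subsets of }A\}$ and $-\colon A\to A$ are functions and $0\in A$, such that for all $a,b,c,d\in A$: (1) $a\in b+c$ implies $c\in -b+a$ and $b\in a+(-c)$; (2) $a\in b+0$ iff $a=b$; (3) if $x\in g+c$ with $g\in a+b$, then there is $h\in b+c$ with $x\in a+h$; (4) $a+b=b+a$; (5) $a\cdot 0=0$; (6) $a\in b+c$ implies $ad\in bd+cd$. A commutative unital ring is a multiring with singleton sums. A morphism of multirings $f$ satisfies $f(a)\in f(b)+f(c)$ whenever $a\in b+c$, and preserves $\cdot,-,0,1$; an isomorphism is a morphism with an inverse morphism. $\sum A^2$ is the set of sums of (one or more) squares. $A$ is semi-real if $-1\notin\sum A^2$. The multiring $\mathbf 3=\{-1,0,1\}$ has the usual multiplication and negation, and sum $0+x=x+0=\{x\}$, $1+1=\{1\}$, $(-1)+(-1)=\{-1\}$, $1+(-1)=(-1)+1=\{-1,0,1\}$. $\mathrm{sper}(A)$ is the set of multiring morphisms $A\to\mathbf 3$. For $a\in A$ let $\hat a\in\mathbf 3^{\mathrm{sper}(A)}$, $\hat a(\sigma)=\sigma(a)$;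 $Q(A)=\{\hat a: a\in A\}$ with $\hat a\hat b=\widehat{ab}$, $-\hat a=\widehat{-a}$, constants $\hat 0,\hat 1$, and $\hat a\in\hat b+\hat c$ iff there are $a',b',c'\in A$ with $\hat a'=\hat a$, $\hat b'=\hat b$, $\hat c'=\hat c$, $a'\in b'+c'$. It is a multiring. Marshall quotient: for a multiplicative set $S$ ($1\in S$, $SS\subseteq S$) of a multiring $B$, $B/_mS$ is the set of classes of $a\sim b\Leftrightarrow as=bt$ for some $s,t\in S$, with $\overline a\,\overline b=\overline{ab}$, $-\overline a=\overline{-a}$, and $\overline a\in\overline b+\overline c$ iff $as\in bt+cu$ for some $s,t,u\in S$ (for a ring: $as=bt+cu$). For the ring $A$: $\mathrm{spec}(A)$ is the usual prime spectrum, $D(a)=\{p:a\notin p\}$, $K_A(p)$ is the fraction field of $A/p$, and $(\mathrm{spec}(A))_{const}$ is $\mathrm{spec}(A)$ with the constructible topology (generated by the $D(a)$ and their complements). $V(A)$ is the set of functions $f\colon\mathrm{spec}(A)\to\bigsqcup_pK_A(p)$ with $f(p)\in K_A(p)$ such that for each $p$ there are a clopen $U$ of $(\mathrm{spec}(A))_{const}$ and $x,y\in A$ with $p\in U\subseteq D(y)$ and $f(q)=\frac xy\in K_A(q)$ for all $q\in U$; operations are pointwise, and $V(A)$ is a commutative von Neumann regular ring. *)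

theory Defs
  imports "HOL-Analysis.Abstract_Topology" "HOL-Algebra.QuotRing"
begin

section \<open>Multirings\<close>

record 'a multiring = "'a monoid" +
  madd :: "'a \<Rightarrow> 'a \<Rightarrow> 'a set" (infixl \<open>\<boxplus>\<index>\<close> 65)
  mneg :: "'a \<Rightarrow> 'a" (\<open>\<boxminus>\<index> _\<close> [81] 80)
  mzero :: 'a

locale multiring = comm_monoid M for M (structure) +
  assumes madd_nonempty: "\<lbrakk>a \<in> carrier M; b \<in> carrier M\<rbrakk> \<Longrightarrow> a \<boxplus> b \<noteq> {}"
    and madd_closed: "\<lbrakk>a \<in> carrier M; b \<in> carrier M\<rbrakk> \<Longrightarrow> a \<boxplus> b \<subseteq> carrier M"
    and mneg_closed: "a \<in> carrier M \<Longrightarrow> \<boxminus> a \<in> carrier M"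
    and mzero_closed: "mzero M \<in> carrier M"
    and madd_reversible:
      "\<lbrakk>a \<in> carrier M; b \<in> carrier M; c \<in> carrier M; a \<in> b \<boxplus> c\<rbrakk>
        \<Longrightarrow> c \<in> (\<boxminus> b) \<boxplus> a \<and> b \<in> a \<boxplus> (\<boxminus> c)"
    and madd_mzero_iff:
      "\<lbrakk>a \<in> carrier M; b \<in> carrier M\<rbrakk> \<Longrightarrow> a \<in> b \<boxplus> mzero M \<longleftrightarrow> a = b"
    and madd_assoc:
      "\<lbrakk>a \<in> carrier M; b \<in> carrier M; c \<in> carrier M; g \<in> a \<boxplus> b; x \<in> g \<boxplus> c\<rbrakk>
        \<Longrightarrow> \<exists>h \<in> b \<boxplus> c. x \<in> a \<boxplus> h"
    and madd_commute: "\<lbrakk>a \<in> carrier M; b \<in> carrier M\<rbrakk> \<Longrightarrow> a \<boxplus> b = b \<boxplus> a"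
    and mult_mzero: "a \<in> carrier M \<Longrightarrow> a \<otimes> mzero M = mzero M"
    and madd_mult:
      "\<lbrakk>a \<in> carrier M; b \<in> carrier M; c \<in> carrier M; d \<in> carrier M; a \<in> b \<boxplus> c\<rbrakk>
        \<Longrightarrow> a \<otimes> d \<in> (b \<otimes> d) \<boxplus> (c \<otimes> d)"

definition multiring_of_ring :: "('a, 'm) ring_scheme \<Rightarrow> 'a multiring"
  where "multiring_of_ring R =
    \<lparr>carrier = carrier R, mult = mult R, one = one R,
     madd = (\<lambda>a b. {a \<oplus>\<^bsub>R\<^esub> b}), mneg = (\<lambda>a. \<ominus>\<^bsub>R\<^esub> a), mzero = zero R\<rparr>"

definition multiring_hom :: "('a, 'm) multiring_scheme \<Rightarrow> ('b, 'n) multiring_scheme \<Rightarrow> ('a \<Rightarrow> 'b) set"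
  where "multiring_hom M N =
    {f \<in> carrier M \<rightarrow> carrier N.
       (\<forall>a \<in> carrier M. \<forall>b \<in> carrier M. \<forall>c \<in> carrier M.
          a \<in> b \<boxplus>\<^bsub>M\<^esub> c \<longrightarrow> f a \<in> f b \<boxplus>\<^bsub>N\<^esub> f c) \<and>
       (\<forall>a \<in> carrier M. \<forall>b \<in> carrier M. f (a \<otimes>\<^bsub>M\<^esub> b) = f a \<otimes>\<^bsub>N\<^esub> f b) \<and>
       (\<forall>a \<in> carrier M. f (\<boxminus>\<^bsub>M\<^esub> a) = \<boxminus>\<^bsub>N\<^esub> f a) \<and>
       f (mzero M) = mzero N \<and> f \<one>\<^bsub>M\<^esub> = \<one>\<^bsub>N\<^esub>}"

definition multiring_isomorphic :: "('a, 'm) multiring_scheme \<Rightarrow> ('b, 'n) multiring_scheme \<Rightarrow> bool"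
    (infix \<open>\<cong>\<^sub>m\<close> 50)
  where "M \<cong>\<^sub>m N \<longleftrightarrow>
    (\<exists>f \<in> multiring_hom M N. \<exists>g \<in> multiring_hom N M.
       (\<forall>a \<in> carrier M. g (f a) = a) \<and> (\<forall>b \<in> carrier N. f (g b) = b))"

inductive_set sums_of_squares :: "('a, 'm) multiring_scheme \<Rightarrow> 'a set" for M (structure)
  where
    square: "a \<in> carrier M \<Longrightarrow> a \<otimes> a \<in> sums_of_squares M"
  | add_square:
      "\<lbrakk>x \<in> sums_of_squares M; a \<in> carrier M; y \<in> x \<boxplus> (a \<otimes> a)\<rbrakk> \<Longrightarrow> y \<in> sums_of_squares M"

definition semi_real :: "('a, 'm) multiring_scheme \<Rightarrow> bool"
  where "semi_real M \<longleftrightarrow> \<boxminus>\<^bsub>M\<^esub> \<one>\<^bsub>M\<^esub> \<notin> sums_of_squares M"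

definition one_plus_sums_of_squares :: "('a, 'm) multiring_scheme \<Rightarrow> 'a set"
  where "one_plus_sums_of_squares M = (\<Union>x \<in> sums_of_squares M. \<one>\<^bsub>M\<^esub> \<boxplus>\<^bsub>M\<^esub> x)"


section \<open>Orderings and the real reduced multiring \<open>Q(A)\<close>\<close>

definition three :: "int multiring"
  where "three =
    \<lparr>carrier = {-1, 0, 1}, mult = (*), one = 1,
     madd = (\<lambda>x y. if x = 0 then {y} else if y = 0 then {x}
                    else if x = y then {x} else {-1, 0, 1}),
     mneg = uminus, mzero = 0\<rparr>"

text \<open>Extensionality makes equality of functions coincide with equality of morphisms on the carrier.\<close>

definition sper :: "('a, 'm) multiring_scheme \<Rightarrow> ('a \<Rightarrow> int) set"
  where "sper M = multiring_hom M three \<inter> extensional (carrier M)"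

definition hat :: "('a, 'm) multiring_scheme \<Rightarrow> 'a \<Rightarrow> ('a \<Rightarrow> int) \<Rightarrow> int"
  where "hat M a = (\<lambda>\<sigma> \<in> sper M. \<sigma> a)"

text \<open>Product and negation are the pointwise ones of \<open>\<three>\<^bsup>sper(M)\<^esup>\<close>; lemma \<open>hat_mult_neg\<close> below
  gives the formulas on representatives.\<close>

definition Qred :: "('a, 'm) multiring_scheme \<Rightarrow> (('a \<Rightarrow> int) \<Rightarrow> int) multiring"
  where "Qred M =
    \<lparr>carrier = hat M ` carrier M,
     mult = (\<lambda>f g. \<lambda>\<sigma> \<in> sper M. f \<sigma> * g \<sigma>),
     one = hat M \<one>\<^bsub>M\<^esub>,
     madd = (\<lambda>f g. {hat M a | a b c. a \<in> carrier M \<and> b \<in> carrier M \<and> c \<in> carrier M \<and>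
                      hat M b = f \<and> hat M c = g \<and> a \<in> b \<boxplus>\<^bsub>M\<^esub> c}),
     mneg = (\<lambda>f. \<lambda>\<sigma> \<in> sper M. - f \<sigma>),
     mzero = hat M (mzero M)\<rparr>"


section \<open>Marshall quotients\<close>

definition marshall_rel :: "('a, 'm) multiring_scheme \<Rightarrow> 'a set \<Rightarrow> ('a \<times> 'a) set"
  where "marshall_rel M S =
    {(a, b). a \<in> carrier M \<and> b \<in> carrier M \<and> (\<exists>s \<in> S. \<exists>t \<in> S. a \<otimes>\<^bsub>M\<^esub> s = b \<otimes>\<^bsub>M\<^esub> t)}"

definition marshall_class :: "('a, 'm) multiring_scheme \<Rightarrow> 'a set \<Rightarrow> 'a \<Rightarrow> 'a set"
  where "marshall_class M S a = marshall_rel M S `` {a}"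

text \<open>The unions are over a single class when \<open>S\<close> is a submonoid of a multiring: see
  \<open>marshall_mult_class\<close> and \<open>marshall_neg_class\<close>.\<close>

definition marshall_quotient :: "('a, 'm) multiring_scheme \<Rightarrow> 'a set \<Rightarrow> 'a set multiring"
    (infixl \<open>'/\<^sub>m\<close> 65)
  where "M /\<^sub>m S =
    \<lparr>carrier = carrier M // marshall_rel M S,
     mult = (\<lambda>X Y. \<Union>a \<in> X. \<Union>b \<in> Y. marshall_class M S (a \<otimes>\<^bsub>M\<^esub> b)),
     one = marshall_class M S \<one>\<^bsub>M\<^esub>,
     madd = (\<lambda>Y Z. {X \<in> carrier M // marshall_rel M S.
               \<exists>a \<in> X. \<exists>b \<in> Y. \<exists>c \<in> Z. \<exists>s \<in> S. \<exists>t \<in> S. \<exists>u \<in> S.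
                 a \<otimes>\<^bsub>M\<^esub> s \<in> (b \<otimes>\<^bsub>M\<^esub> t) \<boxplus>\<^bsub>M\<^esub> (c \<otimes>\<^bsub>M\<^esub> u)}),
     mneg = (\<lambda>X. \<Union>a \<in> X. marshall_class M S (\<boxminus>\<^bsub>M\<^esub> a)),
     mzero = marshall_class M S (mzero M)\<rparr>"


section \<open>The von Neumann regular hull \<open>V(A)\<close>\<close>

text \<open>\<open>fraction R a b\<close> is the fraction \<open>a / b\<close>, as a class of pairs; meant for a domain \<open>R\<close> and \<open>b \<noteq> 0\<close>.
  For the well-definedness of the operations of \<open>fraction_field\<close> see \<open>fraction_mult\<close> and
  \<open>fraction_add\<close>.\<close>

definition fraction :: "('a, 'm) ring_scheme \<Rightarrow> 'a \<Rightarrow> 'a \<Rightarrow> ('a \<times> 'a) set"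
  where "fraction R a b =
    {(c, d). c \<in> carrier R \<and> d \<in> carrier R - {\<zero>\<^bsub>R\<^esub>} \<and> a \<otimes>\<^bsub>R\<^esub> d = c \<otimes>\<^bsub>R\<^esub> b}"

definition fraction_field :: "('a, 'm) ring_scheme \<Rightarrow> ('a \<times> 'a) set ring"
  where "fraction_field R =
    \<lparr>carrier = {fraction R a b | a b. a \<in> carrier R \<and> b \<in> carrier R - {\<zero>\<^bsub>R\<^esub>}},
     mult = (\<lambda>X Y. \<Union>(a, b) \<in> X. \<Union>(c, d) \<in> Y. fraction R (a \<otimes>\<^bsub>R\<^esub> c) (b \<otimes>\<^bsub>R\<^esub> d)),
     one = fraction R \<one>\<^bsub>R\<^esub> \<one>\<^bsub>R\<^esub>,
     zero = fraction R \<zero>\<^bsub>R\<^esub> \<one>\<^bsub>R\<^esub>,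
     add = (\<lambda>X Y. \<Union>(a, b) \<in> X. \<Union>(c, d) \<in> Y.
              fraction R ((a \<otimes>\<^bsub>R\<^esub> d) \<oplus>\<^bsub>R\<^esub> (c \<otimes>\<^bsub>R\<^esub> b)) (b \<otimes>\<^bsub>R\<^esub> d))\<rparr>"

definition spec :: "('a, 'm) ring_scheme \<Rightarrow> 'a set set"
  where "spec A = {p. primeideal p A}"

definition basic_open :: "('a, 'm) ring_scheme \<Rightarrow> 'a \<Rightarrow> 'a set set"
  where "basic_open A a = {p \<in> spec A. a \<notin> p}"

definition constructible_topology :: "('a, 'm) ring_scheme \<Rightarrow> 'a set topology"
  where "constructible_topology A =
    topology_generated_by
      (basic_open A ` carrier A \<union> (\<lambda>a. spec A - basic_open A a) ` carrier A)"

definition residue_field :: "('a, 'm) ring_scheme \<Rightarrow> 'a set \<Rightarrow> ('a set \<times> 'a set) set ring"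
  where "residue_field A p = fraction_field (A Quot p)"

definition residue_frac :: "('a, 'm) ring_scheme \<Rightarrow> 'a set \<Rightarrow> 'a \<Rightarrow> 'a \<Rightarrow> ('a set \<times> 'a set) set"
  where "residue_frac A p x y = fraction (A Quot p) (p +>\<^bsub>A\<^esub> x) (p +>\<^bsub>A\<^esub> y)"

text \<open>The dependent product \<open>\<Pi>\<^sub>E\<close> replaces functions into the disjoint union of the residue fields.\<close>

definition V :: "('a, 'm) ring_scheme \<Rightarrow> ('a set \<Rightarrow> ('a set \<times> 'a set) set) ring"
  where "V A =
    \<lparr>carrier = {f \<in> \<Pi>\<^sub>E p \<in> spec A. carrier (residue_field A p).
       \<forall>p \<in> spec A. \<exists>U. \<exists>x \<in> carrier A. \<exists>y \<in> carrier A.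
         openin (constructible_topology A) U \<and> closedin (constructible_topology A) U \<and>
         p \<in> U \<and> U \<subseteq> basic_open A y \<and> (\<forall>q \<in> U. f q = residue_frac A q x y)},
     mult = (\<lambda>f g. \<lambda>p \<in> spec A. f p \<otimes>\<^bsub>residue_field A p\<^esub> g p),
     one = (\<lambda>p \<in> spec A. \<one>\<^bsub>residue_field A p\<^esub>),
     zero = (\<lambda>p \<in> spec A. \<zero>\<^bsub>residue_field A p\<^esub>),
     add = (\<lambda>f g. \<lambda>p \<in> spec A. f p \<oplus>\<^bsub>residue_field A p\<^esub> g p)\<rparr>"

definition von_neumann_regular :: "('a, 'm) ring_scheme \<Rightarrow> bool"
  where "von_neumann_regular R \<longleftrightarrow>
    cring R \<and> (\<forall>a \<in> carrier R. \<exists>b \<in> carrier R. a = a \<otimes>\<^bsub>R\<^esub> b \<otimes>\<^bsub>R\<^esub> a)"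


section \<open>Basic consistency facts\<close>

lemma multiring_of_ring_simps [simp]:
  "carrier (multiring_of_ring R) = carrier R"
  "mult (multiring_of_ring R) = mult R"
  "one (multiring_of_ring R) = one R"
  "madd (multiring_of_ring R) a b = {a \<oplus>\<^bsub>R\<^esub> b}"
  "mneg (multiring_of_ring R) a = \<ominus>\<^bsub>R\<^esub> a"
  "mzero (multiring_of_ring R) = zero R"
  by (simp_all add: multiring_of_ring_def)

lemma (in cring) multiring_of_ring: "multiring (multiring_of_ring R)"
proof -
  have "comm_monoid (multiring_of_ring R)"
    by (rule comm_monoidI) (auto simp: m_assoc intro: m_comm)
  moreover have "multiring_axioms (multiring_of_ring R)"
  proof (unfold_locales, goal_cases)
    case (5 a b c)
    then have "b \<in> carrier R" "c \<in> carrier R" "a = b \<oplus> c" by auto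
    then have "c = \<ominus> b \<oplus> a" "b = a \<oplus> \<ominus> c"
      by (simp_all add: r_neg1 a_assoc r_neg)
    then show ?case by simp
  qed (auto simp: a_assoc l_distr intro: a_comm)
  ultimately show ?thesis by (rule multiring.intro)
qed

lemma multiring_three: "multiring three"
proof -
  have "comm_monoid three"
    by (rule comm_monoidI) (auto simp: three_def)
  moreover have "multiring_axioms three"
  proof -
    let ?T = "carrier three"
    have t1: "\<forall>a\<in>?T. \<forall>b\<in>?T. a \<boxplus>\<^bsub>three\<^esub> b \<noteq> {} \<and> a \<boxplus>\<^bsub>three\<^esub> b \<subseteq> ?T \<and>
        a \<boxplus>\<^bsub>three\<^esub> b = b \<boxplus>\<^bsub>three\<^esub> a \<and> (a \<in> b \<boxplus>\<^bsub>three\<^esub> mzero three \<longleftrightarrow> a = b)"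
      by (simp add: three_def insert_commute)
    have t2: "\<forall>b\<in>?T. \<forall>c\<in>?T. \<forall>a\<in>b \<boxplus>\<^bsub>three\<^esub> c.
        c \<in> (\<boxminus>\<^bsub>three\<^esub> b) \<boxplus>\<^bsub>three\<^esub> a \<and> b \<in> a \<boxplus>\<^bsub>three\<^esub> (\<boxminus>\<^bsub>three\<^esub> c)"
      by (simp add: three_def)
    have t3: "\<forall>a\<in>?T. \<forall>b\<in>?T. \<forall>c\<in>?T. \<forall>g\<in>a \<boxplus>\<^bsub>three\<^esub> b. \<forall>x\<in>g \<boxplus>\<^bsub>three\<^esub> c.
        \<exists>h\<in>b \<boxplus>\<^bsub>three\<^esub> c. x \<in> a \<boxplus>\<^bsub>three\<^esub> h"
      by (simp add: three_def)
    have t4: "\<forall>b\<in>?T. \<forall>c\<in>?T. \<forall>d\<in>?T. \<forall>a\<in>b \<boxplus>\<^bsub>three\<^esub> c.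
        a \<otimes>\<^bsub>three\<^esub> d \<in> (b \<otimes>\<^bsub>three\<^esub> d) \<boxplus>\<^bsub>three\<^esub> (c \<otimes>\<^bsub>three\<^esub> d)"
      by (simp add: three_def)
    have t5: "mzero three \<in> ?T" "\<forall>a\<in>?T. \<boxminus>\<^bsub>three\<^esub> a \<in> ?T \<and> a \<otimes>\<^bsub>three\<^esub> mzero three = mzero three"
      by (auto simp: three_def)
    show ?thesis
    proof (unfold_locales, goal_cases)
      case 1 with t1 show ?case by blast
    next
      case 2 with t1 show ?case by blast
    next
      case 3 with t5 show ?case by blast
    next
      case 4 show ?case by (rule t5(1))
    next
      case 5 with t2 show ?case by blast
    next
      case 6 with t1 show ?case by blast
    next
      case 7 with t3 show ?case by blast
    next
      case 8 with t1 show ?case by blast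
    next
      case 9 with t5 show ?case by blast
    next
      case 10 with t4 show ?case by blast
    qed
  qed
  ultimately show ?thesis by (rule multiring.intro)
qed

lemma (in multiring) hat_mult_neg:
  assumes "a \<in> carrier M" "b \<in> carrier M"
  shows "hat M a \<otimes>\<^bsub>Qred M\<^esub> hat M b = hat M (a \<otimes> b)"
    and "\<boxminus>\<^bsub>Qred M\<^esub> hat M a = hat M (\<boxminus> a)"
proof -
  have "\<sigma> (a \<otimes> b) = \<sigma> a * \<sigma> b" "\<sigma> (\<boxminus> a) = - \<sigma> a" if "\<sigma> \<in> sper M" for \<sigma>
    using that assms by (simp_all add: sper_def multiring_hom_def three_def)
  then show "hat M a \<otimes>\<^bsub>Qred M\<^esub> hat M b = hat M (a \<otimes> b)"
    and "\<boxminus>\<^bsub>Qred M\<^esub> hat M a = hat M (\<boxminus> a)"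
    by (simp_all add: Qred_def hat_def cong: restrict_cong)
qed

context multiring
begin

lemma mneg_mult:
  assumes "a \<in> carrier M" "b \<in> carrier M"
  shows "(\<boxminus> a) \<otimes> b = \<boxminus> (a \<otimes> b)"
proof -
  have c: "a \<in> carrier M" "b \<in> carrier M" "\<boxminus> a \<in> carrier M" "mzero M \<in> carrier M"
    "a \<otimes> b \<in> carrier M" "(\<boxminus> a) \<otimes> b \<in> carrier M" "\<boxminus> (a \<otimes> b) \<in> carrier M"
    using assms by (simp_all add: mneg_closed mzero_closed)
  have "mzero M \<in> a \<boxplus> (\<boxminus> a)"
    using madd_reversible[of a a "mzero M"] madd_mzero_iff[of a a] c
    by (simp add: madd_commute[of a "\<boxminus> a"])
  then have "mzero M \<otimes> b \<in> (a \<otimes> b) \<boxplus> ((\<boxminus> a) \<otimes> b)"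
    by (intro madd_mult c)
  moreover have "mzero M \<otimes> b = mzero M"
    using mult_mzero c by (subst m_comm) auto
  ultimately have "mzero M \<in> (a \<otimes> b) \<boxplus> ((\<boxminus> a) \<otimes> b)"
    by simp
  then have "(\<boxminus> a) \<otimes> b \<in> (\<boxminus> (a \<otimes> b)) \<boxplus> mzero M"
    using madd_reversible[of "mzero M" "a \<otimes> b" "(\<boxminus> a) \<otimes> b"] c by simp
  then show ?thesis
    using madd_mzero_iff[of "(\<boxminus> a) \<otimes> b" "\<boxminus> (a \<otimes> b)"] c by simp
qed

lemma marshall_relI:
  "\<lbrakk>a \<in> carrier M; b \<in> carrier M; s \<in> S; t \<in> S; a \<otimes> s = b \<otimes> t\<rbrakk> \<Longrightarrow> (a, b) \<in> marshall_rel M S"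
  unfolding marshall_rel_def by blast

lemma marshall_relE:
  assumes "(a, b) \<in> marshall_rel M S"
  obtains s t where "a \<in> carrier M" "b \<in> carrier M" "s \<in> S" "t \<in> S" "a \<otimes> s = b \<otimes> t"
  using assms unfolding marshall_rel_def by blast

context
  fixes S assumes S: "submonoid S M"
begin

interpretation S: submonoid S M by (rule S)

lemma equiv_marshall_rel: "equiv (carrier M) (marshall_rel M S)"
proof (rule equivI)
  show "marshall_rel M S \<subseteq> carrier M \<times> carrier M" by (auto simp: marshall_rel_def)
  show "refl_on (carrier M) (marshall_rel M S)"
    using S.one_closed unfolding refl_on_def marshall_rel_def by blast
  show "sym (marshall_rel M S)" by (intro symI) (metis marshall_relE marshall_relI)
  show "trans (marshall_rel M S)"
  proof (rule transI)
    fix a b c assume "(a, b) \<in> marshall_rel M S" "(b, c) \<in> marshall_rel M S"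
    then obtain s t u v where *: "a \<in> carrier M" "b \<in> carrier M" "c \<in> carrier M"
      "s \<in> S" "t \<in> S" "u \<in> S" "v \<in> S" "a \<otimes> s = b \<otimes> t" "b \<otimes> u = c \<otimes> v"
      by (elim marshall_relE)
    then have c: "s \<in> carrier M" "t \<in> carrier M" "u \<in> carrier M" "v \<in> carrier M"
      using S.subset by auto
    have "a \<otimes> (s \<otimes> u) = b \<otimes> t \<otimes> u" using * c by (simp add: m_assoc[symmetric])
    also have "\<dots> = b \<otimes> u \<otimes> t" using *(2) c by (simp add: m_ac)
    also have "\<dots> = c \<otimes> (v \<otimes> t)" unfolding *(9) using * c by (intro m_assoc)
    finally show "(a, c) \<in> marshall_rel M S"
      by (rule marshall_relI[OF *(1,3) S.m_closed[OF *(4,6)] S.m_closed[OF *(7,5)]])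
  qed
qed

lemma marshall_class_in: "a \<in> carrier M \<Longrightarrow> a \<in> marshall_class M S a"
  unfolding marshall_class_def using equiv_class_self[OF equiv_marshall_rel] .

lemma marshall_class_eq:
  "(a, b) \<in> marshall_rel M S \<Longrightarrow> marshall_class M S a = marshall_class M S b"
  unfolding marshall_class_def using equiv_class_eq[OF equiv_marshall_rel] .

lemma marshall_mult_class:
  assumes "a \<in> carrier M" "b \<in> carrier M"
  shows "marshall_class M S a \<otimes>\<^bsub>M /\<^sub>m S\<^esub> marshall_class M S b = marshall_class M S (a \<otimes> b)"
proof -
  have "marshall_class M S (a' \<otimes> b') = marshall_class M S (a \<otimes> b)"
    if "a' \<in> marshall_class M S a" "b' \<in> marshall_class M S b" for a' b'
  proof -
    obtain s t u v where *: "a' \<in> carrier M" "b' \<in> carrier M"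
      "s \<in> S" "t \<in> S" "u \<in> S" "v \<in> S" "a \<otimes> s = a' \<otimes> t" "b \<otimes> u = b' \<otimes> v"
      using \<open>a' \<in> _\<close> \<open>b' \<in> _\<close> unfolding marshall_class_def by (auto elim!: marshall_relE)
    then have c: "s \<in> carrier M" "t \<in> carrier M" "u \<in> carrier M" "v \<in> carrier M"
      using S.subset by auto
    have "(a' \<otimes> b') \<otimes> (t \<otimes> v) = (a' \<otimes> t) \<otimes> (b' \<otimes> v)" using * c by (simp add: m_ac)
    also have "\<dots> = (a \<otimes> s) \<otimes> (b \<otimes> u)" using * by simp
    also have "\<dots> = (a \<otimes> b) \<otimes> (s \<otimes> u)" using assms c by (simp add: m_ac)
    finally show ?thesis
      using marshall_relI[OF _ _ S.m_closed[OF *(4,6)] S.m_closed[OF *(3,5)]] assms *(1,2)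
      by (intro marshall_class_eq) simp
  qed
  moreover have "marshall_class M S a \<noteq> {}" "marshall_class M S b \<noteq> {}"
    using marshall_class_in[OF assms(1)] marshall_class_in[OF assms(2)] by blast+
  ultimately show ?thesis
    by (simp add: marshall_quotient_def cong: SUP_cong)
qed

lemma marshall_neg_class:
  assumes "a \<in> carrier M"
  shows "\<boxminus>\<^bsub>M /\<^sub>m S\<^esub> marshall_class M S a = marshall_class M S (\<boxminus> a)"
proof -
  have "marshall_class M S (\<boxminus> a') = marshall_class M S (\<boxminus> a)" if "a' \<in> marshall_class M S a" for a'
  proof -
    obtain s t where *: "a' \<in> carrier M" "s \<in> S" "t \<in> S" "a \<otimes> s = a' \<otimes> t"
      using \<open>a' \<in> _\<close> unfolding marshall_class_def by (auto elim!: marshall_relE)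
    moreover from * have "s \<in> carrier M" "t \<in> carrier M" using S.subset by auto
    ultimately have "(\<boxminus> a') \<otimes> t = (\<boxminus> a) \<otimes> s"
      using assms by (simp add: mneg_mult)
    then show ?thesis
      using marshall_relI[OF _ _ *(3,2)] assms *(1)
      by (intro marshall_class_eq) (simp add: mneg_closed)
  qed
  moreover have "marshall_class M S a \<noteq> {}"
    using marshall_class_in[OF assms] by blast
  ultimately show ?thesis
    by (simp add: marshall_quotient_def cong: SUP_cong)
qed

end

end

context domain
begin

lemma fraction_eq_iff:
  assumes "a \<in> carrier R" "b \<in> carrier R - {\<zero>}" "c \<in> carrier R" "d \<in> carrier R - {\<zero>}"
  shows "fraction R a b = fraction R c d \<longleftrightarrow> a \<otimes> d = c \<otimes> b"
proof
  assume "fraction R a b = fraction R c d"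
  moreover have "(a, b) \<in> fraction R a b" using assms by (simp add: fraction_def)
  ultimately have "(a, b) \<in> fraction R c d" by simp
  then show "a \<otimes> d = c \<otimes> b" by (simp add: fraction_def)
next
  have sub: "fraction R a b \<subseteq> fraction R c d"
    if "a \<in> carrier R" "b \<in> carrier R - {\<zero>}" "c \<in> carrier R" "d \<in> carrier R - {\<zero>}"
      and "a \<otimes> d = c \<otimes> b" for a b c d
  proof (clarsimp simp: fraction_def)
    fix x y assume xy: "x \<in> carrier R" "y \<in> carrier R" "y \<noteq> \<zero>" and e: "a \<otimes> y = x \<otimes> b"
    have "b \<otimes> (c \<otimes> y) = (c \<otimes> b) \<otimes> y" using that(1-4) xy by (simp add: m_ac)
    also have "\<dots> = (a \<otimes> d) \<otimes> y" unfolding that(5) ..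
    also have "\<dots> = (a \<otimes> y) \<otimes> d" using that(1-4) xy by (simp add: m_ac)
    also have "\<dots> = b \<otimes> (x \<otimes> d)" unfolding e using that(1-4) xy by (simp add: m_ac)
    finally show "c \<otimes> y = x \<otimes> d" using m_lcancel[of b "c \<otimes> y" "x \<otimes> d"] that(1-4) xy by simp
  qed
  assume "a \<otimes> d = c \<otimes> b"
  then show "fraction R a b = fraction R c d" using assms by (intro equalityI sub) simp_all
qed

lemma fraction_memD:
  assumes "(x, y) \<in> fraction R a b" "a \<in> carrier R" "b \<in> carrier R - {\<zero>}"
  shows "x \<in> carrier R" "y \<in> carrier R - {\<zero>}" "a \<otimes> y = x \<otimes> b"
  using assms by (auto simp: fraction_def)

lemma fraction_mult:
  assumes "a \<in> carrier R" "b \<in> carrier R - {\<zero>}" "c \<in> carrier R" "d \<in> carrier R - {\<zero>}"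
  shows "fraction R a b \<otimes>\<^bsub>fraction_field R\<^esub> fraction R c d = fraction R (a \<otimes> c) (b \<otimes> d)"
proof -
  have "fraction R (x \<otimes> z) (y \<otimes> w) = fraction R (a \<otimes> c) (b \<otimes> d)"
    if "(x, y) \<in> fraction R a b" "(z, w) \<in> fraction R c d" for x y z w
  proof -
    note m1 = fraction_memD[OF that(1) assms(1,2)]
    note m2 = fraction_memD[OF that(2) assms(3,4)]
    note c = m1(1,2) m2(1,2) assms
    have "(x \<otimes> z) \<otimes> (b \<otimes> d) = (x \<otimes> b) \<otimes> (z \<otimes> d)" using c by (simp add: m_ac)
    also have "\<dots> = (a \<otimes> y) \<otimes> (c \<otimes> w)" unfolding m1(3) m2(3) ..
    also have "\<dots> = (a \<otimes> c) \<otimes> (y \<otimes> w)" using c by (simp add: m_ac)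
    finally show ?thesis using c by (subst fraction_eq_iff) (simp_all add: integral_iff)
  qed
  moreover have "fraction R a b \<noteq> {}" "fraction R c d \<noteq> {}"
    using assms by (auto simp: fraction_def)
  ultimately show ?thesis
    by (simp add: fraction_field_def case_prod_beta' cong: SUP_cong)
qed

lemma fraction_add:
  assumes "a \<in> carrier R" "b \<in> carrier R - {\<zero>}" "c \<in> carrier R" "d \<in> carrier R - {\<zero>}"
  shows "fraction R a b \<oplus>\<^bsub>fraction_field R\<^esub> fraction R c d =
    fraction R ((a \<otimes> d) \<oplus> (c \<otimes> b)) (b \<otimes> d)"
proof -
  have "fraction R ((x \<otimes> w) \<oplus> (z \<otimes> y)) (y \<otimes> w) = fraction R ((a \<otimes> d) \<oplus> (c \<otimes> b)) (b \<otimes> d)"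
    if "(x, y) \<in> fraction R a b" "(z, w) \<in> fraction R c d" for x y z w
  proof -
    note m1 = fraction_memD[OF that(1) assms(1,2)]
    note m2 = fraction_memD[OF that(2) assms(3,4)]
    note c = m1(1,2) m2(1,2) assms
    have "((x \<otimes> w) \<oplus> (z \<otimes> y)) \<otimes> (b \<otimes> d) = ((x \<otimes> b) \<otimes> (w \<otimes> d)) \<oplus> ((z \<otimes> d) \<otimes> (y \<otimes> b))"
      using c by (simp add: l_distr r_distr m_ac)
    also have "\<dots> = ((a \<otimes> y) \<otimes> (w \<otimes> d)) \<oplus> ((c \<otimes> w) \<otimes> (y \<otimes> b))" unfolding m1(3) m2(3) ..
    also have "\<dots> = ((a \<otimes> d) \<oplus> (c \<otimes> b)) \<otimes> (y \<otimes> w)" using c by (simp add: l_distr r_distr m_ac)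
    finally show ?thesis using c by (subst fraction_eq_iff) (simp_all add: integral_iff)
  qed
  moreover have "fraction R a b \<noteq> {}" "fraction R c d \<noteq> {}"
    using assms by (auto simp: fraction_def)
  ultimately show ?thesis
    by (simp add: fraction_field_def case_prod_beta' cong: SUP_cong)
qed

end

end

theory Submission
  imports Defs
begin

text \<open>
  Elements of \<open>sper(A)\<close> are the orderings of \<open>A\<close>: the prime support of \<open>\<sigma>\<close> is the zero set of \<open>\<sigma>\<close>, and
  the sign of a fraction \<open>x / y\<close> in the residue field at the support is \<open>\<sigma>(x) \<sigma>(y)\<close>. Evaluating a
  section \<open>f \<in> V(A)\<close> at the support of \<open>\<sigma>\<close> therefore extends \<open>\<sigma>\<close> to \<open>V(A)\<close>, and every ordering of
  \<open>V(A)\<close> arises in this way (\<open>extend_ordering\<close>, \<open>extend_restr\<close>). So \<open>A\<close> and \<open>V(A)\<close> have the same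
  orderings, and \<open>V(A)\<close> only has more sign functions: it contains the indicator functions of the
  constructible sets.

  A representation \<open>Q(A) \<cong> B /\<^sub>m S\<close> forces these indicator functions into \<open>Q(A)\<close>. Signs satisfy
  \<open>y\<^sup>3 = y\<close>; if \<open>x \<in> B\<close> represents \<open>y\<close>, this reads \<open>x\<^sup>3 s = x t\<close> with \<open>s, t \<in> S\<close>. The element
  \<open>c = t - x\<^sup>2 s\<close>, which exists because the addition of \<open>B\<close> is single-valued, is killed by \<open>x\<close> and lies
  in the multivalued sum \<open>1 - x\<^sup>2\<close>, so its sign is exactly \<open>1 - y\<^sup>2\<close>
  (\<open>sign_complemented_if_marshall_represented\<close>). With such indicator functions local solutions can be
  glued, and the compactness of the space of orderings shows that the signs of any section of \<open>V(A)\<close>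
  are the signs of an element of \<open>A\<close>, compatibly with sums (\<open>signs_of_sections_from_ring\<close>).

  In a von Neumann regular ring, a Positivstellensatz shows that two elements with the same sign at
  every ordering are equal up to factors in \<open>1 + \<Sum>V\<^sup>2\<close> (\<open>marshall_equivalent_if_same_signs\<close>). Together
  these facts say that the class of \<open>a \<in> A\<close> in \<open>V(A) /\<^sub>m (1 + \<Sum>V(A)\<^sup>2)\<close> depends only on the sign function
  of \<open>a\<close>, and that this identifies \<open>Q(A)\<close> with the whole quotient. The only tool from infinite
  combinatorics is the existence of an ordering above a proper preordering (\<open>exists_ordering\<close>), a
  consequence of Zorn's lemma; the compactness statement and the Positivstellensatz are both obtained
  by applying it to suitable preorderings.
\<close>

section \<open>Orderings of a commutative ring\<close>

abbreviation orderings :: "('a, 'm) ring_scheme \<Rightarrow> ('a \<Rightarrow> int) set"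
  where "orderings R \<equiv> sper (multiring_of_ring R)"

definition ring_preordering :: "('a, 'm) ring_scheme \<Rightarrow> 'a set \<Rightarrow> bool"
  where "ring_preordering R P \<longleftrightarrow> P \<subseteq> carrier R \<and> (\<forall>a \<in> carrier R. a \<otimes>\<^bsub>R\<^esub> a \<in> P) \<and>
    (\<forall>a \<in> P. \<forall>b \<in> P. a \<oplus>\<^bsub>R\<^esub> b \<in> P \<and> a \<otimes>\<^bsub>R\<^esub> b \<in> P) \<and> \<ominus>\<^bsub>R\<^esub> \<one>\<^bsub>R\<^esub> \<notin> P"

context cring
begin

text \<open>The multivalued sum of \<open>\<three>\<close> constrains the sign of a sum only if one summand has sign \<open>0\<close> or both
  signs agree; sums of opposite signs are unrestricted.\<close>

lemma orderingI:
  assumes "\<sigma> \<in> extensional (carrier R)"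
    and vals: "\<And>a. a \<in> carrier R \<Longrightarrow> \<sigma> a \<in> {-1, 0, 1}"
    and "\<And>a b. a \<in> carrier R \<Longrightarrow> b \<in> carrier R \<Longrightarrow> \<sigma> (a \<otimes> b) = \<sigma> a * \<sigma> b"
    and "\<And>a. a \<in> carrier R \<Longrightarrow> \<sigma> (\<ominus> a) = - \<sigma> a"
    and "\<sigma> \<one> = 1"
    and zero: "\<And>a b. a \<in> carrier R \<Longrightarrow> b \<in> carrier R \<Longrightarrow> \<sigma> a = 0 \<Longrightarrow> \<sigma> (a \<oplus> b) = \<sigma> b"
    and same: "\<And>a b. a \<in> carrier R \<Longrightarrow> b \<in> carrier R \<Longrightarrow> \<sigma> a = \<sigma> b \<Longrightarrow> \<sigma> (a \<oplus> b) = \<sigma> a"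
  shows "\<sigma> \<in> orderings R"
proof -
  have "\<sigma> \<zero> = - \<sigma> \<zero>" using assms(4)[of "\<zero>"] by simp
  then have z: "\<sigma> \<zero> = 0" by simp
  have "\<sigma> (b \<oplus> c) \<in> \<sigma> b \<boxplus>\<^bsub>three\<^esub> \<sigma> c" if "b \<in> carrier R" "c \<in> carrier R" for b c
    using zero[OF that] zero[OF that(2,1)] same[OF that] vals[of "b \<oplus> c"] that
    by (auto simp: three_def a_comm[of b c])
  then show ?thesis
    using assms z by (auto simp: sper_def multiring_hom_def) (auto simp: three_def)
qed

context
  fixes \<sigma> assumes \<sigma>: "\<sigma> \<in> orderings R"
begin

lemma ordering_hom: "\<sigma> \<in> multiring_hom (multiring_of_ring R) three"
  using \<sigma> by (simp add: sper_def)

lemma ordering_vals: "a \<in> carrier R \<Longrightarrow> \<sigma> a = -1 \<or> \<sigma> a = 0 \<or> \<sigma> a = 1"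
  using ordering_hom by (auto simp: multiring_hom_def three_def)

lemma ordering_mult [simp]: "a \<in> carrier R \<Longrightarrow> b \<in> carrier R \<Longrightarrow> \<sigma> (a \<otimes> b) = \<sigma> a * \<sigma> b"
  using ordering_hom by (auto simp: multiring_hom_def three_def)

lemma ordering_neg [simp]: "a \<in> carrier R \<Longrightarrow> \<sigma> (\<ominus> a) = - \<sigma> a"
  using ordering_hom by (auto simp: multiring_hom_def three_def)

lemma ordering_one [simp]: "\<sigma> \<one> = 1" and ordering_zero [simp]: "\<sigma> \<zero> = 0"
  using ordering_hom by (auto simp: multiring_hom_def three_def)

lemma ordering_add:
  assumes "a \<in> carrier R" "b \<in> carrier R"
  shows "\<sigma> (a \<oplus> b) \<in> \<sigma> a \<boxplus>\<^bsub>three\<^esub> \<sigma> b"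
  using ordering_hom assms by (auto simp: multiring_hom_def)

lemma ordering_add_zero:
  assumes "a \<in> carrier R" "b \<in> carrier R" "\<sigma> a = 0"
  shows "\<sigma> (a \<oplus> b) = \<sigma> b" "\<sigma> (b \<oplus> a) = \<sigma> b"
  using ordering_add[OF assms(1,2)] ordering_add[OF assms(2,1)] assms(3)
  by (auto simp: three_def split: if_splits)

lemma ordering_add_same:
  assumes "a \<in> carrier R" "b \<in> carrier R" "\<sigma> a = \<sigma> b"
  shows "\<sigma> (a \<oplus> b) = \<sigma> a"
  using ordering_add[OF assms(1,2)] assms(3)
  by (auto simp: three_def split: if_splits)

lemma ordering_add_nonneg:
  assumes "a \<in> carrier R" "b \<in> carrier R" "0 \<le> \<sigma> a" "0 \<le> \<sigma> b"
  shows "0 \<le> \<sigma> (a \<oplus> b)"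
  using ordering_add[OF assms(1,2)] ordering_vals[OF assms(1)] ordering_vals[OF assms(2)] assms(3,4)
  by (auto simp: three_def split: if_splits)

lemma ordering_eq_if_diff_zero:
  assumes "a \<in> carrier R" "b \<in> carrier R" "\<sigma> (a \<ominus> b) = 0"
  shows "\<sigma> a = \<sigma> b"
proof -
  have "a = (a \<ominus> b) \<oplus> b" using assms by algebra
  then show ?thesis using ordering_add_zero(1)[of "a \<ominus> b" b] assms by simp
qed

lemma ordering_sums_of_squares:
  assumes "s \<in> sums_of_squares (multiring_of_ring R)"
  shows "s \<in> carrier R \<and> 0 \<le> \<sigma> s"
  using assms by induction (auto intro: ordering_add_nonneg)

end

text \<open>Adjoining \<open>a\<close> yields \<open>P + a P\<close>, which is closed under sums and products. By maximality it cannot be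
  proper, and the stated equation is a rearrangement of \<open>-1 \<in> P + a P\<close>.\<close>

lemma maximal_preordering_not_member:
  assumes P: "ring_preordering R P" and a: "a \<in> carrier R"
  assumes max: "\<forall>Q. ring_preordering R Q \<longrightarrow> P \<subseteq> Q \<longrightarrow> Q = P"
    and "a \<notin> P"
  obtains x y where "x \<in> P" "y \<in> P" "\<ominus> (a \<otimes> y) = \<one> \<oplus> x"
proof -
  let ?Q = "{x \<oplus> a \<otimes> y | x y. x \<in> P \<and> y \<in> P}"
  have PC: "P \<subseteq> carrier R" and sq: "\<And>b. b \<in> carrier R \<Longrightarrow> b \<otimes> b \<in> P"
    and add: "\<And>b c. b \<in> P \<Longrightarrow> c \<in> P \<Longrightarrow> b \<oplus> c \<in> P"
    and mul: "\<And>b c. b \<in> P \<Longrightarrow> c \<in> P \<Longrightarrow> b \<otimes> c \<in> P"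
    using P by (auto simp: ring_preordering_def)
  have z: "\<zero> \<in> P" and o: "\<one> \<in> P" using sq[of "\<zero>"] sq[of "\<one>"] by auto
  have PQ: "P \<subseteq> ?Q"
  proof
    fix x assume "x \<in> P"
    then have "x = x \<oplus> a \<otimes> \<zero>" using PC a by auto
    then show "x \<in> ?Q" using \<open>x \<in> P\<close> z by blast
  qed
  have "a = \<zero> \<oplus> a \<otimes> \<one>" using a by simp
  then have aQ: "a \<in> ?Q" using z o by blast
  have QQ: "b \<oplus> c \<in> ?Q \<and> b \<otimes> c \<in> ?Q" if bc: "b \<in> ?Q" "c \<in> ?Q" for b c
  proof -
    obtain x y x' y' where xy: "x \<in> P" "y \<in> P" "x' \<in> P" "y' \<in> P"
      "b = x \<oplus> a \<otimes> y" "c = x' \<oplus> a \<otimes> y'" using bc by blast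
    have C: "x \<in> carrier R" "y \<in> carrier R" "x' \<in> carrier R" "y' \<in> carrier R" using xy PC by auto
    have "b \<oplus> c = (x \<oplus> x') \<oplus> a \<otimes> (y \<oplus> y')" unfolding xy using C a by (simp add: r_distr a_ac)
    moreover have "b \<otimes> c = (x \<otimes> x' \<oplus> (a \<otimes> a) \<otimes> (y \<otimes> y')) \<oplus> a \<otimes> (x \<otimes> y' \<oplus> x' \<otimes> y)"
      unfolding xy using C a by (simp add: l_distr r_distr m_ac a_ac)
    moreover have "x \<oplus> x' \<in> P" "y \<oplus> y' \<in> P" "x \<otimes> x' \<oplus> (a \<otimes> a) \<otimes> (y \<otimes> y') \<in> P"
      "x \<otimes> y' \<oplus> x' \<otimes> y \<in> P"
      using xy(1-4) add mul sq[OF a] by simp_all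
    ultimately show ?thesis by blast
  qed
  define Q where "Q = ?Q"
  have "Q \<subseteq> carrier R" using PC a by (auto simp: Q_def)
  moreover have "\<forall>b \<in> Q. \<forall>c \<in> Q. b \<oplus> c \<in> Q \<and> b \<otimes> c \<in> Q" unfolding Q_def using QQ by blast
  moreover have "\<forall>b \<in> carrier R. b \<otimes> b \<in> Q" using PQ sq by (auto simp: Q_def)
  moreover have "\<not> ring_preordering R Q" using max PQ aQ \<open>a \<notin> P\<close> by (auto simp: Q_def)
  ultimately have "\<ominus> \<one> \<in> Q" unfolding ring_preordering_def by blast
  then obtain x y where xy: "x \<in> P" "y \<in> P" and e: "\<ominus> \<one> = x \<oplus> a \<otimes> y"
    unfolding Q_def by blast
  have "x \<in> carrier R" "y \<in> carrier R" using xy PC by auto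
  then have "\<ominus> (a \<otimes> y) = x \<ominus> (x \<oplus> a \<otimes> y)" using a by algebra
  also have "\<dots> = \<one> \<oplus> x" using e[symmetric] \<open>x \<in> carrier R\<close> by simp algebra
  finally show ?thesis using that xy by blast
qed

lemma exists_maximal_preordering:
  assumes "ring_preordering R P"
  obtains M where "ring_preordering R M" "P \<subseteq> M"
    "\<forall>Q. ring_preordering R Q \<longrightarrow> M \<subseteq> Q \<longrightarrow> Q = M"
proof -
  have "\<exists>M \<in> {Q. ring_preordering R Q \<and> P \<subseteq> Q}. \<forall>X \<in> {Q. ring_preordering R Q \<and> P \<subseteq> Q}. M \<subseteq> X \<longrightarrow> X = M"
  proof (rule subset_Zorn_nonempty)
    fix C assume C: "C \<noteq> {}" "subset.chain {Q. ring_preordering R Q \<and> P \<subseteq> Q} C"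
    then have pre: "\<And>Q. Q \<in> C \<Longrightarrow> ring_preordering R Q \<and> P \<subseteq> Q" by (auto simp: subset_chain_def)
    have "a \<oplus> b \<in> \<Union>C \<and> a \<otimes> b \<in> \<Union>C" if ab: "a \<in> \<Union>C" "b \<in> \<Union>C" for a b
    proof -
      obtain Q where "Q \<in> C" "a \<in> Q" "b \<in> Q" using ab C(2) unfolding subset_chain_def by blast
      then show ?thesis using pre[of Q] unfolding ring_preordering_def by blast
    qed
    moreover have "\<Union>C \<subseteq> carrier R" "\<ominus> \<one> \<notin> \<Union>C"
      using pre unfolding ring_preordering_def by blast+
    moreover have "a \<otimes> a \<in> \<Union>C" if "a \<in> carrier R" for a
      using pre C(1) that unfolding ring_preordering_def by blast
    ultimately have "ring_preordering R (\<Union>C)"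
      unfolding ring_preordering_def by blast
    then show "\<Union>C \<in> {Q. ring_preordering R Q \<and> P \<subseteq> Q}" using pre C(1) by blast
  qed (use assms in blast)
  then obtain M where M: "ring_preordering R M" "P \<subseteq> M"
    and max: "\<forall>X \<in> {Q. ring_preordering R Q \<and> P \<subseteq> Q}. M \<subseteq> X \<longrightarrow> X = M" by auto
  show ?thesis
    using that[OF M] max M(2) by auto
qed

text \<open>A maximal preordering \<open>M\<close> satisfies \<open>M \<union> -M = R\<close> and \<open>M \<inter> -M\<close> is a prime ideal, so the sign with
  respect to \<open>M\<close> is an ordering. Both properties come from multiplying two equations of the shape
  given by \<open>maximal_preordering_not_member\<close>.\<close>

theorem exists_ordering:
  assumes "ring_preordering R P"
  obtains \<sigma> where "\<sigma> \<in> orderings R" "\<forall>a \<in> P. 0 \<le> \<sigma> a"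
proof -
  obtain M where M: "ring_preordering R M" "P \<subseteq> M" and max: "\<forall>Q. ring_preordering R Q \<longrightarrow> M \<subseteq> Q \<longrightarrow> Q = M"
    by (rule exists_maximal_preordering[OF assms])
  have MC: "M \<subseteq> carrier R" and sq: "\<And>b. b \<in> carrier R \<Longrightarrow> b \<otimes> b \<in> M"
    and add: "\<And>b c. b \<in> M \<Longrightarrow> c \<in> M \<Longrightarrow> b \<oplus> c \<in> M"
    and mul: "\<And>b c. b \<in> M \<Longrightarrow> c \<in> M \<Longrightarrow> b \<otimes> c \<in> M" and m1: "\<ominus> \<one> \<notin> M"
    using M(1) by (auto simp: ring_preordering_def)
  have z: "\<zero> \<in> M" and o: "\<one> \<in> M" using sq[of "\<zero>"] sq[of "\<one>"] by auto
  note ext = maximal_preordering_not_member[OF M(1) _ max]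
  \<comment> \<open>The product of the two right-hand sides is \<open>1 + (x + x' + x x')\<close>, while the product of the
    left-hand sides lies in \<open>-M\<close>; this puts \<open>-1\<close> into \<open>M\<close>.\<close>
  have product: False
    if "a \<in> carrier R" "b \<in> carrier R" "\<ominus> (a \<otimes> b) \<in> M" "y \<in> M" "x \<in> M" "y' \<in> M" "x' \<in> M"
      "a \<otimes> y = \<one> \<oplus> x" "b \<otimes> y' = \<one> \<oplus> x'" for a b x y x' y'
  proof -
    have C: "x \<in> carrier R" "y \<in> carrier R" "x' \<in> carrier R" "y' \<in> carrier R" using that MC by auto
    have "\<ominus> \<one> = x \<oplus> x' \<oplus> x \<otimes> x' \<ominus> (\<one> \<oplus> x) \<otimes> (\<one> \<oplus> x')" using C by algebra
    also have "\<dots> = x \<oplus> x' \<oplus> x \<otimes> x' \<ominus> (a \<otimes> y) \<otimes> (b \<otimes> y')" unfolding that(8,9) ..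
    also have "\<dots> = x \<oplus> x' \<oplus> x \<otimes> x' \<oplus> (\<ominus> (a \<otimes> b)) \<otimes> (y \<otimes> y')" using C that(1,2) by algebra
    also have "\<dots> \<in> M" using add mul that by simp
    finally show False using m1 by blast
  qed
  have tot: "\<ominus> a \<in> M" if a: "a \<in> carrier R" "a \<notin> M" for a
  proof (rule ccontr)
    assume n: "\<ominus> a \<notin> M"
    obtain x y where 1: "x \<in> M" "y \<in> M" "\<ominus> (a \<otimes> y) = \<one> \<oplus> x" using ext[OF a(1) a(2)] by blast
    obtain x' y' where 2: "x' \<in> M" "y' \<in> M" "\<ominus> (\<ominus> a \<otimes> y') = \<one> \<oplus> x'"
      using ext[OF a_inv_closed[OF a(1)] n] by blast
    have C: "y \<in> carrier R" "y' \<in> carrier R" using 1 2 MC by auto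
    show False
    proof (rule product[of "\<ominus> a" a y x y' x'])
      show "\<ominus> (\<ominus> a \<otimes> a) \<in> M" using sq[OF a(1)] a(1) by (simp add: l_minus)
      show "\<ominus> a \<otimes> y = \<one> \<oplus> x" using 1 C a by (simp add: l_minus)
      show "a \<otimes> y' = \<one> \<oplus> x'" using 2 C a by (simp add: l_minus)
    qed (use a 1 2 in auto)
  qed
  have supp_mult: "a \<otimes> b \<in> M" if "a \<in> M" "\<ominus> a \<in> M" "b \<in> carrier R" for a b
  proof (cases "b \<in> M")
    case False
    then have "\<ominus> a \<otimes> \<ominus> b \<in> M" using that tot mul by blast
    then show ?thesis using that MC by (simp add: l_minus r_minus subset_iff)
  qed (use that mul in blast)
  have prime: False if ab: "a \<in> M" "b \<in> M" "\<ominus> a \<notin> M" "\<ominus> b \<notin> M" "\<ominus> (a \<otimes> b) \<in> M" for a b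
  proof -
    have C: "a \<in> carrier R" "b \<in> carrier R" using ab MC by auto
    obtain x y where 1: "x \<in> M" "y \<in> M" "\<ominus> (\<ominus> a \<otimes> y) = \<one> \<oplus> x"
      using ext[OF a_inv_closed[OF C(1)] ab(3)] by blast
    obtain x' y' where 2: "x' \<in> M" "y' \<in> M" "\<ominus> (\<ominus> b \<otimes> y') = \<one> \<oplus> x'"
      using ext[OF a_inv_closed[OF C(2)] ab(4)] by blast
    have "y \<in> carrier R" "y' \<in> carrier R" using 1 2 MC by auto
    then show False using product[OF C ab(5) 1(2,1) 2(2,1)] 1 2 C by (simp add: l_minus)
  qed
  define \<sigma> where "\<sigma> = (\<lambda>a \<in> carrier R. if a \<in> M \<and> \<ominus> a \<in> M then 0 else if a \<in> M then 1 else -1 :: int)"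
  have cancel: "b \<in> M" if "a \<in> carrier R" "b \<in> carrier R" "\<ominus> a \<in> M" "a \<oplus> b \<in> M" for a b
  proof -
    have "b = \<ominus> a \<oplus> (a \<oplus> b)" using that by algebra
    then show ?thesis using that add by metis
  qed
  have "\<sigma> \<in> orderings R"
  proof (rule orderingI)
    show "\<sigma> \<in> extensional (carrier R)" by (simp add: \<sigma>_def)
    show "\<sigma> a \<in> {-1, 0, 1}" if "a \<in> carrier R" for a using that by (simp add: \<sigma>_def)
    show neg: "\<sigma> (\<ominus> a) = - \<sigma> a" if "a \<in> carrier R" for a using that tot by (auto simp: \<sigma>_def)
    show "\<sigma> \<one> = 1" using o m1 by (simp add: \<sigma>_def)
    have pos: "\<sigma> (a \<otimes> b) = \<sigma> a * \<sigma> b" if "a \<in> M" "b \<in> M" for a b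
    proof -
      have C: "a \<in> carrier R" "b \<in> carrier R" using that MC by auto
      have "\<ominus> (a \<otimes> b) \<in> M" if "\<ominus> a \<in> M"
        using supp_mult[of "\<ominus> a" b] C \<open>a \<in> M\<close> that by (simp add: l_minus)
      moreover have "\<ominus> (a \<otimes> b) \<in> M" if "\<ominus> b \<in> M"
        using supp_mult[of "\<ominus> b" a] C \<open>b \<in> M\<close> that by (simp add: l_minus r_minus m_comm)
      ultimately show ?thesis using that C prime[OF that] mul[OF that] by (auto simp: \<sigma>_def)
    qed
    show "\<sigma> (a \<otimes> b) = \<sigma> a * \<sigma> b" if C: "a \<in> carrier R" "b \<in> carrier R" for a b
    proof -
      have n: "\<sigma> (\<ominus> a \<otimes> b) = - \<sigma> (a \<otimes> b)" "\<sigma> (a \<otimes> \<ominus> b) = - \<sigma> (a \<otimes> b)"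
        "\<sigma> (\<ominus> a \<otimes> \<ominus> b) = \<sigma> (a \<otimes> b)"
        using C neg[of "a \<otimes> b"] by (simp_all add: l_minus r_minus)
      consider "a \<in> M" "b \<in> M" | "\<ominus> a \<in> M" "b \<in> M" | "a \<in> M" "\<ominus> b \<in> M" | "\<ominus> a \<in> M" "\<ominus> b \<in> M"
        using tot C by blast
      then show ?thesis
        using pos[of a b] pos[of "\<ominus> a" b] pos[of a "\<ominus> b"] pos[of "\<ominus> a" "\<ominus> b"]
        unfolding n neg[OF C(1)] neg[OF C(2)] by cases simp_all
    qed
    have nneg: "\<sigma> a = -1 \<longleftrightarrow> a \<notin> M" "\<sigma> a = 0 \<longleftrightarrow> a \<in> M \<and> \<ominus> a \<in> M" "\<sigma> a = 1 \<longleftrightarrow> \<ominus> a \<notin> M"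
      if "a \<in> carrier R" for a
      using tot that by (auto simp: \<sigma>_def)
    show zero: "\<sigma> (a \<oplus> b) = \<sigma> b" if C: "a \<in> carrier R" "b \<in> carrier R" "\<sigma> a = 0" for a b
    proof -
      have a: "a \<in> M" "\<ominus> a \<in> M" using nneg C by auto
      have "a \<oplus> b \<in> M \<longleftrightarrow> b \<in> M" using cancel[of a b] add a C by blast
      moreover have "\<ominus> (a \<oplus> b) = \<ominus> a \<oplus> \<ominus> b" using C by algebra
      moreover have "\<ominus> a \<oplus> \<ominus> b \<in> M \<longleftrightarrow> \<ominus> b \<in> M"
        using cancel[of "\<ominus> a" "\<ominus> b"] add[of "\<ominus> a" "\<ominus> b"] a C by auto
      ultimately show ?thesis using C by (simp add: \<sigma>_def)
    qed
    have p: "\<sigma> (a \<oplus> b) = 1" if C: "a \<in> carrier R" "b \<in> carrier R" "\<sigma> a = 1" "\<sigma> b = 1" for a b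
    proof -
      have a: "a \<in> M" "\<ominus> a \<notin> M" "b \<in> M" using nneg[OF C(1)] nneg[OF C(2)] C tot by auto
      have "\<ominus> (a \<oplus> b) \<in> M \<Longrightarrow> \<ominus> a \<in> M"
        using add[of b "\<ominus> (a \<oplus> b)"] a C by (simp add: minus_add a_comm[of a b] r_neg2)
      then show ?thesis using nneg[of "a \<oplus> b"] a C by blast
    qed
    show "\<sigma> (a \<oplus> b) = \<sigma> a" if C: "a \<in> carrier R" "b \<in> carrier R" "\<sigma> a = \<sigma> b" for a b
    proof -
      have "\<ominus> (a \<oplus> b) = \<ominus> a \<oplus> \<ominus> b" using C by algebra
      then have "- \<sigma> (a \<oplus> b) = \<sigma> (\<ominus> a \<oplus> \<ominus> b)" using neg[of "a \<oplus> b"] C by simp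
      moreover have "\<sigma> a \<in> {-1, 0, 1}" using C by (simp add: \<sigma>_def)
      ultimately show ?thesis using zero[OF C(1,2)] p[OF C(1,2)] p[of "\<ominus> a" "\<ominus> b"] neg C by auto
    qed
  qed
  moreover have "\<forall>a \<in> P. 0 \<le> \<sigma> a" using M(2) MC by (auto simp: \<sigma>_def)
  ultimately show ?thesis using that by blast
qed

text \<open>Let \<open>P\<close> be the set of all elements that are nonnegative wherever some finite part of \<open>G\<close> is. It
  contains \<open>G\<close> and is closed under sums and products, because the union of two finite parts is finite.
  If no finite part of \<open>G\<close> sufficed, \<open>P\<close> would be proper, and an ordering above \<open>P\<close> would be nonnegative
  on all of \<open>G\<close>.\<close>

theorem orderings_compact:
  assumes G: "G \<subseteq> carrier R" and none: "\<And>\<sigma>. \<sigma> \<in> orderings R \<Longrightarrow> \<exists>g \<in> G. \<sigma> g < 0"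
  obtains F where "finite F" "F \<subseteq> G" "\<forall>\<sigma> \<in> orderings R. \<exists>g \<in> F. \<sigma> g < 0"
proof (rule ccontr)
  assume "\<not> thesis"
  note no_cover = this
  define P where "P = {x \<in> carrier R. \<exists>F. finite F \<and> F \<subseteq> G \<and>
    (\<forall>\<sigma> \<in> orderings R. (\<forall>g \<in> F. 0 \<le> \<sigma> g) \<longrightarrow> 0 \<le> \<sigma> x)}"
  have "ring_preordering R P"
    unfolding ring_preordering_def
  proof (intro conjI ballI)
    show "P \<subseteq> carrier R" by (auto simp: P_def)
    show "a \<otimes> a \<in> P" if "a \<in> carrier R" for a
      using that by (auto simp: P_def intro!: exI[of _ "{}"])
    have "a \<oplus> b \<in> P \<and> a \<otimes> b \<in> P" if ab: "a \<in> P" "b \<in> P" for a b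
    proof -
      from ab obtain F F' where F: "a \<in> carrier R" "b \<in> carrier R"
        "finite F" "F \<subseteq> G" "finite F'" "F' \<subseteq> G"
        "\<And>\<sigma>. \<sigma> \<in> orderings R \<Longrightarrow> \<forall>g \<in> F. 0 \<le> \<sigma> g \<Longrightarrow> 0 \<le> \<sigma> a"
        "\<And>\<sigma>. \<sigma> \<in> orderings R \<Longrightarrow> \<forall>g \<in> F'. 0 \<le> \<sigma> g \<Longrightarrow> 0 \<le> \<sigma> b"
        by (auto simp: P_def)
      then have "finite (F \<union> F')" "F \<union> F' \<subseteq> G" by auto
      moreover have "0 \<le> \<sigma> (a \<oplus> b) \<and> 0 \<le> \<sigma> (a \<otimes> b)"
        if "\<sigma> \<in> orderings R" "\<forall>g \<in> F \<union> F'. 0 \<le> \<sigma> g" for \<sigma>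
        using F(7,8)[OF that(1)] that F(1,2) by (auto intro: ordering_add_nonneg)
      ultimately show ?thesis using F(1,2) unfolding P_def by blast
    qed
    then show "a \<oplus> b \<in> P" "a \<otimes> b \<in> P" if "a \<in> P" "b \<in> P" for a b
      using that by blast+
    show "\<ominus> \<one> \<notin> P"
    proof
      assume "\<ominus> \<one> \<in> P"
      then obtain F where F: "finite F" "F \<subseteq> G"
        "\<forall>\<sigma> \<in> orderings R. (\<forall>g \<in> F. 0 \<le> \<sigma> g) \<longrightarrow> 0 \<le> \<sigma> (\<ominus> \<one>)"
        unfolding P_def by blast
      have "\<exists>g \<in> F. \<sigma> g < 0" if "\<sigma> \<in> orderings R" for \<sigma>
        using bspec[OF F(3) that] that by (auto simp: not_le[symmetric])
      then show False using no_cover that F(1,2) by blast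
    qed
  qed
  then obtain \<sigma> where \<sigma>: "\<sigma> \<in> orderings R" "\<forall>a \<in> P. 0 \<le> \<sigma> a"
    by (rule exists_ordering)
  have "G \<subseteq> P"
  proof
    fix g assume "g \<in> G"
    then have "finite {g} \<and> {g} \<subseteq> G \<and> (\<forall>\<sigma> \<in> orderings R. (\<forall>g' \<in> {g}. 0 \<le> \<sigma> g') \<longrightarrow> 0 \<le> \<sigma> g)"
      by auto
    then show "g \<in> P" using \<open>g \<in> G\<close> G unfolding P_def by blast
  qed
  then show False using none[OF \<sigma>(1)] \<sigma>(2) by force
qed

end

section \<open>Sums of squares and a Positivstellensatz\<close>

abbreviation sum_squares :: "('a, 'm) ring_scheme \<Rightarrow> 'a set"
  where "sum_squares R \<equiv> sums_of_squares (multiring_of_ring R)"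

abbreviation one_plus_sum_squares :: "('a, 'm) ring_scheme \<Rightarrow> 'a set"
  where "one_plus_sum_squares R \<equiv> one_plus_sums_of_squares (multiring_of_ring R)"

context cring
begin

lemma sum_squares_closed: "x \<in> sum_squares R \<Longrightarrow> x \<in> carrier R"
  by (induction rule: sums_of_squares.induct) auto

lemma sum_squares_square: "a \<in> carrier R \<Longrightarrow> a \<otimes> a \<in> sum_squares R"
  using sums_of_squares.square[of a "multiring_of_ring R"] by simp

lemma sum_squares_add_square:
  "x \<in> sum_squares R \<Longrightarrow> a \<in> carrier R \<Longrightarrow> x \<oplus> a \<otimes> a \<in> sum_squares R"
  using sums_of_squares.add_square[of x "multiring_of_ring R" a] by simp

lemma sum_squares_induct [consumes 1, case_names square add_square]:
  assumes "x \<in> sum_squares R"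
    and "\<And>a. a \<in> carrier R \<Longrightarrow> Q (a \<otimes> a)"
    and "\<And>x a. x \<in> sum_squares R \<Longrightarrow> x \<in> carrier R \<Longrightarrow> Q x \<Longrightarrow> a \<in> carrier R \<Longrightarrow> Q (x \<oplus> a \<otimes> a)"
  shows "Q x"
  using assms(1) by induction (use assms(2,3) sum_squares_closed in auto)

lemma sum_squares_zero: "\<zero> \<in> sum_squares R" and sum_squares_one: "\<one> \<in> sum_squares R"
  using sum_squares_square[of "\<zero>"] sum_squares_square[of "\<one>"] by auto

lemma sum_squares_add:
  assumes "y \<in> sum_squares R" "x \<in> sum_squares R"
  shows "x \<oplus> y \<in> sum_squares R"
  using assms
proof (induction rule: sum_squares_induct)
  case (add_square y a)
  then have "x \<oplus> (y \<oplus> a \<otimes> a) = (x \<oplus> y) \<oplus> a \<otimes> a"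
    using sum_squares_closed by (simp add: a_assoc)
  then show ?case using add_square by (simp add: sum_squares_add_square)
qed (simp add: sum_squares_add_square)

lemma sum_squares_mult_square:
  assumes "x \<in> sum_squares R" "b \<in> carrier R"
  shows "x \<otimes> (b \<otimes> b) \<in> sum_squares R"
  using assms
proof (induction rule: sum_squares_induct)
  case (square a)
  then have "a \<otimes> a \<otimes> (b \<otimes> b) = (a \<otimes> b) \<otimes> (a \<otimes> b)" by (simp add: m_ac)
  then show ?case using square by (simp add: sum_squares_square)
next
  case (add_square x a)
  then have "(x \<oplus> a \<otimes> a) \<otimes> (b \<otimes> b) = x \<otimes> (b \<otimes> b) \<oplus> (a \<otimes> b) \<otimes> (a \<otimes> b)"
    by (simp add: l_distr r_distr m_ac)
  then show ?case using add_square by (simp add: sum_squares_add_square)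
qed

lemma sum_squares_mult:
  assumes "y \<in> sum_squares R" "x \<in> sum_squares R"
  shows "x \<otimes> y \<in> sum_squares R"
  using assms
proof (induction rule: sum_squares_induct)
  case (add_square y a)
  then show ?case
    using sum_squares_add[of "x \<otimes> (a \<otimes> a)" "x \<otimes> y"] sum_squares_closed
    by (simp add: r_distr sum_squares_mult_square)
qed (simp add: sum_squares_mult_square)

lemma one_plus_sum_squares_iff: "s \<in> one_plus_sum_squares R \<longleftrightarrow> (\<exists>x \<in> sum_squares R. s = \<one> \<oplus> x)"
  by (auto simp: one_plus_sums_of_squares_def)

lemma one_in_one_plus_sum_squares: "\<one> \<in> one_plus_sum_squares R"
  using sum_squares_zero unfolding one_plus_sum_squares_iff by force

lemma one_plus_sum_squares_closed: "s \<in> one_plus_sum_squares R \<Longrightarrow> s \<in> carrier R"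
  by (auto simp: one_plus_sum_squares_iff sum_squares_closed)

lemma one_plus_sum_squares_add:
  assumes "s \<in> one_plus_sum_squares R" "x \<in> sum_squares R"
  shows "s \<oplus> x \<in> one_plus_sum_squares R"
proof -
  obtain y where y: "y \<in> sum_squares R" "s = \<one> \<oplus> y" using assms by (auto simp: one_plus_sum_squares_iff)
  then have "s \<oplus> x = \<one> \<oplus> (y \<oplus> x)" using assms sum_squares_closed by (simp add: a_assoc)
  then show ?thesis using sum_squares_add[OF assms(2) y(1)] by (auto simp: one_plus_sum_squares_iff)
qed

lemma one_plus_sum_squares_mult:
  assumes "s \<in> one_plus_sum_squares R" "t \<in> one_plus_sum_squares R"
  shows "s \<otimes> t \<in> one_plus_sum_squares R"
proof -
  obtain x y where xy: "x \<in> sum_squares R" "s = \<one> \<oplus> x" "y \<in> sum_squares R" "t = \<one> \<oplus> y"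
    using assms by (auto simp: one_plus_sum_squares_iff)
  then have "s \<otimes> t = s \<oplus> (y \<oplus> x \<otimes> y)"
    using sum_squares_closed by (simp add: l_distr r_distr a_ac)
  then show ?thesis
    using one_plus_sum_squares_add[OF assms(1)] xy sum_squares_add sum_squares_mult by simp
qed

lemma submonoid_one_plus_sum_squares: "submonoid (one_plus_sum_squares R) (multiring_of_ring R)"
  by standard
    (auto simp: one_in_one_plus_sum_squares one_plus_sum_squares_mult one_plus_sum_squares_closed)

lemma ordering_one_plus_sum_squares:
  assumes "\<sigma> \<in> orderings R" "s \<in> one_plus_sum_squares R"
  shows "\<sigma> s = 1"
proof -
  obtain x where x: "x \<in> sum_squares R" "s = \<one> \<oplus> x" using assms by (auto simp: one_plus_sum_squares_iff)
  then show ?thesis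
    using ordering_sums_of_squares[OF assms(1) x(1)] ordering_vals[OF assms(1), of x]
      ordering_add_same[OF assms(1), of "\<one>" x] ordering_add_zero(2)[OF assms(1), of x "\<one>"] assms(1)
    by auto
qed

text \<open>Here \<open>e = h g\<close> is the idempotent with \<open>h R = e R\<close>, so on the factor \<open>e R\<close> the claim is the identity
  \<open>h q = 1 + p\<close> for a unit \<open>h\<close> that is positive. The preordering \<open>P\<close> used in the proof consists of the
  elements that agree on \<open>e R\<close> with some \<open>p - h q\<close> and are arbitrary on \<open>(1 - e) R\<close>. It contains \<open>-h\<close> and
  \<open>e - 1\<close>, so an ordering above it would have \<open>\<sigma>(h) = 0\<close> and \<open>\<sigma>(e) = 1\<close>, although \<open>\<sigma>(h) = 0\<close> entails
  \<open>\<sigma>(e) = 0\<close>. Hence \<open>-1 \<in> P\<close>, which is the claim.\<close>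

lemma positivstellensatz_on_support:
  assumes h: "h \<in> carrier R" "g \<in> carrier R" "h \<otimes> g \<otimes> h = h"
    and nonneg: "\<And>\<sigma>. \<sigma> \<in> orderings R \<Longrightarrow> 0 \<le> \<sigma> h"
  obtains p q where "p \<in> sum_squares R" "q \<in> sum_squares R" "h \<otimes> q = (h \<otimes> g) \<otimes> (\<one> \<oplus> p)"
proof -
  define e where "e = h \<otimes> g"
  have e: "e \<in> carrier R" "e \<otimes> e = e" "e \<otimes> h = h"
    using h by (auto simp: e_def m_ac)
  define P where "P = {x \<in> carrier R. \<exists>p \<in> sum_squares R. \<exists>q \<in> sum_squares R. e \<otimes> x = e \<otimes> p \<ominus> h \<otimes> q}"
  have PI: "x \<in> P" if "x \<in> carrier R" "p \<in> sum_squares R" "q \<in> sum_squares R"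
    "e \<otimes> x = e \<otimes> p \<ominus> h \<otimes> q" for x p q
    using that by (auto simp: P_def)
  note cl = sum_squares_closed
  have m1P: "\<ominus> \<one> \<in> P"
  proof (rule ccontr)
    assume m1: "\<ominus> \<one> \<notin> P"
    have "a \<oplus> b \<in> P \<and> a \<otimes> b \<in> P" if ab: "a \<in> P" "b \<in> P" for a b
    proof -
      from ab obtain p q p' q' where *: "a \<in> carrier R" "b \<in> carrier R"
        "p \<in> sum_squares R" "q \<in> sum_squares R" "p' \<in> sum_squares R" "q' \<in> sum_squares R"
        "e \<otimes> a = e \<otimes> p \<ominus> h \<otimes> q" "e \<otimes> b = e \<otimes> p' \<ominus> h \<otimes> q'"
        by (auto simp: P_def)
      note C = *(1,2) cl[OF *(3)] cl[OF *(4)] cl[OF *(5)] cl[OF *(6)] e(1) h(1)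
      have "e \<otimes> (a \<oplus> b) = (e \<otimes> p \<ominus> h \<otimes> q) \<oplus> (e \<otimes> p' \<ominus> h \<otimes> q')"
        unfolding *(7,8)[symmetric] using C by (simp add: r_distr)
      also have "\<dots> = e \<otimes> (p \<oplus> p') \<ominus> h \<otimes> (q \<oplus> q')" using C by algebra
      finally have "a \<oplus> b \<in> P"
        using * by (intro PI[of _ "p \<oplus> p'" "q \<oplus> q'"]) (simp_all add: sum_squares_add)
      have "e \<otimes> (a \<otimes> b) = (e \<otimes> e) \<otimes> (a \<otimes> b)" by (simp add: e(2))
      also have "\<dots> = (e \<otimes> a) \<otimes> (e \<otimes> b)" using C by (simp add: m_ac)
      also have "\<dots> = (e \<otimes> e) \<otimes> (p \<otimes> p') \<oplus> (h \<otimes> h) \<otimes> (q \<otimes> q') \<ominus> (e \<otimes> h) \<otimes> (p \<otimes> q' \<oplus> p' \<otimes> q)"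
        unfolding *(7,8) using C by algebra
      also have "\<dots> = e \<otimes> (p \<otimes> p') \<oplus> ((e \<otimes> h) \<otimes> h) \<otimes> (q \<otimes> q') \<ominus> h \<otimes> (p \<otimes> q' \<oplus> p' \<otimes> q)"
        by (simp only: e)
      also have "\<dots> = e \<otimes> (p \<otimes> p' \<oplus> (h \<otimes> h) \<otimes> (q \<otimes> q')) \<ominus> h \<otimes> (p \<otimes> q' \<oplus> p' \<otimes> q)"
        using C by algebra
      finally have "a \<otimes> b \<in> P"
        using * h
        by (intro PI[of _ "p \<otimes> p' \<oplus> (h \<otimes> h) \<otimes> (q \<otimes> q')" "p \<otimes> q' \<oplus> p' \<otimes> q"])
          (simp_all add: sum_squares_add sum_squares_mult sum_squares_square)
      with \<open>a \<oplus> b \<in> P\<close> show ?thesis ..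
    qed
    moreover have "a \<otimes> a \<in> P" if "a \<in> carrier R" for a
      using that e h sum_squares_square[OF that] sum_squares_zero
      by (intro PI[of _ "a \<otimes> a" "\<zero>"]) (simp_all add: minus_eq)
    moreover have "P \<subseteq> carrier R" by (auto simp: P_def)
    ultimately have "ring_preordering R P" using m1 unfolding ring_preordering_def by blast
    then obtain \<sigma> where \<sigma>: "\<sigma> \<in> orderings R" "\<forall>a \<in> P. 0 \<le> \<sigma> a"
      by (rule exists_ordering)
    have "\<ominus> h \<in> P"
      using h e sum_squares_zero sum_squares_one
      by (intro PI[of _ "\<zero>" "\<one>"]) (simp_all add: minus_eq r_minus)
    then have "\<sigma> h = 0" using bspec[OF \<sigma>(2), of "\<ominus> h"] nonneg[OF \<sigma>(1)] \<sigma>(1) h by simp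
    then have "\<sigma> e = 0" using \<sigma>(1) h by (simp add: e_def)
    then have "\<sigma> (e \<oplus> \<ominus> \<one>) = -1"
      using ordering_add_zero(1)[OF \<sigma>(1), of e "\<ominus> \<one>"] \<sigma>(1) e by simp
    moreover have "e \<oplus> \<ominus> \<one> \<in> P"
      using h e sum_squares_zero
      by (intro PI[of _ "\<zero>" "\<zero>"]) (simp_all add: minus_eq r_distr r_minus r_neg)
    ultimately show False using \<sigma>(2) by fastforce
  qed
  then obtain p q where pq: "p \<in> sum_squares R" "q \<in> sum_squares R"
    "e \<otimes> \<ominus> \<one> = e \<otimes> p \<ominus> h \<otimes> q"
    by (auto simp: P_def)
  have C: "p \<in> carrier R" "q \<in> carrier R" using pq cl by auto
  have "h \<otimes> q = e \<otimes> p \<ominus> (e \<otimes> p \<ominus> h \<otimes> q)" using C e(1) h(1) by algebra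
  also have "\<dots> = e \<otimes> (\<one> \<oplus> p)"
    unfolding pq(3)[symmetric] using C e(1) by algebra
  finally show ?thesis using that pq by (simp add: e_def)
qed

text \<open>The idempotent cuts out a factor without orderings, in which \<open>-1\<close> is a sum of squares. This is
  \<open>positivstellensatz_on_support\<close> for \<open>h = -e\<close> with \<open>g = -1\<close>.\<close>

lemma annihilated_if_zero_at_all_orderings:
  assumes e: "e \<in> carrier R" "e \<otimes> e = e" and zero: "\<And>\<sigma>. \<sigma> \<in> orderings R \<Longrightarrow> \<sigma> e = 0"
  obtains s where "s \<in> one_plus_sum_squares R" "e \<otimes> s = \<zero>"
proof -
  have "\<ominus> e \<otimes> \<ominus> \<one> \<otimes> \<ominus> e = \<ominus> e" using e by (simp add: l_minus r_minus)
  moreover have "0 \<le> \<sigma> (\<ominus> e)" if "\<sigma> \<in> orderings R" for \<sigma>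
    using zero[OF that] that e by simp
  ultimately obtain p q where pq: "p \<in> sum_squares R" "q \<in> sum_squares R"
    "\<ominus> e \<otimes> q = (\<ominus> e \<otimes> \<ominus> \<one>) \<otimes> (\<one> \<oplus> p)"
    by (rule positivstellensatz_on_support[rotated 2]) (use e in auto)
  have C: "p \<in> carrier R" "q \<in> carrier R" using pq sum_squares_closed by auto
  then have "e \<otimes> (\<one> \<oplus> (p \<oplus> q)) = (\<ominus> e \<otimes> \<ominus> \<one>) \<otimes> (\<one> \<oplus> p) \<ominus> \<ominus> e \<otimes> q" using e(1) by algebra
  also have "\<dots> = \<zero>" unfolding pq(3) using C e by algebra
  finally show ?thesis
    using that[of "\<one> \<oplus> (p \<oplus> q)"] pq sum_squares_add by (auto simp: one_plus_sum_squares_iff)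
qed

end

text \<open>Let \<open>e\<close> and \<open>f\<close> be the idempotents with \<open>a R = e R\<close> and \<open>b R = f R\<close>. Since \<open>a b\<close> is nowhere negative,
  \<open>a b q = e f u\<close> with \<open>u \<in> 1 + \<Sum>R\<^sup>2\<close>. On \<open>e f R\<close> this gives \<open>a (q b\<^sup>2) = b u\<close> and \<open>a u = b (q a\<^sup>2)\<close>, and the sum
  of the two equations is \<open>a s = b t\<close> with \<open>s = u + q b\<^sup>2\<close> and \<open>t = u + q a\<^sup>2\<close>. The idempotents
  \<open>e (1 - f)\<close> and \<open>f (1 - e)\<close> vanish at all orderings, so they are annihilated by elements \<open>s1\<close> and \<open>s2\<close>
  of \<open>1 + \<Sum>R\<^sup>2\<close>; multiplying \<open>s\<close> and \<open>t\<close> by \<open>s1 s2\<close> makes the equation hold everywhere.\<close>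

theorem marshall_equivalent_if_same_signs:
  assumes R: "von_neumann_regular R"
    and a: "a \<in> carrier R" and b: "b \<in> carrier R"
    and same: "\<And>\<sigma>. \<sigma> \<in> orderings R \<Longrightarrow> \<sigma> a = \<sigma> b"
  obtains s t where "s \<in> one_plus_sum_squares R" "t \<in> one_plus_sum_squares R"
    "a \<otimes>\<^bsub>R\<^esub> s = b \<otimes>\<^bsub>R\<^esub> t"
proof -
  interpret cring R using R by (simp add: von_neumann_regular_def)
  obtain a' b' where a': "a' \<in> carrier R" "a \<otimes>\<^bsub>R\<^esub> a' \<otimes>\<^bsub>R\<^esub> a = a"
    and b': "b' \<in> carrier R" "b \<otimes>\<^bsub>R\<^esub> b' \<otimes>\<^bsub>R\<^esub> b = b"
    using R a b unfolding von_neumann_regular_def by metis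
  define e f where "e = a \<otimes>\<^bsub>R\<^esub> a'" and "f = b \<otimes>\<^bsub>R\<^esub> b'"
  have e: "e \<in> carrier R" "e \<otimes>\<^bsub>R\<^esub> e = e" "e \<otimes>\<^bsub>R\<^esub> a = a"
    using a a' by (auto simp: e_def) (metis a a' m_assoc m_closed)
  have f: "f \<in> carrier R" "f \<otimes>\<^bsub>R\<^esub> f = f" "f \<otimes>\<^bsub>R\<^esub> b = b"
    using b b' by (auto simp: f_def) (metis b b' m_assoc m_closed)
  have supp: "\<sigma> e = \<sigma> f" if \<sigma>: "\<sigma> \<in> orderings R" for \<sigma>
  proof -
    have "\<sigma> e * \<sigma> e = \<sigma> e" "\<sigma> f * \<sigma> f = \<sigma> f" "\<sigma> e * \<sigma> a = \<sigma> a" "\<sigma> f * \<sigma> b = \<sigma> b"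
      using e f a b ordering_mult[OF \<sigma>] by metis+
    moreover have "\<sigma> e = \<sigma> a * \<sigma> a'" "\<sigma> f = \<sigma> b * \<sigma> b'"
      using a a' b b' \<sigma> by (simp_all add: e_def f_def)
    ultimately show ?thesis using same[OF \<sigma>] by (cases "\<sigma> b = 0") (simp, metis mult_cancel_right1)
  qed
  have one_minus: "\<sigma> (\<one>\<^bsub>R\<^esub> \<ominus>\<^bsub>R\<^esub> x) = 0" if "\<sigma> \<in> orderings R" "x \<in> carrier R" "x \<otimes>\<^bsub>R\<^esub> x = x" "\<sigma> x \<noteq> 0" for \<sigma> x
  proof -
    have "x \<otimes>\<^bsub>R\<^esub> (\<one>\<^bsub>R\<^esub> \<ominus>\<^bsub>R\<^esub> x) = x \<ominus>\<^bsub>R\<^esub> x \<otimes>\<^bsub>R\<^esub> x" using that(2) by algebra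
    also have "\<dots> = \<zero>\<^bsub>R\<^esub>" using that(2,3) by (simp add: minus_eq r_neg)
    finally have "\<sigma> x * \<sigma> (\<one>\<^bsub>R\<^esub> \<ominus>\<^bsub>R\<^esub> x) = 0"
      using ordering_mult[OF that(1,2), of "\<one>\<^bsub>R\<^esub> \<ominus>\<^bsub>R\<^esub> x"] that by simp
    then show ?thesis using that by simp
  qed
  have idem: "(x \<otimes>\<^bsub>R\<^esub> (\<one>\<^bsub>R\<^esub> \<ominus>\<^bsub>R\<^esub> y)) \<otimes>\<^bsub>R\<^esub> (x \<otimes>\<^bsub>R\<^esub> (\<one>\<^bsub>R\<^esub> \<ominus>\<^bsub>R\<^esub> y)) = x \<otimes>\<^bsub>R\<^esub> (\<one>\<^bsub>R\<^esub> \<ominus>\<^bsub>R\<^esub> y)"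
    if "x \<in> carrier R" "y \<in> carrier R" "x \<otimes>\<^bsub>R\<^esub> x = x" "y \<otimes>\<^bsub>R\<^esub> y = y" for x y
  proof -
    have "(x \<otimes>\<^bsub>R\<^esub> (\<one>\<^bsub>R\<^esub> \<ominus>\<^bsub>R\<^esub> y)) \<otimes>\<^bsub>R\<^esub> (x \<otimes>\<^bsub>R\<^esub> (\<one>\<^bsub>R\<^esub> \<ominus>\<^bsub>R\<^esub> y)) =
      (x \<otimes>\<^bsub>R\<^esub> x) \<otimes>\<^bsub>R\<^esub> (\<one>\<^bsub>R\<^esub> \<ominus>\<^bsub>R\<^esub> y \<ominus>\<^bsub>R\<^esub> y \<oplus>\<^bsub>R\<^esub> y \<otimes>\<^bsub>R\<^esub> y)" using that(1,2) by algebra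
    also have "\<dots> = x \<otimes>\<^bsub>R\<^esub> (\<one>\<^bsub>R\<^esub> \<ominus>\<^bsub>R\<^esub> y \<ominus>\<^bsub>R\<^esub> y \<oplus>\<^bsub>R\<^esub> y)" unfolding that(3,4) ..
    also have "\<dots> = x \<otimes>\<^bsub>R\<^esub> (\<one>\<^bsub>R\<^esub> \<ominus>\<^bsub>R\<^esub> y)" using that(1,2) by algebra
    finally show ?thesis .
  qed
  obtain s1 where s1: "s1 \<in> one_plus_sum_squares R" "e \<otimes>\<^bsub>R\<^esub> (\<one>\<^bsub>R\<^esub> \<ominus>\<^bsub>R\<^esub> f) \<otimes>\<^bsub>R\<^esub> s1 = \<zero>\<^bsub>R\<^esub>"
  proof (rule annihilated_if_zero_at_all_orderings)
    show "\<sigma> (e \<otimes>\<^bsub>R\<^esub> (\<one>\<^bsub>R\<^esub> \<ominus>\<^bsub>R\<^esub> f)) = 0" if "\<sigma> \<in> orderings R" for \<sigma>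
      using one_minus[OF that f(1,2)] supp[OF that] that e f by auto
  qed (use e f idem in auto)
  obtain s2 where s2: "s2 \<in> one_plus_sum_squares R" "f \<otimes>\<^bsub>R\<^esub> (\<one>\<^bsub>R\<^esub> \<ominus>\<^bsub>R\<^esub> e) \<otimes>\<^bsub>R\<^esub> s2 = \<zero>\<^bsub>R\<^esub>"
  proof (rule annihilated_if_zero_at_all_orderings)
    show "\<sigma> (f \<otimes>\<^bsub>R\<^esub> (\<one>\<^bsub>R\<^esub> \<ominus>\<^bsub>R\<^esub> e)) = 0" if "\<sigma> \<in> orderings R" for \<sigma>
      using one_minus[OF that e(1,2)] supp[OF that] that e f by auto
  qed (use e f idem in auto)
  have "(a \<otimes>\<^bsub>R\<^esub> b) \<otimes>\<^bsub>R\<^esub> (a' \<otimes>\<^bsub>R\<^esub> b') \<otimes>\<^bsub>R\<^esub> (a \<otimes>\<^bsub>R\<^esub> b) = (a \<otimes>\<^bsub>R\<^esub> a' \<otimes>\<^bsub>R\<^esub> a) \<otimes>\<^bsub>R\<^esub> (b \<otimes>\<^bsub>R\<^esub> b' \<otimes>\<^bsub>R\<^esub> b)"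
    using a b a'(1) b'(1) by (simp add: m_ac)
  then have "(a \<otimes>\<^bsub>R\<^esub> b) \<otimes>\<^bsub>R\<^esub> (a' \<otimes>\<^bsub>R\<^esub> b') \<otimes>\<^bsub>R\<^esub> (a \<otimes>\<^bsub>R\<^esub> b) = a \<otimes>\<^bsub>R\<^esub> b" by (simp add: a' b')
  moreover have "0 \<le> \<sigma> (a \<otimes>\<^bsub>R\<^esub> b)" if "\<sigma> \<in> orderings R" for \<sigma>
    using same[OF that] that a b by simp
  ultimately obtain p q where pq: "p \<in> sum_squares R" "q \<in> sum_squares R"
    "(a \<otimes>\<^bsub>R\<^esub> b) \<otimes>\<^bsub>R\<^esub> q = (a \<otimes>\<^bsub>R\<^esub> b) \<otimes>\<^bsub>R\<^esub> (a' \<otimes>\<^bsub>R\<^esub> b') \<otimes>\<^bsub>R\<^esub> (\<one>\<^bsub>R\<^esub> \<oplus>\<^bsub>R\<^esub> p)"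
    by (rule positivstellensatz_on_support[rotated 2]) (use a b a' b' in auto)
  define u where "u = \<one>\<^bsub>R\<^esub> \<oplus>\<^bsub>R\<^esub> p"
  have u: "u \<in> one_plus_sum_squares R" using pq by (auto simp: u_def one_plus_sum_squares_iff)
  have C: "q \<in> carrier R" "u \<in> carrier R" "s1 \<in> carrier R" "s2 \<in> carrier R"
    using pq sum_squares_closed u s1 s2 one_plus_sum_squares_closed by auto
  have abq: "(a \<otimes>\<^bsub>R\<^esub> b) \<otimes>\<^bsub>R\<^esub> q = (e \<otimes>\<^bsub>R\<^esub> f) \<otimes>\<^bsub>R\<^esub> u"
    using pq(3) a b a'(1) b'(1) C by (simp add: e_def f_def u_def[symmetric] m_ac)
  define s t where "s = u \<oplus>\<^bsub>R\<^esub> q \<otimes>\<^bsub>R\<^esub> (b \<otimes>\<^bsub>R\<^esub> b)" and "t = u \<oplus>\<^bsub>R\<^esub> q \<otimes>\<^bsub>R\<^esub> (a \<otimes>\<^bsub>R\<^esub> a)"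
  have st: "s \<in> one_plus_sum_squares R" "t \<in> one_plus_sum_squares R"
    using u pq a b by (simp_all add: s_def t_def one_plus_sum_squares_add sum_squares_mult_square)
  then have st': "s \<in> carrier R" "t \<in> carrier R" using one_plus_sum_squares_closed by auto
  have ast: "f \<otimes>\<^bsub>R\<^esub> (a \<otimes>\<^bsub>R\<^esub> s) = e \<otimes>\<^bsub>R\<^esub> (b \<otimes>\<^bsub>R\<^esub> t)"
  proof -
    have "f \<otimes>\<^bsub>R\<^esub> (a \<otimes>\<^bsub>R\<^esub> s) = f \<otimes>\<^bsub>R\<^esub> (a \<otimes>\<^bsub>R\<^esub> u) \<oplus>\<^bsub>R\<^esub> (f \<otimes>\<^bsub>R\<^esub> b) \<otimes>\<^bsub>R\<^esub> ((a \<otimes>\<^bsub>R\<^esub> b) \<otimes>\<^bsub>R\<^esub> q)"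
      using C a b f(1) by (simp add: s_def r_distr m_ac)
    also have "\<dots> = f \<otimes>\<^bsub>R\<^esub> ((e \<otimes>\<^bsub>R\<^esub> a) \<otimes>\<^bsub>R\<^esub> u) \<oplus>\<^bsub>R\<^esub> b \<otimes>\<^bsub>R\<^esub> ((e \<otimes>\<^bsub>R\<^esub> f) \<otimes>\<^bsub>R\<^esub> u)"
      by (simp only: f e abq)
    also have "\<dots> = a \<otimes>\<^bsub>R\<^esub> ((e \<otimes>\<^bsub>R\<^esub> f) \<otimes>\<^bsub>R\<^esub> u) \<oplus>\<^bsub>R\<^esub> e \<otimes>\<^bsub>R\<^esub> ((f \<otimes>\<^bsub>R\<^esub> b) \<otimes>\<^bsub>R\<^esub> u)"
      using C a b f(1) e(1) by (simp add: m_ac)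
    also have "\<dots> = (e \<otimes>\<^bsub>R\<^esub> a) \<otimes>\<^bsub>R\<^esub> ((a \<otimes>\<^bsub>R\<^esub> b) \<otimes>\<^bsub>R\<^esub> q) \<oplus>\<^bsub>R\<^esub> e \<otimes>\<^bsub>R\<^esub> (b \<otimes>\<^bsub>R\<^esub> u)"
      by (simp only: f e abq)
    also have "\<dots> = e \<otimes>\<^bsub>R\<^esub> (b \<otimes>\<^bsub>R\<^esub> t)"
      using C a b e(1) by (simp add: t_def r_distr m_ac a_ac)
    finally show ?thesis .
  qed
  have as1: "a \<otimes>\<^bsub>R\<^esub> s1 = f \<otimes>\<^bsub>R\<^esub> (a \<otimes>\<^bsub>R\<^esub> s1)"
  proof -
    have "a \<otimes>\<^bsub>R\<^esub> s1 = (e \<otimes>\<^bsub>R\<^esub> a) \<otimes>\<^bsub>R\<^esub> s1" by (simp only: e)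
    also have "\<dots> = (e \<otimes>\<^bsub>R\<^esub> (\<one>\<^bsub>R\<^esub> \<ominus>\<^bsub>R\<^esub> f) \<otimes>\<^bsub>R\<^esub> s1) \<otimes>\<^bsub>R\<^esub> a \<oplus>\<^bsub>R\<^esub> f \<otimes>\<^bsub>R\<^esub> ((e \<otimes>\<^bsub>R\<^esub> a) \<otimes>\<^bsub>R\<^esub> s1)"
      using a C e(1) f(1) by algebra
    finally show ?thesis using a C e f by (simp only: s1) simp
  qed
  have bs2: "b \<otimes>\<^bsub>R\<^esub> s2 = e \<otimes>\<^bsub>R\<^esub> (b \<otimes>\<^bsub>R\<^esub> s2)"
  proof -
    have "b \<otimes>\<^bsub>R\<^esub> s2 = (f \<otimes>\<^bsub>R\<^esub> b) \<otimes>\<^bsub>R\<^esub> s2" by (simp only: f)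
    also have "\<dots> = (f \<otimes>\<^bsub>R\<^esub> (\<one>\<^bsub>R\<^esub> \<ominus>\<^bsub>R\<^esub> e) \<otimes>\<^bsub>R\<^esub> s2) \<otimes>\<^bsub>R\<^esub> b \<oplus>\<^bsub>R\<^esub> e \<otimes>\<^bsub>R\<^esub> ((f \<otimes>\<^bsub>R\<^esub> b) \<otimes>\<^bsub>R\<^esub> s2)"
      using b C e(1) f(1) by algebra
    finally show ?thesis using b C e f by (simp only: s2) simp
  qed
  have "a \<otimes>\<^bsub>R\<^esub> (s \<otimes>\<^bsub>R\<^esub> (s1 \<otimes>\<^bsub>R\<^esub> s2)) = (a \<otimes>\<^bsub>R\<^esub> s1) \<otimes>\<^bsub>R\<^esub> (s \<otimes>\<^bsub>R\<^esub> s2)"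
    using a C st' by (simp add: m_ac)
  also have "\<dots> = (f \<otimes>\<^bsub>R\<^esub> (a \<otimes>\<^bsub>R\<^esub> s)) \<otimes>\<^bsub>R\<^esub> (s1 \<otimes>\<^bsub>R\<^esub> s2)"
    by (subst as1) (use a f C st' in \<open>simp add: m_ac\<close>)
  also have "\<dots> = (e \<otimes>\<^bsub>R\<^esub> (b \<otimes>\<^bsub>R\<^esub> s2)) \<otimes>\<^bsub>R\<^esub> (t \<otimes>\<^bsub>R\<^esub> s1)"
    unfolding ast using b e C st' by (simp add: m_ac)
  also have "\<dots> = b \<otimes>\<^bsub>R\<^esub> (t \<otimes>\<^bsub>R\<^esub> (s1 \<otimes>\<^bsub>R\<^esub> s2))"
    unfolding bs2[symmetric] using b C st' by (simp add: m_ac)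
  finally show ?thesis
    by (rule that[rotated 2]) (simp_all add: one_plus_sum_squares_mult s1(1) s2(1) st)
qed

section \<open>Fractions and residue fields\<close>

context domain
begin

lemma fraction_fieldE:
  assumes "X \<in> carrier (fraction_field R)"
  obtains a b where "a \<in> carrier R" "b \<in> carrier R" "b \<noteq> \<zero>" "X = fraction R a b"
  using assms by (auto simp: fraction_field_def)

lemma fraction_closed:
  "a \<in> carrier R \<Longrightarrow> b \<in> carrier R \<Longrightarrow> b \<noteq> \<zero> \<Longrightarrow> fraction R a b \<in> carrier (fraction_field R)"
  by (auto simp: fraction_field_def)

lemma fraction_field_one: "\<one>\<^bsub>fraction_field R\<^esub> = fraction R \<one> \<one>"
  and fraction_field_zero: "\<zero>\<^bsub>fraction_field R\<^esub> = fraction R \<zero> \<one>"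
  by (simp_all add: fraction_field_def)

lemma cring_fraction_field: "cring (fraction_field R)"
proof (rule cringI)
  note calc = fraction_add fraction_mult fraction_eq_iff fraction_closed integral_iff
    fraction_field_one fraction_field_zero
  show "abelian_group (fraction_field R)"
  proof (rule abelian_groupI)
    fix X Y assume "X \<in> carrier (fraction_field R)" "Y \<in> carrier (fraction_field R)"
    then show "X \<oplus>\<^bsub>fraction_field R\<^esub> Y \<in> carrier (fraction_field R)"
      by (elim fraction_fieldE) (simp add: calc)
  next
    fix X Y assume "X \<in> carrier (fraction_field R)" "Y \<in> carrier (fraction_field R)"
    then show "X \<oplus>\<^bsub>fraction_field R\<^esub> Y = Y \<oplus>\<^bsub>fraction_field R\<^esub> X"
      by (elim fraction_fieldE) (simp add: calc m_ac a_ac)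
  next
    fix X Y Z assume "X \<in> carrier (fraction_field R)" "Y \<in> carrier (fraction_field R)"
      "Z \<in> carrier (fraction_field R)"
    then show "X \<oplus>\<^bsub>fraction_field R\<^esub> Y \<oplus>\<^bsub>fraction_field R\<^esub> Z =
      X \<oplus>\<^bsub>fraction_field R\<^esub> (Y \<oplus>\<^bsub>fraction_field R\<^esub> Z)"
      by (elim fraction_fieldE) (simp add: calc l_distr r_distr m_ac a_ac)
  next
    show "\<zero>\<^bsub>fraction_field R\<^esub> \<in> carrier (fraction_field R)" by (simp add: calc)
  next
    fix X assume "X \<in> carrier (fraction_field R)"
    then show "\<zero>\<^bsub>fraction_field R\<^esub> \<oplus>\<^bsub>fraction_field R\<^esub> X = X"
      by (elim fraction_fieldE) (simp add: calc)
  next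
    fix X assume "X \<in> carrier (fraction_field R)"
    then obtain a b where X: "a \<in> carrier R" "b \<in> carrier R" "b \<noteq> \<zero>" "X = fraction R a b"
      by (rule fraction_fieldE)
    then have "fraction R (\<ominus> a) b \<oplus>\<^bsub>fraction_field R\<^esub> X = \<zero>\<^bsub>fraction_field R\<^esub>"
      by (simp add: calc l_minus l_neg)
    then show "\<exists>Y \<in> carrier (fraction_field R). Y \<oplus>\<^bsub>fraction_field R\<^esub> X = \<zero>\<^bsub>fraction_field R\<^esub>"
      using X by (intro bexI[of _ "fraction R (\<ominus> a) b"]) (simp_all add: calc)
  qed
  show "comm_monoid (fraction_field R)"
  proof (rule comm_monoidI)
    fix X Y assume "X \<in> carrier (fraction_field R)" "Y \<in> carrier (fraction_field R)"
    then show "X \<otimes>\<^bsub>fraction_field R\<^esub> Y \<in> carrier (fraction_field R)"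
      by (elim fraction_fieldE) (simp add: calc)
  next
    fix X Y assume "X \<in> carrier (fraction_field R)" "Y \<in> carrier (fraction_field R)"
    then show "X \<otimes>\<^bsub>fraction_field R\<^esub> Y = Y \<otimes>\<^bsub>fraction_field R\<^esub> X"
      by (elim fraction_fieldE) (simp add: calc m_ac)
  next
    fix X Y Z assume "X \<in> carrier (fraction_field R)" "Y \<in> carrier (fraction_field R)"
      "Z \<in> carrier (fraction_field R)"
    then show "X \<otimes>\<^bsub>fraction_field R\<^esub> Y \<otimes>\<^bsub>fraction_field R\<^esub> Z =
      X \<otimes>\<^bsub>fraction_field R\<^esub> (Y \<otimes>\<^bsub>fraction_field R\<^esub> Z)"
      by (elim fraction_fieldE) (simp add: calc m_ac)
  next
    show "\<one>\<^bsub>fraction_field R\<^esub> \<in> carrier (fraction_field R)" by (simp add: calc)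
  next
    fix X assume "X \<in> carrier (fraction_field R)"
    then show "\<one>\<^bsub>fraction_field R\<^esub> \<otimes>\<^bsub>fraction_field R\<^esub> X = X"
      by (elim fraction_fieldE) (simp add: calc)
  qed
  fix X Y Z assume "X \<in> carrier (fraction_field R)" "Y \<in> carrier (fraction_field R)"
    "Z \<in> carrier (fraction_field R)"
  then show "(X \<oplus>\<^bsub>fraction_field R\<^esub> Y) \<otimes>\<^bsub>fraction_field R\<^esub> Z =
    X \<otimes>\<^bsub>fraction_field R\<^esub> Z \<oplus>\<^bsub>fraction_field R\<^esub> Y \<otimes>\<^bsub>fraction_field R\<^esub> Z"
    by (elim fraction_fieldE) (simp add: calc l_distr r_distr m_ac a_ac)
qed

end

context cring
begin

context
  fixes p assumes p: "p \<in> spec R"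
begin

interpretation primeideal p R using p by (simp add: spec_def)

interpretation quotient: domain "R Quot p" by (rule quotient_is_domain)

lemma coset_closed: "x \<in> carrier R \<Longrightarrow> p +> x \<in> carrier (R Quot p)"
  by (auto simp: FactRing_def A_RCOSETS_def')

lemma coset_eq_zero_iff: "x \<in> carrier R \<Longrightarrow> p +> x = \<zero>\<^bsub>R Quot p\<^esub> \<longleftrightarrow> x \<in> p"
  by (simp add: FactRing_def) (metis a_coset_join1 a_coset_join2 a_subgroup is_additive_subgroup)

lemma coset_mult: "x \<in> carrier R \<Longrightarrow> y \<in> carrier R \<Longrightarrow>
    (p +> x) \<otimes>\<^bsub>R Quot p\<^esub> (p +> y) = p +> (x \<otimes> y)"
  by (simp add: FactRing_def rcoset_mult_add)

lemma coset_add: "x \<in> carrier R \<Longrightarrow> y \<in> carrier R \<Longrightarrow>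
    (p +> x) \<oplus>\<^bsub>R Quot p\<^esub> (p +> y) = p +> (x \<oplus> y)"
  by (simp add: FactRing_def a_rcos_sum)

lemma coset_eq_iff: "x \<in> carrier R \<Longrightarrow> y \<in> carrier R \<Longrightarrow> p +> x = p +> y \<longleftrightarrow> x \<ominus> y \<in> p"
  using quotient_eq_iff_same_a_r_cos[OF is_ideal] by simp

lemma residue_frac_eq_iff:
  assumes "x \<in> carrier R" "y \<in> carrier R" "y \<notin> p" "x' \<in> carrier R" "y' \<in> carrier R" "y' \<notin> p"
  shows "residue_frac R p x y = residue_frac R p x' y' \<longleftrightarrow> x \<otimes> y' \<ominus> x' \<otimes> y \<in> p"
  unfolding residue_frac_def using assms
  by (subst quotient.fraction_eq_iff) (simp_all add: coset_closed coset_eq_zero_iff coset_mult coset_eq_iff)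

lemma residue_frac_mult:
  assumes "x \<in> carrier R" "y \<in> carrier R" "y \<notin> p" "x' \<in> carrier R" "y' \<in> carrier R" "y' \<notin> p"
  shows "residue_frac R p x y \<otimes>\<^bsub>residue_field R p\<^esub> residue_frac R p x' y' =
    residue_frac R p (x \<otimes> x') (y \<otimes> y')"
  unfolding residue_frac_def residue_field_def using assms
  by (subst quotient.fraction_mult) (simp_all add: coset_closed coset_eq_zero_iff coset_mult)

lemma residue_frac_add:
  assumes "x \<in> carrier R" "y \<in> carrier R" "y \<notin> p" "x' \<in> carrier R" "y' \<in> carrier R" "y' \<notin> p"
  shows "residue_frac R p x y \<oplus>\<^bsub>residue_field R p\<^esub> residue_frac R p x' y' =
    residue_frac R p (x \<otimes> y' \<oplus> x' \<otimes> y) (y \<otimes> y')"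
  unfolding residue_frac_def residue_field_def using assms
  by (subst quotient.fraction_add) (simp_all add: coset_closed coset_eq_zero_iff coset_mult coset_add)

lemma residue_frac_closed:
  assumes "x \<in> carrier R" "y \<in> carrier R" "y \<notin> p"
  shows "residue_frac R p x y \<in> carrier (residue_field R p)"
  unfolding residue_frac_def residue_field_def using assms
  by (simp add: quotient.fraction_closed coset_closed coset_eq_zero_iff)

lemma residue_one: "\<one>\<^bsub>residue_field R p\<^esub> = residue_frac R p \<one> \<one>"
  unfolding residue_frac_def residue_field_def by (simp add: quotient.fraction_field_one) (simp add: FactRing_def)

lemma residue_zero: "\<zero>\<^bsub>residue_field R p\<^esub> = residue_frac R p \<zero> \<one>"
  unfolding residue_frac_def residue_field_def quotient.fraction_field_zero
  using coset_eq_zero_iff[of "\<zero>"] additive_subgroup.zero_closed[OF is_additive_subgroup]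
  by (simp add: FactRing_def)

lemma residue_cring: "cring (residue_field R p)"
  unfolding residue_field_def by (rule quotient.cring_fraction_field)

lemma prime_one: "\<one> \<notin> p"
  using I_notcarr one_imp_carrier by blast

lemma prime_mult: "x \<in> carrier R \<Longrightarrow> y \<in> carrier R \<Longrightarrow> x \<otimes> y \<in> p \<longleftrightarrow> x \<in> p \<or> y \<in> p"
  using I_prime I_l_closed I_r_closed by blast

lemma prime_zero: "\<zero> \<in> p"
  using additive_subgroup.zero_closed[OF is_additive_subgroup] .

end

end

section \<open>The von Neumann regular hull\<close>

context cring
begin

abbreviation clopen :: "'a set set \<Rightarrow> bool"
  where "clopen U \<equiv> openin (constructible_topology R) U \<and> closedin (constructible_topology R) U"

lemma topspace_constructible: "topspace (constructible_topology R) = spec R"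
proof -
  have "basic_open R \<one> = spec R" by (auto simp: basic_open_def prime_one)
  then show ?thesis
    unfolding constructible_topology_def topology_generated_by_topspace by (auto simp: basic_open_def)
qed

lemma clopen_basic_open: "a \<in> carrier R \<Longrightarrow> clopen (basic_open R a)"
  and clopen_compl_basic_open: "a \<in> carrier R \<Longrightarrow> clopen (spec R - basic_open R a)"
proof -
  assume a: "a \<in> carrier R"
  have 1: "openin (constructible_topology R) (basic_open R a)"
    "openin (constructible_topology R) (spec R - basic_open R a)"
    using a unfolding constructible_topology_def by (auto intro!: topology_generated_by_Basis)
  have "basic_open R a \<subseteq> spec R" by (auto simp: basic_open_def)
  with 1 show "clopen (basic_open R a)" "clopen (spec R - basic_open R a)"
    by (auto simp: closedin_def topspace_constructible double_diff)
qed

lemma clopen_Int: "clopen U \<Longrightarrow> clopen W \<Longrightarrow> clopen (U \<inter> W)"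
  by auto

lemma V_carrierI:
  assumes "f \<in> extensional (spec R)"
    and loc: "\<And>p. p \<in> spec R \<Longrightarrow> \<exists>U x y. clopen U \<and> p \<in> U \<and> x \<in> carrier R \<and> y \<in> carrier R \<and>
      (\<forall>q \<in> U. y \<notin> q \<and> f q = residue_frac R q x y)"
  shows "f \<in> carrier (V R)"
proof -
  have "f p \<in> carrier (residue_field R p)" if p: "p \<in> spec R" for p
    using loc[OF p] residue_frac_closed[OF p] by force
  moreover have "\<exists>U. \<exists>x \<in> carrier R. \<exists>y \<in> carrier R.
      openin (constructible_topology R) U \<and> closedin (constructible_topology R) U \<and>
      p \<in> U \<and> U \<subseteq> basic_open R y \<and> (\<forall>q \<in> U. f q = residue_frac R q x y)" if p: "p \<in> spec R" for p
  proof -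
    obtain U x y where U: "clopen U" "p \<in> U" "x \<in> carrier R" "y \<in> carrier R"
      "\<forall>q \<in> U. y \<notin> q \<and> f q = residue_frac R q x y"
      using loc[OF p] by blast
    have "U \<subseteq> spec R" using U(1) openin_subset topspace_constructible by metis
    then have "U \<subseteq> basic_open R y" using U(5) by (auto simp: basic_open_def)
    then show ?thesis using U by blast
  qed
  ultimately show ?thesis using assms(1) by (simp add: V_def PiE_def Pi_def)
qed

lemma V_carrierE:
  assumes "f \<in> carrier (V R)" "p \<in> spec R"
  obtains U x y where "clopen U" "p \<in> U" "U \<subseteq> spec R" "x \<in> carrier R" "y \<in> carrier R"
    "\<forall>q \<in> U. y \<notin> q \<and> f q = residue_frac R q x y"
proof -
  obtain U x y where U: "x \<in> carrier R" "y \<in> carrier R" "clopen U" "p \<in> U" "U \<subseteq> basic_open R y"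
    "\<forall>q \<in> U. f q = residue_frac R q x y"
    using assms unfolding V_def by auto
  then show ?thesis using that[of U x y] by (auto simp: basic_open_def)
qed

lemma V_extensional: "f \<in> carrier (V R) \<Longrightarrow> f \<in> extensional (spec R)"
  by (auto simp: V_def PiE_def)

lemma V_apply_closed: "f \<in> carrier (V R) \<Longrightarrow> p \<in> spec R \<Longrightarrow> f p \<in> carrier (residue_field R p)"
  by (auto simp: V_def)

lemma V_eqI:
  "f \<in> carrier (V R) \<Longrightarrow> g \<in> carrier (V R) \<Longrightarrow> (\<And>p. p \<in> spec R \<Longrightarrow> f p = g p) \<Longrightarrow> f = g"
  using V_extensional by (metis extensionalityI)

lemma V_apply:
  assumes "p \<in> spec R"
  shows "(f \<otimes>\<^bsub>V R\<^esub> g) p = f p \<otimes>\<^bsub>residue_field R p\<^esub> g p"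
    "(f \<oplus>\<^bsub>V R\<^esub> g) p = f p \<oplus>\<^bsub>residue_field R p\<^esub> g p"
    "\<one>\<^bsub>V R\<^esub> p = \<one>\<^bsub>residue_field R p\<^esub>" "\<zero>\<^bsub>V R\<^esub> p = \<zero>\<^bsub>residue_field R p\<^esub>"
  using assms by (simp_all add: V_def)

text \<open>The canonical homomorphism from \<open>R\<close> to \<open>V R\<close>.\<close>

definition embed :: "'a \<Rightarrow> 'a set \<Rightarrow> ('a set \<times> 'a set) set"
  where "embed a = (\<lambda>p \<in> spec R. residue_frac R p a \<one>)"

lemma embed_apply: "p \<in> spec R \<Longrightarrow> embed a p = residue_frac R p a \<one>"
  by (simp add: embed_def)

lemma embed_closed: "a \<in> carrier R \<Longrightarrow> embed a \<in> carrier (V R)"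
proof (rule V_carrierI)
  fix p assume a: "a \<in> carrier R" and p: "p \<in> spec R"
  then have "clopen (basic_open R \<one>) \<and> p \<in> basic_open R \<one> \<and> a \<in> carrier R \<and> \<one> \<in> carrier R \<and>
      (\<forall>q \<in> basic_open R \<one>. \<one> \<notin> q \<and> embed a q = residue_frac R q a \<one>)"
    using clopen_basic_open[OF one_closed] by (simp add: basic_open_def prime_one embed_apply)
  then show "\<exists>U x y. clopen U \<and> p \<in> U \<and> x \<in> carrier R \<and> y \<in> carrier R \<and>
      (\<forall>q \<in> U. y \<notin> q \<and> embed a q = residue_frac R q x y)" by blast
qed (simp add: embed_def)

lemma V_one_eq: "\<one>\<^bsub>V R\<^esub> = embed \<one>" and V_zero_eq: "\<zero>\<^bsub>V R\<^esub> = embed \<zero>"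
  by (simp_all add: V_def embed_def residue_one residue_zero cong: restrict_cong)

lemma V_closed:
  assumes f: "f \<in> carrier (V R)" and g: "g \<in> carrier (V R)"
  shows "f \<otimes>\<^bsub>V R\<^esub> g \<in> carrier (V R)" "f \<oplus>\<^bsub>V R\<^esub> g \<in> carrier (V R)"
proof -
  have "\<exists>U x y. clopen U \<and> p \<in> U \<and> x \<in> carrier R \<and> y \<in> carrier R \<and>
      (\<forall>q \<in> U. y \<notin> q \<and> (f \<otimes>\<^bsub>V R\<^esub> g) q = residue_frac R q x y)"
    "\<exists>U x y. clopen U \<and> p \<in> U \<and> x \<in> carrier R \<and> y \<in> carrier R \<and>
      (\<forall>q \<in> U. y \<notin> q \<and> (f \<oplus>\<^bsub>V R\<^esub> g) q = residue_frac R q x y)" if p: "p \<in> spec R" for p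
  proof -
    obtain U x y where U: "clopen U" "p \<in> U" "U \<subseteq> spec R" "x \<in> carrier R" "y \<in> carrier R"
      "\<forall>q \<in> U. y \<notin> q \<and> f q = residue_frac R q x y" using f p by (rule V_carrierE)
    obtain W z w where W: "clopen W" "p \<in> W" "W \<subseteq> spec R" "z \<in> carrier R" "w \<in> carrier R"
      "\<forall>q \<in> W. w \<notin> q \<and> g q = residue_frac R q z w" using g p by (rule V_carrierE)
    have UW: "clopen (U \<inter> W)" "p \<in> U \<inter> W" using U W clopen_Int by blast+
    have "\<forall>q \<in> U \<inter> W. y \<otimes> w \<notin> q \<and> (f \<otimes>\<^bsub>V R\<^esub> g) q = residue_frac R q (x \<otimes> z) (y \<otimes> w) \<and>
       (f \<oplus>\<^bsub>V R\<^esub> g) q = residue_frac R q (x \<otimes> w \<oplus> z \<otimes> y) (y \<otimes> w)"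
    proof
      fix q assume "q \<in> U \<inter> W"
      then have "q \<in> spec R" "y \<notin> q" "w \<notin> q" "f q = residue_frac R q x y" "g q = residue_frac R q z w"
        using U W by auto
      then show "y \<otimes> w \<notin> q \<and> (f \<otimes>\<^bsub>V R\<^esub> g) q = residue_frac R q (x \<otimes> z) (y \<otimes> w) \<and>
       (f \<oplus>\<^bsub>V R\<^esub> g) q = residue_frac R q (x \<otimes> w \<oplus> z \<otimes> y) (y \<otimes> w)"
        using U W by (simp add: V_apply residue_frac_mult residue_frac_add prime_mult)
    qed
    moreover have "x \<otimes> z \<in> carrier R" "x \<otimes> w \<oplus> z \<otimes> y \<in> carrier R" "y \<otimes> w \<in> carrier R"
      using U W by auto
    ultimately show "\<exists>U x y. clopen U \<and> p \<in> U \<and> x \<in> carrier R \<and> y \<in> carrier R \<and>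
      (\<forall>q \<in> U. y \<notin> q \<and> (f \<otimes>\<^bsub>V R\<^esub> g) q = residue_frac R q x y)"
      "\<exists>U x y. clopen U \<and> p \<in> U \<and> x \<in> carrier R \<and> y \<in> carrier R \<and>
      (\<forall>q \<in> U. y \<notin> q \<and> (f \<oplus>\<^bsub>V R\<^esub> g) q = residue_frac R q x y)"
      using UW by meson+
  qed
  moreover have "f \<otimes>\<^bsub>V R\<^esub> g \<in> extensional (spec R)" "f \<oplus>\<^bsub>V R\<^esub> g \<in> extensional (spec R)"
    by (simp_all add: V_def)
  ultimately show "f \<otimes>\<^bsub>V R\<^esub> g \<in> carrier (V R)" "f \<oplus>\<^bsub>V R\<^esub> g \<in> carrier (V R)"
    by (simp_all add: V_carrierI)
qed

lemma embed_mult: "a \<in> carrier R \<Longrightarrow> b \<in> carrier R \<Longrightarrow> embed (a \<otimes> b) = embed a \<otimes>\<^bsub>V R\<^esub> embed b"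
  by (rule V_eqI) (simp_all add: embed_closed V_closed V_apply embed_apply residue_frac_mult prime_one)

lemma embed_add: "a \<in> carrier R \<Longrightarrow> b \<in> carrier R \<Longrightarrow> embed (a \<oplus> b) = embed a \<oplus>\<^bsub>V R\<^esub> embed b"
  by (rule V_eqI) (simp_all add: embed_closed V_closed V_apply embed_apply residue_frac_add prime_one)

theorem cring_V: "cring (V R)"
proof (rule cringI)
  note simps = V_apply V_closed V_apply_closed embed_closed V_one_eq[symmetric] V_zero_eq[symmetric]
  have zc: "\<zero>\<^bsub>V R\<^esub> \<in> carrier (V R)" and oc: "\<one>\<^bsub>V R\<^esub> \<in> carrier (V R)"
    by (simp_all add: V_one_eq V_zero_eq embed_closed)
  show "abelian_group (V R)"
  proof (rule abelian_groupI)
    fix f g h assume f: "f \<in> carrier (V R)" and g: "g \<in> carrier (V R)" and h: "h \<in> carrier (V R)"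
    show "f \<oplus>\<^bsub>V R\<^esub> g \<oplus>\<^bsub>V R\<^esub> h = f \<oplus>\<^bsub>V R\<^esub> (g \<oplus>\<^bsub>V R\<^esub> h)"
    proof (rule V_eqI)
      fix p assume p: "p \<in> spec R"
      interpret K: cring "residue_field R p" by (rule residue_cring[OF p])
      show "(f \<oplus>\<^bsub>V R\<^esub> g \<oplus>\<^bsub>V R\<^esub> h) p = (f \<oplus>\<^bsub>V R\<^esub> (g \<oplus>\<^bsub>V R\<^esub> h)) p"
        using f g h p by (simp add: simps K.a_assoc)
    qed (use f g h in \<open>simp_all add: simps\<close>)
  next
    fix f g assume f: "f \<in> carrier (V R)" and g: "g \<in> carrier (V R)"
    show "f \<oplus>\<^bsub>V R\<^esub> g = g \<oplus>\<^bsub>V R\<^esub> f"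
    proof (rule V_eqI)
      fix p assume p: "p \<in> spec R"
      interpret K: cring "residue_field R p" by (rule residue_cring[OF p])
      show "(f \<oplus>\<^bsub>V R\<^esub> g) p = (g \<oplus>\<^bsub>V R\<^esub> f) p"
        using f g p by (simp add: simps K.a_comm)
    qed (use f g in \<open>simp_all add: simps\<close>)
  next
    fix f assume f: "f \<in> carrier (V R)"
    show "\<zero>\<^bsub>V R\<^esub> \<oplus>\<^bsub>V R\<^esub> f = f"
    proof (rule V_eqI)
      fix p assume p: "p \<in> spec R"
      interpret K: cring "residue_field R p" by (rule residue_cring[OF p])
      show "(\<zero>\<^bsub>V R\<^esub> \<oplus>\<^bsub>V R\<^esub> f) p = f p" using f p by (simp add: simps)
    qed (use f zc in \<open>simp_all add: simps\<close>)
    have "embed (\<ominus> \<one>) \<otimes>\<^bsub>V R\<^esub> f \<oplus>\<^bsub>V R\<^esub> f = \<zero>\<^bsub>V R\<^esub>"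
    proof (rule V_eqI)
      fix p assume p: "p \<in> spec R"
      interpret K: cring "residue_field R p" by (rule residue_cring[OF p])
      have "embed (\<ominus> \<one>) p \<oplus>\<^bsub>residue_field R p\<^esub> \<one>\<^bsub>residue_field R p\<^esub> = \<zero>\<^bsub>residue_field R p\<^esub>"
        using p by (simp add: embed_apply residue_one residue_zero residue_frac_add prime_one l_neg)
      moreover have "(embed (\<ominus> \<one>) \<otimes>\<^bsub>V R\<^esub> f \<oplus>\<^bsub>V R\<^esub> f) p =
        (embed (\<ominus> \<one>) p \<oplus>\<^bsub>residue_field R p\<^esub> \<one>\<^bsub>residue_field R p\<^esub>) \<otimes>\<^bsub>residue_field R p\<^esub> f p"
        using f p by (simp add: simps K.l_distr)
      ultimately show "(embed (\<ominus> \<one>) \<otimes>\<^bsub>V R\<^esub> f \<oplus>\<^bsub>V R\<^esub> f) p = \<zero>\<^bsub>V R\<^esub> p"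
        using f p by (simp add: simps)
    qed (use f zc in \<open>simp_all add: simps\<close>)
    then show "\<exists>g \<in> carrier (V R). g \<oplus>\<^bsub>V R\<^esub> f = \<zero>\<^bsub>V R\<^esub>"
      using f by (intro bexI[of _ "embed (\<ominus> \<one>) \<otimes>\<^bsub>V R\<^esub> f"]) (simp_all add: simps)
  qed (simp_all add: simps zc)
  show "comm_monoid (V R)"
  proof (rule comm_monoidI)
    fix f g h assume f: "f \<in> carrier (V R)" and g: "g \<in> carrier (V R)" and h: "h \<in> carrier (V R)"
    show "f \<otimes>\<^bsub>V R\<^esub> g \<otimes>\<^bsub>V R\<^esub> h = f \<otimes>\<^bsub>V R\<^esub> (g \<otimes>\<^bsub>V R\<^esub> h)"
    proof (rule V_eqI)
      fix p assume p: "p \<in> spec R"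
      interpret K: cring "residue_field R p" by (rule residue_cring[OF p])
      show "(f \<otimes>\<^bsub>V R\<^esub> g \<otimes>\<^bsub>V R\<^esub> h) p = (f \<otimes>\<^bsub>V R\<^esub> (g \<otimes>\<^bsub>V R\<^esub> h)) p"
        using f g h p by (simp add: simps K.m_assoc)
    qed (use f g h in \<open>simp_all add: simps\<close>)
  next
    fix f g assume f: "f \<in> carrier (V R)" and g: "g \<in> carrier (V R)"
    show "f \<otimes>\<^bsub>V R\<^esub> g = g \<otimes>\<^bsub>V R\<^esub> f"
    proof (rule V_eqI)
      fix p assume p: "p \<in> spec R"
      interpret K: cring "residue_field R p" by (rule residue_cring[OF p])
      show "(f \<otimes>\<^bsub>V R\<^esub> g) p = (g \<otimes>\<^bsub>V R\<^esub> f) p"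
        using f g p by (simp add: simps K.m_comm)
    qed (use f g in \<open>simp_all add: simps\<close>)
  next
    fix f assume f: "f \<in> carrier (V R)"
    show "\<one>\<^bsub>V R\<^esub> \<otimes>\<^bsub>V R\<^esub> f = f"
    proof (rule V_eqI)
      fix p assume p: "p \<in> spec R"
      interpret K: cring "residue_field R p" by (rule residue_cring[OF p])
      show "(\<one>\<^bsub>V R\<^esub> \<otimes>\<^bsub>V R\<^esub> f) p = f p" using f p by (simp add: simps)
    qed (use f oc in \<open>simp_all add: simps\<close>)
  qed (simp_all add: simps oc)
  fix f g h assume f: "f \<in> carrier (V R)" and g: "g \<in> carrier (V R)" and h: "h \<in> carrier (V R)"
  show "(f \<oplus>\<^bsub>V R\<^esub> g) \<otimes>\<^bsub>V R\<^esub> h = f \<otimes>\<^bsub>V R\<^esub> h \<oplus>\<^bsub>V R\<^esub> g \<otimes>\<^bsub>V R\<^esub> h"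
  proof (rule V_eqI)
    fix p assume p: "p \<in> spec R"
    interpret K: cring "residue_field R p" by (rule residue_cring[OF p])
    show "((f \<oplus>\<^bsub>V R\<^esub> g) \<otimes>\<^bsub>V R\<^esub> h) p = (f \<otimes>\<^bsub>V R\<^esub> h \<oplus>\<^bsub>V R\<^esub> g \<otimes>\<^bsub>V R\<^esub> h) p"
      using f g h p by (simp add: simps K.l_distr)
  qed (use f g h in \<open>simp_all add: simps\<close>)
qed

lemma embed_neg:
  assumes a: "a \<in> carrier R"
  shows "embed (\<ominus> a) = \<ominus>\<^bsub>V R\<^esub> embed a"
proof -
  interpret V: cring "V R" by (rule cring_V)
  have "embed (\<ominus> a) \<oplus>\<^bsub>V R\<^esub> embed a = \<zero>\<^bsub>V R\<^esub>"
    using a by (simp add: V_zero_eq embed_add[symmetric] l_neg)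
  then show ?thesis
    using a by (intro V.minus_equality[symmetric]) (simp_all add: embed_closed)
qed

text \<open>The witness is the pointwise inverse, with \<open>0\<close> as inverse of \<open>0\<close>. It is again locally a fraction:
  where \<open>f = x / y\<close>, it is \<open>y / x\<close> on \<open>D(x)\<close> and \<open>0 / 1\<close> on the complement of \<open>D(x)\<close>, and both sets are
  clopen.\<close>

lemma V_quasi_inverse_exists:
  assumes "f \<in> carrier (V R)"
  obtains g where "g \<in> carrier (V R)" "f = f \<otimes>\<^bsub>V R\<^esub> g \<otimes>\<^bsub>V R\<^esub> f"
proof -
  define good where "good = (\<lambda>p x y. x \<in> carrier R \<and> y \<in> carrier R \<and> y \<notin> p \<and> f p = residue_frac R p x y)"
  define r where "r = (\<lambda>p x y. if x \<in> p then residue_frac R p \<zero> \<one> else residue_frac R p y x)"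
  define g where "g = (\<lambda>p \<in> spec R. THE c. \<exists>x y. good p x y \<and> c = r p x y)"
  have g: "g p = (if x \<in> p then residue_frac R p \<zero> \<one> else residue_frac R p y x)"
    if "p \<in> spec R" "good p x y" for p x y
  proof -
    \<comment> \<open>The inverse of the fraction \<open>x / y\<close> does not depend on the chosen numerator and denominator.\<close>
    have indep: "r p x' y' = r p x y" if g': "good p x' y'" for x' y'
    proof -
      have 1: "x \<otimes> y' \<ominus> x' \<otimes> y \<in> p" and C: "x \<in> carrier R" "y \<in> carrier R" "x' \<in> carrier R" "y' \<in> carrier R"
        and n: "y \<notin> p" "y' \<notin> p"
        using \<open>good p x y\<close> g' residue_frac_eq_iff[OF \<open>p \<in> spec R\<close>, of x y x' y'] by (auto simp: good_def)
      interpret primeideal p R using \<open>p \<in> spec R\<close> by (simp add: spec_def)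
      have "x \<otimes> y' \<in> p \<longleftrightarrow> x' \<otimes> y \<in> p"
      proof
        assume "x \<otimes> y' \<in> p"
        then have "x \<otimes> y' \<ominus> (x \<otimes> y' \<ominus> x' \<otimes> y) \<in> p" using 1 C by (simp add: minus_eq)
        moreover have "x \<otimes> y' \<ominus> (x \<otimes> y' \<ominus> x' \<otimes> y) = x' \<otimes> y" using C by algebra
        ultimately show "x' \<otimes> y \<in> p" by simp
      next
        assume "x' \<otimes> y \<in> p"
        then have "(x \<otimes> y' \<ominus> x' \<otimes> y) \<oplus> x' \<otimes> y \<in> p" using 1 C by simp
        moreover have "(x \<otimes> y' \<ominus> x' \<otimes> y) \<oplus> x' \<otimes> y = x \<otimes> y'" using C by algebra
        ultimately show "x \<otimes> y' \<in> p" by simp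
      qed
      then have "x \<in> p \<longleftrightarrow> x' \<in> p" using C n prime_mult[OF \<open>p \<in> spec R\<close>] by blast
      moreover have "residue_frac R p y x = residue_frac R p y' x'" if "x \<notin> p" "x' \<notin> p"
      proof -
        have "y \<otimes> x' \<ominus> y' \<otimes> x = \<ominus> (x \<otimes> y' \<ominus> x' \<otimes> y)" using C by algebra
        then show ?thesis using 1 C that residue_frac_eq_iff[OF \<open>p \<in> spec R\<close>] by simp
      qed
      ultimately show ?thesis by (simp add: r_def)
    qed
    have "(THE c. \<exists>x y. good p x y \<and> c = r p x y) = r p x y"
    proof (rule the_equality)
      show "\<exists>x' y'. good p x' y' \<and> r p x y = r p x' y'" using that(2) by blast
    qed (use indep in auto)
    then show ?thesis using that(1) by (simp add: g_def r_def)
  qed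
  have gc: "g \<in> carrier (V R)"
  proof (rule V_carrierI)
    fix p assume p: "p \<in> spec R"
    obtain U x y where U: "clopen U" "p \<in> U" "U \<subseteq> spec R" "x \<in> carrier R" "y \<in> carrier R"
      "\<forall>q \<in> U. y \<notin> q \<and> f q = residue_frac R q x y" using assms p by (rule V_carrierE)
    then have gq: "g q = (if x \<in> q then residue_frac R q \<zero> \<one> else residue_frac R q y x)" if "q \<in> U" for q
      using g[of q x y] that by (auto simp: good_def)
    show "\<exists>U x y. clopen U \<and> p \<in> U \<and> x \<in> carrier R \<and> y \<in> carrier R \<and>
      (\<forall>q \<in> U. y \<notin> q \<and> g q = residue_frac R q x y)"
    proof (cases "x \<in> p")
      case True
      have "clopen (U \<inter> (spec R - basic_open R x))"
        using U(1) clopen_compl_basic_open[OF U(4)] by (rule clopen_Int)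
      moreover have "p \<in> U \<inter> (spec R - basic_open R x)" using True U p by (auto simp: basic_open_def)
      moreover have "\<forall>q \<in> U \<inter> (spec R - basic_open R x). \<one> \<notin> q \<and> g q = residue_frac R q \<zero> \<one>"
        using gq by (auto simp: basic_open_def prime_one)
      ultimately show ?thesis using zero_closed one_closed by meson
    next
      case False
      have "clopen (U \<inter> basic_open R x)"
        using U(1) clopen_basic_open[OF U(4)] by (rule clopen_Int)
      moreover have "p \<in> U \<inter> basic_open R x" using False U p by (auto simp: basic_open_def)
      moreover have "\<forall>q \<in> U \<inter> basic_open R x. x \<notin> q \<and> g q = residue_frac R q y x"
        using gq by (auto simp: basic_open_def)
      ultimately show ?thesis using U(4,5) by meson
    qed
  qed (simp add: g_def)
  have "f = f \<otimes>\<^bsub>V R\<^esub> g \<otimes>\<^bsub>V R\<^esub> f"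
  proof (rule V_eqI)
    fix p assume p: "p \<in> spec R"
    obtain U x y where U: "clopen U" "p \<in> U" "U \<subseteq> spec R" "x \<in> carrier R" "y \<in> carrier R"
      "\<forall>q \<in> U. y \<notin> q \<and> f q = residue_frac R q x y" using assms p by (rule V_carrierE)
    then have xy: "y \<notin> p" "f p = residue_frac R p x y" by auto
    have gp: "g p = (if x \<in> p then residue_frac R p \<zero> \<one> else residue_frac R p y x)"
      using g[of p x y] p U xy by (auto simp: good_def)
    interpret primeideal p R using \<open>p \<in> spec R\<close> by (simp add: spec_def)
    show "f p = (f \<otimes>\<^bsub>V R\<^esub> g \<otimes>\<^bsub>V R\<^esub> f) p"
    proof (cases "x \<in> p")
      case True
      then show ?thesis using U(4,5) xy gp p
        by (simp add: V_apply residue_frac_mult prime_one prime_mult residue_frac_eq_iff minus_eq)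
    next
      case False
      have "x \<otimes> (y \<otimes> x \<otimes> y) \<ominus> x \<otimes> y \<otimes> x \<otimes> y = \<zero>" using U(4,5) by algebra
      then show ?thesis using U(4,5) xy gp p False
        by (simp add: V_apply residue_frac_mult prime_mult residue_frac_eq_iff prime_zero)
    qed
  qed (use assms gc in \<open>simp_all add: V_closed\<close>)
  with gc show ?thesis by (rule that)
qed

theorem von_neumann_regular_V: "von_neumann_regular (V R)"
  unfolding von_neumann_regular_def using cring_V V_quasi_inverse_exists by metis

end

section \<open>Orderings of the hull\<close>

context cring
begin

definition support :: "('a \<Rightarrow> int) \<Rightarrow> 'a set"
  where "support \<sigma> = {a \<in> carrier R. \<sigma> a = 0}"

lemma support_in_spec:
  assumes \<sigma>: "\<sigma> \<in> orderings R"
  shows "support \<sigma> \<in> spec R"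
proof -
  have "ideal (support \<sigma>) R"
  proof (rule idealI)
    show "subgroup (support \<sigma>) (add_monoid R)"
    proof (rule add.subgroupI)
      show "support \<sigma> \<noteq> {}" using \<sigma> zero_closed by (auto simp: support_def)
    qed (use \<sigma> ordering_add_zero(1)[OF \<sigma>] in \<open>auto simp: support_def a_inv_def[symmetric]\<close>)
  qed (use \<sigma> in \<open>auto simp: support_def ring_axioms\<close>)
  then have "primeideal (support \<sigma>) R"
  proof (rule primeidealI)
    have "\<one> \<notin> support \<sigma>" using \<sigma> by (simp add: support_def)
    then show "carrier R \<noteq> support \<sigma>" by auto
  qed (use \<sigma> in \<open>auto simp: support_def is_cring\<close>)
  then show ?thesis by (simp add: spec_def)
qed

text \<open>The sign of \<open>f\<close> at the support of \<open>\<sigma>\<close>: a fraction \<open>x / y = x y / y\<^sup>2\<close> has the sign of \<open>x y\<close>. By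
  \<open>extend_eq\<close> the description is unambiguous.\<close>

definition extend :: "('a \<Rightarrow> int) \<Rightarrow> ('a set \<Rightarrow> ('a set \<times> 'a set) set) \<Rightarrow> int"
  where "extend \<sigma> = (\<lambda>f \<in> carrier (V R). THE v. \<exists>x y. x \<in> carrier R \<and> y \<in> carrier R \<and> \<sigma> y \<noteq> 0 \<and>
    f (support \<sigma>) = residue_frac R (support \<sigma>) x y \<and> v = \<sigma> x * \<sigma> y)"

definition restr :: "(('a set \<Rightarrow> ('a set \<times> 'a set) set) \<Rightarrow> int) \<Rightarrow> 'a \<Rightarrow> int"
  where "restr \<tau> = (\<lambda>a \<in> carrier R. \<tau> (embed a))"

context
  fixes \<sigma> assumes \<sigma>: "\<sigma> \<in> orderings R"
begin

lemma ordering_square: "a \<in> carrier R \<Longrightarrow> \<sigma> a \<noteq> 0 \<Longrightarrow> \<sigma> a * \<sigma> a = 1"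
  using ordering_vals[OF \<sigma>] by fastforce

lemma extend_eq:
  assumes f: "f \<in> carrier (V R)" and xy: "x \<in> carrier R" "y \<in> carrier R" "\<sigma> y \<noteq> 0"
    "f (support \<sigma>) = residue_frac R (support \<sigma>) x y"
  shows "extend \<sigma> f = \<sigma> x * \<sigma> y"
proof -
  have "\<sigma> x' * \<sigma> y' = \<sigma> x * \<sigma> y"
    if "x' \<in> carrier R" "y' \<in> carrier R" "\<sigma> y' \<noteq> 0"
      "f (support \<sigma>) = residue_frac R (support \<sigma>) x' y'" for x' y'
  proof -
    have "x \<otimes> y' \<ominus> x' \<otimes> y \<in> support \<sigma>"
      using residue_frac_eq_iff[OF support_in_spec[OF \<sigma>], of x y x' y'] xy that by (simp add: support_def)
    then have "\<sigma> (x \<otimes> y') = \<sigma> (x' \<otimes> y)"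
      using xy that by (intro ordering_eq_if_diff_zero[OF \<sigma>]) (auto simp: support_def)
    then have "\<sigma> x * \<sigma> y' = \<sigma> x' * \<sigma> y" using \<sigma> xy that by simp
    then have "\<sigma> x * (\<sigma> y' * \<sigma> y') * \<sigma> y = \<sigma> x' * (\<sigma> y * \<sigma> y) * \<sigma> y'" by (simp add: mult_ac)
    then show ?thesis using ordering_square xy that by simp
  qed
  note unique = this
  have "(THE v. \<exists>x y. x \<in> carrier R \<and> y \<in> carrier R \<and> \<sigma> y \<noteq> 0 \<and>
    f (support \<sigma>) = residue_frac R (support \<sigma>) x y \<and> v = \<sigma> x * \<sigma> y) = \<sigma> x * \<sigma> y"
  proof (rule the_equality)
    show "\<exists>x' y'. x' \<in> carrier R \<and> y' \<in> carrier R \<and> \<sigma> y' \<noteq> 0 \<and>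
      f (support \<sigma>) = residue_frac R (support \<sigma>) x' y' \<and> \<sigma> x * \<sigma> y = \<sigma> x' * \<sigma> y'"
      using xy by blast
  qed (use unique in blast)
  then show ?thesis using f by (simp add: extend_def)
qed

lemma extend_repr:
  assumes "f \<in> carrier (V R)"
  obtains x y where "x \<in> carrier R" "y \<in> carrier R" "\<sigma> y \<noteq> 0" "\<sigma> y * \<sigma> y = 1"
    "f (support \<sigma>) = residue_frac R (support \<sigma>) x y" "extend \<sigma> f = \<sigma> x * \<sigma> y"
proof -
  obtain U x y where U: "support \<sigma> \<in> U" "x \<in> carrier R" "y \<in> carrier R"
    "\<forall>q \<in> U. y \<notin> q \<and> f q = residue_frac R q x y"
    using assms support_in_spec[OF \<sigma>] by (rule V_carrierE)
  then have "\<sigma> y \<noteq> 0" and *: "f (support \<sigma>) = residue_frac R (support \<sigma>) x y"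
    by (auto simp: support_def)
  with U(2,3) show ?thesis
    by (intro that[of x y]) (simp_all add: extend_eq[OF assms U(2,3)] ordering_square)
qed

lemma extend_embed:
  assumes "a \<in> carrier R"
  shows "extend \<sigma> (embed a) = \<sigma> a"
  using extend_eq[of "embed a" a "\<one>"] assms \<sigma> support_in_spec[OF \<sigma>]
  by (simp add: embed_closed embed_apply)

lemma extend_mult:
  assumes f: "f \<in> carrier (V R)" and g: "g \<in> carrier (V R)"
  shows "extend \<sigma> (f \<otimes>\<^bsub>V R\<^esub> g) = extend \<sigma> f * extend \<sigma> g"
proof -
  obtain x y where x: "x \<in> carrier R" "y \<in> carrier R" "\<sigma> y \<noteq> 0" "\<sigma> y * \<sigma> y = 1"
    "f (support \<sigma>) = residue_frac R (support \<sigma>) x y" "extend \<sigma> f = \<sigma> x * \<sigma> y"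
    using f by (rule extend_repr)
  obtain z w where z: "z \<in> carrier R" "w \<in> carrier R" "\<sigma> w \<noteq> 0" "\<sigma> w * \<sigma> w = 1"
    "g (support \<sigma>) = residue_frac R (support \<sigma>) z w" "extend \<sigma> g = \<sigma> z * \<sigma> w"
    using g by (rule extend_repr)
  have "(f \<otimes>\<^bsub>V R\<^esub> g) (support \<sigma>) = residue_frac R (support \<sigma>) (x \<otimes> z) (y \<otimes> w)"
    using x z support_in_spec[OF \<sigma>] by (simp add: V_apply residue_frac_mult support_def[of \<sigma>, THEN eqset_imp_iff])
  then have "extend \<sigma> (f \<otimes>\<^bsub>V R\<^esub> g) = \<sigma> (x \<otimes> z) * \<sigma> (y \<otimes> w)"
    using x z f g \<sigma> by (intro extend_eq) (simp_all add: V_closed)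
  then show ?thesis using x z \<sigma> by (simp add: mult_ac)
qed

text \<open>At a fixed prime all sections are fractions, so every condition reduces to one on numerators over
  the common denominator \<open>y w\<close>, whose sign squares to \<open>1\<close>.\<close>

theorem extend_ordering: "extend \<sigma> \<in> orderings (V R)"
proof -
  interpret V: cring "V R" by (rule cring_V)
  show ?thesis
  proof (rule V.orderingI)
    show "extend \<sigma> \<in> extensional (carrier (V R))" by (simp add: extend_def)
    show "extend \<sigma> f \<in> {-1, 0, 1}" if f: "f \<in> carrier (V R)" for f
    proof -
      obtain x y where xy: "x \<in> carrier R" "y \<in> carrier R" "\<sigma> y \<noteq> 0" "\<sigma> y * \<sigma> y = 1"
        "f (support \<sigma>) = residue_frac R (support \<sigma>) x y" "extend \<sigma> f = \<sigma> x * \<sigma> y"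
        using f by (rule extend_repr)
      show ?thesis
        unfolding xy(6) using ordering_vals[OF \<sigma> xy(1)] ordering_vals[OF \<sigma> xy(2)]
        by (elim disjE) simp_all
    qed
    show "extend \<sigma> \<one>\<^bsub>V R\<^esub> = 1" using \<sigma> by (simp add: V_one_eq extend_embed)
    show "extend \<sigma> (\<ominus>\<^bsub>V R\<^esub> f) = - extend \<sigma> f" if f: "f \<in> carrier (V R)" for f
    proof -
      have "\<ominus>\<^bsub>V R\<^esub> f = embed (\<ominus> \<one>) \<otimes>\<^bsub>V R\<^esub> f"
        using f V.l_minus[of "\<one>\<^bsub>V R\<^esub>" f] by (simp add: embed_neg V_one_eq[symmetric])
      then show ?thesis using f \<sigma> by (simp add: extend_mult embed_closed extend_embed)
    qed
    fix f g assume f: "f \<in> carrier (V R)" and g: "g \<in> carrier (V R)"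
    show "extend \<sigma> (f \<otimes>\<^bsub>V R\<^esub> g) = extend \<sigma> f * extend \<sigma> g" using f g by (rule extend_mult)
    obtain x y where x: "x \<in> carrier R" "y \<in> carrier R" "\<sigma> y \<noteq> 0" "\<sigma> y * \<sigma> y = 1"
      "f (support \<sigma>) = residue_frac R (support \<sigma>) x y" "extend \<sigma> f = \<sigma> x * \<sigma> y"
      using f by (rule extend_repr)
    obtain z w where z: "z \<in> carrier R" "w \<in> carrier R" "\<sigma> w \<noteq> 0" "\<sigma> w * \<sigma> w = 1"
      "g (support \<sigma>) = residue_frac R (support \<sigma>) z w" "extend \<sigma> g = \<sigma> z * \<sigma> w"
      using g by (rule extend_repr)
    have "(f \<oplus>\<^bsub>V R\<^esub> g) (support \<sigma>) = residue_frac R (support \<sigma>) (x \<otimes> w \<oplus> z \<otimes> y) (y \<otimes> w)"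
      using x z support_in_spec[OF \<sigma>] by (simp add: V_apply residue_frac_add support_def[of \<sigma>, THEN eqset_imp_iff])
    then have "extend \<sigma> (f \<oplus>\<^bsub>V R\<^esub> g) = \<sigma> (x \<otimes> w \<oplus> z \<otimes> y) * \<sigma> (y \<otimes> w)"
      using x z f g \<sigma> by (intro extend_eq) (simp_all add: V_closed)
    then have sum: "extend \<sigma> (f \<oplus>\<^bsub>V R\<^esub> g) = \<sigma> (x \<otimes> w \<oplus> z \<otimes> y) * \<sigma> y * \<sigma> w"
      using x z \<sigma> by simp
    show "extend \<sigma> (f \<oplus>\<^bsub>V R\<^esub> g) = extend \<sigma> g" if "extend \<sigma> f = 0"
    proof -
      have "\<sigma> (x \<otimes> w) = 0" using that x z \<sigma> by simp
      then have "\<sigma> (x \<otimes> w \<oplus> z \<otimes> y) = \<sigma> z * \<sigma> y"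
        using ordering_add_zero(1)[OF \<sigma>, of "x \<otimes> w" "z \<otimes> y"] x z \<sigma> by simp
      then have "extend \<sigma> (f \<oplus>\<^bsub>V R\<^esub> g) = \<sigma> z * (\<sigma> y * \<sigma> y) * \<sigma> w" unfolding sum by simp
      then show ?thesis using x z by simp
    qed
    show "extend \<sigma> (f \<oplus>\<^bsub>V R\<^esub> g) = extend \<sigma> f" if "extend \<sigma> f = extend \<sigma> g"
    proof -
      have "(\<sigma> x * \<sigma> y) * (\<sigma> y * \<sigma> w) = (\<sigma> z * \<sigma> w) * (\<sigma> y * \<sigma> w)" using that x z by simp
      then have "\<sigma> x * \<sigma> w * (\<sigma> y * \<sigma> y) = \<sigma> z * \<sigma> y * (\<sigma> w * \<sigma> w)" by (simp add: mult_ac)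
      then have "\<sigma> (x \<otimes> w) = \<sigma> (z \<otimes> y)" using x z \<sigma> by simp
      then have "\<sigma> (x \<otimes> w \<oplus> z \<otimes> y) = \<sigma> x * \<sigma> w"
        using ordering_add_same[OF \<sigma>, of "x \<otimes> w" "z \<otimes> y"] x z \<sigma> by simp
      then have "extend \<sigma> (f \<oplus>\<^bsub>V R\<^esub> g) = \<sigma> x * \<sigma> y * (\<sigma> w * \<sigma> w)" unfolding sum by simp
      then show ?thesis using x z by simp
    qed
  qed
qed

end

context
  fixes \<tau> assumes \<tau>: "\<tau> \<in> orderings (V R)"
begin

interpretation V: cring "V R" by (rule cring_V)

lemma restr_ordering: "restr \<tau> \<in> orderings R"
proof (rule orderingI)
  show "restr \<tau> \<in> extensional (carrier R)" by (simp add: restr_def)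
  show "restr \<tau> a \<in> {-1, 0, 1}" if "a \<in> carrier R" for a
    using V.ordering_vals[OF \<tau> embed_closed[OF that]] that by (simp add: restr_def)
  show "restr \<tau> \<one> = 1" using \<tau> by (simp add: restr_def V_one_eq[symmetric])
  show "restr \<tau> (\<ominus> a) = - restr \<tau> a" if "a \<in> carrier R" for a
    using V.ordering_neg[OF \<tau> embed_closed[OF that]] that by (simp add: restr_def embed_neg)
  fix a b assume "a \<in> carrier R" "b \<in> carrier R"
  then show "restr \<tau> (a \<otimes> b) = restr \<tau> a * restr \<tau> b"
    "restr \<tau> a = 0 \<Longrightarrow> restr \<tau> (a \<oplus> b) = restr \<tau> b"
    "restr \<tau> a = restr \<tau> b \<Longrightarrow> restr \<tau> (a \<oplus> b) = restr \<tau> a"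
    using V.ordering_mult[OF \<tau>] V.ordering_add_zero(1)[OF \<tau>] V.ordering_add_same[OF \<tau>]
    by (simp_all add: restr_def embed_mult embed_add embed_closed)
qed

text \<open>A substitute for the indicator function of a neighbourhood of the support inside \<open>U\<close>. On the subbasis
  it is \<open>a\<close> itself for \<open>D(a)\<close>, and \<open>1 - b c\<close> with \<open>c\<close> a quasi-inverse of \<open>b\<close> for the complement of \<open>D(b)\<close>;
  products take care of intersections.\<close>

lemma separating_section:
  assumes "openin (constructible_topology R) U" "support (restr \<tau>) \<in> U"
  shows "\<exists>e \<in> carrier (V R). \<tau> e \<noteq> 0 \<and> (\<forall>q \<in> spec R - U. e q = \<zero>\<^bsub>residue_field R q\<^esub>)"
  using assms unfolding constructible_topology_def openin_topology_generated_by_iff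
proof (induction rule: generate_topology_on.induct)
  case Empty
  then show ?case by simp
next
  case (Int U W)
  then obtain e f where ef: "e \<in> carrier (V R)" "\<tau> e \<noteq> 0" "\<forall>q \<in> spec R - U. e q = \<zero>\<^bsub>residue_field R q\<^esub>"
    "f \<in> carrier (V R)" "\<tau> f \<noteq> 0" "\<forall>q \<in> spec R - W. f q = \<zero>\<^bsub>residue_field R q\<^esub>"
    by blast
  have "(e \<otimes>\<^bsub>V R\<^esub> f) q = \<zero>\<^bsub>residue_field R q\<^esub>" if "q \<in> spec R - (U \<inter> W)" for q
  proof -
    interpret K: cring "residue_field R q" using that by (intro residue_cring) simp
    show ?thesis using that ef by (auto simp: V_apply V_apply_closed)
  qed
  then show ?case using ef \<tau> by (intro bexI[of _ "e \<otimes>\<^bsub>V R\<^esub> f"]) simp_all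
next
  case (UN K)
  then obtain k where "k \<in> K" "support (restr \<tau>) \<in> k" by blast
  with UN.IH[of k] show ?case by blast
next
  case (Basis U)
  then consider a where "a \<in> carrier R" "U = basic_open R a"
    | b where "b \<in> carrier R" "U = spec R - basic_open R b" by blast
  then show ?case
  proof cases
    case 1
    have "\<tau> (embed a) \<noteq> 0" using Basis.prems 1 by (auto simp: basic_open_def support_def restr_def)
    moreover have "embed a q = \<zero>\<^bsub>residue_field R q\<^esub>" if "q \<in> spec R - U" for q
      using that 1 by (simp add: basic_open_def embed_apply residue_zero residue_frac_eq_iff prime_one minus_eq)
    ultimately show ?thesis using 1 embed_closed by blast
  next
    case 2
    have b: "embed b \<in> carrier (V R)" using 2 by (simp add: embed_closed)
    then obtain c where c: "c \<in> carrier (V R)" "embed b = embed b \<otimes>\<^bsub>V R\<^esub> c \<otimes>\<^bsub>V R\<^esub> embed b"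
      by (rule V_quasi_inverse_exists)
    define e where "e = \<one>\<^bsub>V R\<^esub> \<ominus>\<^bsub>V R\<^esub> embed b \<otimes>\<^bsub>V R\<^esub> c"
    have e: "e \<in> carrier (V R)" using b c by (simp add: e_def)
    have "e \<otimes>\<^bsub>V R\<^esub> embed b = embed b \<ominus>\<^bsub>V R\<^esub> embed b \<otimes>\<^bsub>V R\<^esub> c \<otimes>\<^bsub>V R\<^esub> embed b"
      using b c(1) by (simp add: e_def V.minus_eq V.l_distr V.l_minus)
    also have "\<dots> = \<zero>\<^bsub>V R\<^esub>" unfolding c(2)[symmetric] using b by (simp add: V.minus_eq V.r_neg)
    finally have eb: "e \<otimes>\<^bsub>V R\<^esub> embed b = \<zero>\<^bsub>V R\<^esub>" .
    have "e q = \<zero>\<^bsub>residue_field R q\<^esub>" if q: "q \<in> spec R - U" for q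
    proof -
      have q': "q \<in> spec R" "b \<notin> q" using q 2 by (auto simp: basic_open_def)
      interpret K: cring "residue_field R q" using q by (intro residue_cring) simp
      have r: "residue_frac R q \<one> b \<in> carrier (residue_field R q)" using 2 q' by (simp add: residue_frac_closed)
      have "embed b q \<otimes>\<^bsub>residue_field R q\<^esub> residue_frac R q \<one> b = \<one>\<^bsub>residue_field R q\<^esub>"
        using q' 2 by (simp add: embed_apply residue_one residue_frac_mult residue_frac_eq_iff prime_one
            prime_zero minus_eq r_neg)
      then have "e q = (e \<otimes>\<^bsub>V R\<^esub> embed b) q \<otimes>\<^bsub>residue_field R q\<^esub> residue_frac R q \<one> b"
        using q' e b r by (simp add: V_apply K.m_assoc V_apply_closed)
      then show ?thesis unfolding eb using q' r by (simp add: V_apply)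
    qed
    moreover have "\<tau> e = 1"
    proof -
      have "support (restr \<tau>) \<in> spec R" by (rule support_in_spec[OF restr_ordering])
      then have "\<tau> (embed b) = 0" using Basis.prems 2 by (auto simp: basic_open_def support_def restr_def)
      then show ?thesis
        using V.ordering_add_zero(2)[OF \<tau>, of "\<ominus>\<^bsub>V R\<^esub> (embed b \<otimes>\<^bsub>V R\<^esub> c)" "\<one>\<^bsub>V R\<^esub>"] b c(1) \<tau>
        by (simp add: e_def V.minus_eq)
    qed
    ultimately show ?thesis using e by (intro bexI[of _ e]) simp_all
  qed
qed

text \<open>An ordering of \<open>V R\<close> knows about \<open>f\<close> only through equations in \<open>V R\<close>, whereas \<open>f = x / y\<close> holds just on
  a neighbourhood \<open>U\<close> of the support. A section \<open>e\<close> that vanishes outside \<open>U\<close> turns this into the global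
  equation \<open>e f y = e x\<close>, and \<open>\<tau>(e) \<noteq> 0\<close> can be cancelled.\<close>

theorem extend_restr:
  assumes f: "f \<in> carrier (V R)"
  shows "extend (restr \<tau>) f = \<tau> f"
proof -
  let ?\<sigma> = "restr \<tau>"
  note \<sigma> = restr_ordering
  obtain U x y where U: "clopen U" "support ?\<sigma> \<in> U" "U \<subseteq> spec R" "x \<in> carrier R" "y \<in> carrier R"
    "\<forall>q \<in> U. y \<notin> q \<and> f q = residue_frac R q x y"
    using f support_in_spec[OF \<sigma>] by (rule V_carrierE)
  have y: "?\<sigma> y \<noteq> 0" using U by (auto simp: support_def)
  obtain e where e: "e \<in> carrier (V R)" "\<tau> e \<noteq> 0" "\<forall>q \<in> spec R - U. e q = \<zero>\<^bsub>residue_field R q\<^esub>"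
    using separating_section[OF conjunct1[OF U(1)] U(2)] by blast
  have xy: "embed x \<in> carrier (V R)" "embed y \<in> carrier (V R)" using U by (simp_all add: embed_closed)
  have "e \<otimes>\<^bsub>V R\<^esub> (f \<otimes>\<^bsub>V R\<^esub> embed y) = e \<otimes>\<^bsub>V R\<^esub> embed x"
  proof (rule V_eqI)
    fix q assume q: "q \<in> spec R"
    interpret K: cring "residue_field R q" by (rule residue_cring[OF q])
    show "(e \<otimes>\<^bsub>V R\<^esub> (f \<otimes>\<^bsub>V R\<^esub> embed y)) q = (e \<otimes>\<^bsub>V R\<^esub> embed x) q"
    proof (cases "q \<in> U")
      case True
      then have yq: "y \<notin> q" "f q = residue_frac R q x y" using U by auto
      have "x \<otimes> y \<ominus> x \<otimes> y \<in> q" using U prime_zero[OF q] by (simp add: minus_eq r_neg)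
      then have "(f \<otimes>\<^bsub>V R\<^esub> embed y) q = embed x q"
        using q U yq by (simp add: V_apply embed_apply residue_frac_mult residue_frac_eq_iff prime_one)
      then show ?thesis using q by (simp add: V_apply)
    next
      case False
      then have "e q = \<zero>\<^bsub>residue_field R q\<^esub>" using e q by blast
      then show ?thesis using q f xy by (simp add: V_apply V_apply_closed)
    qed
  qed (use e f xy in simp_all)
  then have "\<tau> e * (\<tau> f * \<tau> (embed y)) = \<tau> e * \<tau> (embed x)"
    using V.ordering_mult[OF \<tau>] e f xy by (metis V.m_closed)
  then have "\<tau> f * ?\<sigma> y = ?\<sigma> x" using e U by (simp add: restr_def)
  then have "?\<sigma> x * ?\<sigma> y = \<tau> f * (?\<sigma> y * ?\<sigma> y)" by (simp add: mult_ac)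
  moreover have "extend ?\<sigma> f = ?\<sigma> x * ?\<sigma> y" using f U y by (intro extend_eq[OF \<sigma>]) auto
  ultimately show ?thesis using ordering_square[OF \<sigma> U(5) y] by simp
qed

end

end

section \<open>Signs of sections of the hull\<close>

text \<open>The complement of the set where \<open>y\<close> is nonzero has its indicator function in \<open>Q(R)\<close>. Since that of
  the set itself is the sign function of \<open>y\<^sup>2\<close>, products then give all basic constructible sets.\<close>

definition sign_complemented :: "('a, 'm) ring_scheme \<Rightarrow> bool"
  where "sign_complemented R \<longleftrightarrow>
    (\<forall>y \<in> carrier R. \<exists>z \<in> carrier R. \<forall>\<sigma> \<in> orderings R. \<sigma> z = 1 - \<sigma> y * \<sigma> y)"

context cring
begin

lemma separating_element:
  assumes compl: "sign_complemented R" and \<sigma>: "\<sigma> \<in> orderings R"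
    and "openin (constructible_topology R) U" "support \<sigma> \<in> U"
  shows "\<exists>w \<in> carrier R. \<sigma> w = 1 \<and>
    (\<forall>\<rho> \<in> orderings R. \<rho> w = 0 \<or> \<rho> w = 1 \<and> support \<rho> \<in> U)"
  using assms(3,4) unfolding constructible_topology_def openin_topology_generated_by_iff
proof (induction rule: generate_topology_on.induct)
  case Empty
  then show ?case by simp
next
  case (Int U W)
  then obtain u w where uw: "u \<in> carrier R" "\<sigma> u = 1" "w \<in> carrier R" "\<sigma> w = 1"
    "\<forall>\<rho> \<in> orderings R. \<rho> u = 0 \<or> \<rho> u = 1 \<and> support \<rho> \<in> U"
    "\<forall>\<rho> \<in> orderings R. \<rho> w = 0 \<or> \<rho> w = 1 \<and> support \<rho> \<in> W" by blast
  have "\<rho> (u \<otimes> w) = 0 \<or> \<rho> (u \<otimes> w) = 1 \<and> support \<rho> \<in> U \<inter> W" if "\<rho> \<in> orderings R" for \<rho>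
    using bspec[OF uw(5) that] bspec[OF uw(6) that] uw(1,3) that by auto
  then show ?case using \<sigma> uw by (intro bexI[of _ "u \<otimes> w"]) auto
next
  case (UN K)
  then obtain k where k: "k \<in> K" "support \<sigma> \<in> k" by blast
  then obtain w where "w \<in> carrier R" "\<sigma> w = 1" "\<forall>\<rho> \<in> orderings R. \<rho> w = 0 \<or> \<rho> w = 1 \<and> support \<rho> \<in> k"
    using UN.IH[of k] by blast
  with k show ?case by blast
next
  case (Basis U)
  then consider a where "a \<in> carrier R" "U = basic_open R a"
    | b where "b \<in> carrier R" "U = spec R - basic_open R b" by blast
  then show ?case
  proof cases
    case 1
    have iff: "support \<rho> \<in> U \<longleftrightarrow> \<rho> a \<noteq> 0" if "\<rho> \<in> orderings R" for \<rho>
      using 1 support_in_spec[OF that] by (auto simp: basic_open_def support_def)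
    show ?thesis
      using iff Basis.prems \<sigma> 1(1) ordering_square by (intro bexI[of _ "a \<otimes> a"]) auto
  next
    case 2
    have iff: "support \<rho> \<in> U \<longleftrightarrow> \<rho> b = 0" if "\<rho> \<in> orderings R" for \<rho>
      using 2 support_in_spec[OF that] by (auto simp: basic_open_def support_def)
    obtain z where z: "z \<in> carrier R" "\<forall>\<rho> \<in> orderings R. \<rho> z = 1 - \<rho> b * \<rho> b"
      using compl 2(1) unfolding sign_complemented_def by blast
    have "\<rho> z = 0 \<or> \<rho> z = 1 \<and> support \<rho> \<in> U" if "\<rho> \<in> orderings R" for \<rho>
      using iff[OF that] z that ordering_square[OF that 2(1)] by auto
    moreover have "\<sigma> z = 1" using bspec[OF z(2) \<sigma>] iff[OF \<sigma>] Basis.prems by simp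
    ultimately show ?thesis using z(1) by blast
  qed
qed

text \<open>If \<open>w\<close> and \<open>z\<close> have complementary indicator functions as signs, then \<open>w u + z v\<close> has the signs of \<open>u\<close>
  on one part and of \<open>v\<close> on the other.\<close>

lemma ordering_glue:
  assumes \<sigma>: "\<sigma> \<in> orderings R" and C: "w \<in> carrier R" "z \<in> carrier R" "u \<in> carrier R" "v \<in> carrier R"
  shows "\<sigma> w = 1 \<Longrightarrow> \<sigma> z = 0 \<Longrightarrow> \<sigma> (w \<otimes> u \<oplus> z \<otimes> v) = \<sigma> u"
    and "\<sigma> w = 0 \<Longrightarrow> \<sigma> z = 1 \<Longrightarrow> \<sigma> (w \<otimes> u \<oplus> z \<otimes> v) = \<sigma> v"
  using ordering_add_zero[OF \<sigma>, of "z \<otimes> v" "w \<otimes> u"] ordering_add_zero[OF \<sigma>, of "w \<otimes> u" "z \<otimes> v"] C \<sigma>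
  by simp_all

text \<open>Call \<open>w\<close> good if it has signs \<open>0\<close> and \<open>1\<close> and the problem is solvable on the set where \<open>w\<close> is \<open>1\<close>.
  By \<open>ordering_glue\<close> these sets are closed under unions; they cover all orderings because sections are
  locally fractions; by compactness finitely many of them suffice. A pair of sections is treated
  simultaneously, together with its sum, because the multivalued addition of \<open>Q(R)\<close> asks for
  representatives whose sum in \<open>R\<close> has prescribed signs.\<close>

theorem signs_of_sections_from_ring:
  assumes compl: "sign_complemented R" and f: "f \<in> carrier (V R)" and g: "g \<in> carrier (V R)"
  obtains b c where "b \<in> carrier R" "c \<in> carrier R"
    "\<forall>\<sigma> \<in> orderings R. \<sigma> b = extend \<sigma> f \<and> \<sigma> c = extend \<sigma> g \<and> \<sigma> (b \<oplus> c) = extend \<sigma> (f \<oplus>\<^bsub>V R\<^esub> g)"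
proof -
  define sol where "sol = (\<lambda>\<sigma> b c. \<sigma> b = extend \<sigma> f \<and> \<sigma> c = extend \<sigma> g \<and> \<sigma> (b \<oplus> c) = extend \<sigma> (f \<oplus>\<^bsub>V R\<^esub> g))"
  define good where "good = (\<lambda>w. w \<in> carrier R \<and> (\<forall>\<sigma> \<in> orderings R. \<sigma> w = 0 \<or> \<sigma> w = 1) \<and>
    (\<exists>b \<in> carrier R. \<exists>c \<in> carrier R. \<forall>\<sigma> \<in> orderings R. \<sigma> w = 1 \<longrightarrow> sol \<sigma> b c))"
  have join: "\<exists>u. good u \<and> (\<forall>\<sigma> \<in> orderings R. \<sigma> w = 1 \<or> \<sigma> w' = 1 \<longrightarrow> \<sigma> u = 1)"
    if good: "good w" "good w'" for w w'
  proof -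
    have wC: "w \<in> carrier R" "w' \<in> carrier R"
      and w01: "\<forall>\<sigma> \<in> orderings R. \<sigma> w = 0 \<or> \<sigma> w = 1" "\<forall>\<sigma> \<in> orderings R. \<sigma> w' = 0 \<or> \<sigma> w' = 1"
      using good by (simp_all add: good_def)
    obtain b c where bcC: "b \<in> carrier R" "c \<in> carrier R" "\<forall>\<sigma> \<in> orderings R. \<sigma> w = 1 \<longrightarrow> sol \<sigma> b c"
      using good(1) unfolding good_def by blast
    obtain b' c' where bcC': "b' \<in> carrier R" "c' \<in> carrier R" "\<forall>\<sigma> \<in> orderings R. \<sigma> w' = 1 \<longrightarrow> sol \<sigma> b' c'"
      using good(2) unfolding good_def by blast
    note * = wC(1) bcC(1,2) wC(2) bcC'(1,2)
    note w = bspec[OF w01(1)] bspec[OF bcC(3), rule_format]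
    note w' = bspec[OF w01(2)] bspec[OF bcC'(3), rule_format]
    obtain z where z: "z \<in> carrier R" "\<forall>\<sigma> \<in> orderings R. \<sigma> z = 1 - \<sigma> w * \<sigma> w"
      using compl *(1) unfolding sign_complemented_def by blast
    let ?u = "w \<otimes> \<one> \<oplus> z \<otimes> w'" and ?b = "w \<otimes> b \<oplus> z \<otimes> b'" and ?c = "w \<otimes> c \<oplus> z \<otimes> c'"
    have bc: "?b \<oplus> ?c = w \<otimes> (b \<oplus> c) \<oplus> z \<otimes> (b' \<oplus> c')"
      using * z(1) by (simp add: r_distr a_ac)
    have u: "(\<sigma> ?u = 0 \<or> \<sigma> ?u = 1) \<and> (\<sigma> ?u = 1 \<longrightarrow> sol \<sigma> ?b ?c) \<and> (\<sigma> w = 1 \<or> \<sigma> w' = 1 \<longrightarrow> \<sigma> ?u = 1)"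
      if \<sigma>: "\<sigma> \<in> orderings R" for \<sigma>
      using w(1)[OF \<sigma>]
    proof
      assume 0: "\<sigma> w = 0"
      then have 1: "\<sigma> z = 1" using bspec[OF z(2) \<sigma>] by simp
      note glue = ordering_glue(2)[OF \<sigma> *(1) z(1) _ _ 0 1]
      have u: "\<sigma> ?u = \<sigma> w'" by (rule glue) (use * in simp_all)
      show ?thesis
        unfolding u sol_def bc using glue * w'[OF \<sigma>] 0 by (auto simp add: sol_def)
    next
      assume 1: "\<sigma> w = 1"
      then have 0: "\<sigma> z = 0" using bspec[OF z(2) \<sigma>] by simp
      note glue = ordering_glue(1)[OF \<sigma> *(1) z(1) _ _ 1 0]
      have u: "\<sigma> ?u = \<sigma> \<one>" by (rule glue) (use * in simp_all)
      show ?thesis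
        unfolding u sol_def bc using glue * w[OF \<sigma>] 1 \<sigma> by (simp add: sol_def)
    qed
    have "?u \<in> carrier R" "?b \<in> carrier R" "?c \<in> carrier R" using * z(1) by simp_all
    with u have "good ?u" unfolding good_def by blast
    with u show ?thesis by blast
  qed
  have local: "\<exists>w. good w \<and> \<sigma> w = 1" if \<sigma>: "\<sigma> \<in> orderings R" for \<sigma>
  proof -
    obtain U x y where U: "clopen U" "support \<sigma> \<in> U" "U \<subseteq> spec R" "x \<in> carrier R" "y \<in> carrier R"
      "\<forall>q \<in> U. y \<notin> q \<and> f q = residue_frac R q x y" using f support_in_spec[OF \<sigma>] by (rule V_carrierE)
    obtain W z v where W: "clopen W" "support \<sigma> \<in> W" "W \<subseteq> spec R" "z \<in> carrier R" "v \<in> carrier R"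
      "\<forall>q \<in> W. v \<notin> q \<and> g q = residue_frac R q z v" using g support_in_spec[OF \<sigma>] by (rule V_carrierE)
    have UW: "openin (constructible_topology R) (U \<inter> W)" "support \<sigma> \<in> U \<inter> W" using U W by auto
    obtain w where w: "w \<in> carrier R" "\<sigma> w = 1"
      "\<forall>\<rho> \<in> orderings R. \<rho> w = 0 \<or> \<rho> w = 1 \<and> support \<rho> \<in> U \<inter> W"
      using separating_element[OF compl \<sigma> UW] by blast
    \<comment> \<open>The numerators of \<open>f = x / y\<close> and \<open>g = z / v\<close> over the common denominator \<open>y\<^sup>2 v\<^sup>2\<close>, which is
      positive; hence the sum of the numerators also has the sign of \<open>f + g\<close>.\<close>
    let ?b = "x \<otimes> y \<otimes> (v \<otimes> v)" and ?c = "z \<otimes> v \<otimes> (y \<otimes> y)"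
    have "sol \<rho> ?b ?c" if \<rho>: "\<rho> \<in> orderings R" "\<rho> w = 1" for \<rho>
    proof -
      have supp: "support \<rho> \<in> U" "support \<rho> \<in> W" "support \<rho> \<in> spec R" using w U that by auto
      have fr: "y \<notin> support \<rho>" "f (support \<rho>) = residue_frac R (support \<rho>) x y"
        "v \<notin> support \<rho>" "g (support \<rho>) = residue_frac R (support \<rho>) z v"
        using supp U W by auto
      have n: "\<rho> y \<noteq> 0" "\<rho> v \<noteq> 0" using fr U W by (auto simp: support_def)
      note sq = ordering_square[OF \<rho>(1) U(5) n(1)] ordering_square[OF \<rho>(1) W(5) n(2)]
      have "extend \<rho> f = \<rho> x * \<rho> y" "extend \<rho> g = \<rho> z * \<rho> v"
        using extend_eq[OF \<rho>(1)] f g U W fr n by auto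
      moreover have "(f \<oplus>\<^bsub>V R\<^esub> g) (support \<rho>) = residue_frac R (support \<rho>) (x \<otimes> v \<oplus> z \<otimes> y) (y \<otimes> v)"
        using supp fr U W by (simp add: V_apply residue_frac_add)
      then have "extend \<rho> (f \<oplus>\<^bsub>V R\<^esub> g) = \<rho> (x \<otimes> v \<oplus> z \<otimes> y) * \<rho> (y \<otimes> v)"
        using U W f g \<rho> n by (intro extend_eq) (simp_all add: V_closed)
      then have "extend \<rho> (f \<oplus>\<^bsub>V R\<^esub> g) = \<rho> ((x \<otimes> v \<oplus> z \<otimes> y) \<otimes> (y \<otimes> v))"
        using U W \<rho> by simp
      moreover have "(x \<otimes> v \<oplus> z \<otimes> y) \<otimes> (y \<otimes> v) = ?b \<oplus> ?c"
        using U W by (simp add: l_distr r_distr m_ac)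
      ultimately show ?thesis using U W \<rho> sq by (simp add: sol_def)
    qed
    moreover have "?b \<in> carrier R" "?c \<in> carrier R" using U W by simp_all
    ultimately have "good w" unfolding good_def using w by blast
    then show ?thesis using w by blast
  qed
  \<comment> \<open>Compactness is stated for negative signs, hence the sign change.\<close>
  define G where "G = {\<ominus> w | w. good w}"
  have "G \<subseteq> carrier R" by (auto simp: G_def good_def)
  moreover have "\<exists>g \<in> G. \<sigma> g < 0" if \<sigma>: "\<sigma> \<in> orderings R" for \<sigma>
  proof -
    obtain w where w: "good w" "\<sigma> w = 1" using local[OF \<sigma>] by blast
    then have "\<sigma> (\<ominus> w) < 0" using \<sigma> by (simp add: good_def)
    then show ?thesis using w unfolding G_def by blast
  qed
  ultimately obtain F where F: "finite F" "F \<subseteq> G" "\<forall>\<sigma> \<in> orderings R. \<exists>g \<in> F. \<sigma> g < 0"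
    by (rule orderings_compact)
  have "\<exists>u. good u \<and> (\<forall>\<sigma> \<in> orderings R. (\<exists>g \<in> F. \<sigma> g < 0) \<longrightarrow> \<sigma> u = 1)"
    using F(1,2)
  proof induction
    case empty
    have "good \<zero>" unfolding good_def by (auto intro: zero_closed)
    then show ?case by blast
  next
    case (insert g F)
    obtain u where u: "good u" "\<forall>\<sigma> \<in> orderings R. (\<exists>g \<in> F. \<sigma> g < 0) \<longrightarrow> \<sigma> u = 1"
      using insert by auto
    obtain w where w: "good w" "g = \<ominus> w" using insert by (auto simp: G_def)
    then have wg: "\<sigma> w = 1" if "\<sigma> \<in> orderings R" "\<sigma> g < 0" for \<sigma>
      using that by (auto simp: good_def)
    obtain v where v: "good v" "\<forall>\<sigma> \<in> orderings R. \<sigma> u = 1 \<or> \<sigma> w = 1 \<longrightarrow> \<sigma> v = 1"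
      using join[OF u(1) w(1)] by blast
    show ?case using u(2) v wg by (intro exI[of _ v]) auto
  qed
  then obtain u where u: "good u" "\<forall>\<sigma> \<in> orderings R. \<sigma> u = 1" using F(3) by blast
  then obtain b c where "b \<in> carrier R" "c \<in> carrier R" "\<forall>\<sigma> \<in> orderings R. sol \<sigma> b c"
    unfolding good_def by blast
  then show ?thesis using that unfolding sol_def by blast
qed

end

section \<open>Representing the real reduced multiring\<close>

lemma hat_eq_iff: "hat M a = hat M b \<longleftrightarrow> (\<forall>\<sigma> \<in> sper M. \<sigma> a = \<sigma> b)"
  by (auto simp: hat_def restrict_def fun_eq_iff)

lemma Qred_simps:
  "carrier (Qred M) = hat M ` carrier M" "\<one>\<^bsub>Qred M\<^esub> = hat M \<one>\<^bsub>M\<^esub>" "mzero (Qred M) = hat M (mzero M)"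
  by (simp_all add: Qred_def)

lemma Qred_madd_iff:
  "h \<in> f \<boxplus>\<^bsub>Qred M\<^esub> g \<longleftrightarrow> (\<exists>a \<in> carrier M. \<exists>b \<in> carrier M. \<exists>c \<in> carrier M.
     h = hat M a \<and> f = hat M b \<and> g = hat M c \<and> a \<in> b \<boxplus>\<^bsub>M\<^esub> c)"
  by (auto simp: Qred_def)

lemma marshall_quotient_simps:
  "carrier (M /\<^sub>m S) = carrier M // marshall_rel M S"
  "\<one>\<^bsub>M /\<^sub>m S\<^esub> = marshall_class M S \<one>\<^bsub>M\<^esub>" "mzero (M /\<^sub>m S) = marshall_class M S (mzero M)"
  by (simp_all add: marshall_quotient_def)

lemma marshall_carrierE:
  assumes "X \<in> carrier (M /\<^sub>m S)"
  obtains a where "a \<in> carrier M" "X = marshall_class M S a"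
  using assms by (auto simp: marshall_quotient_simps marshall_class_def elim: quotientE)

lemma marshall_class_closed: "a \<in> carrier M \<Longrightarrow> marshall_class M S a \<in> carrier (M /\<^sub>m S)"
  by (auto simp: marshall_quotient_simps marshall_class_def intro: quotientI)

lemma (in multiring) marshall_maddI:
  assumes S: "submonoid S M" and C: "a \<in> carrier M" "b \<in> carrier M" "c \<in> carrier M"
    and "s \<in> S" "t \<in> S" "u \<in> S" "a \<otimes> s \<in> (b \<otimes> t) \<boxplus> (c \<otimes> u)"
  shows "marshall_class M S a \<in> marshall_class M S b \<boxplus>\<^bsub>M /\<^sub>m S\<^esub> marshall_class M S c"
proof -
  have "a \<in> marshall_class M S a" "b \<in> marshall_class M S b" "c \<in> marshall_class M S c"
    using C by (simp_all add: marshall_class_in[OF S])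
  then show ?thesis
    using assms marshall_class_closed[of a M S] by (simp add: marshall_quotient_def) blast
qed

text \<open>Let \<open>x \<in> B\<close> represent \<open>y\<close>. The identity \<open>y\<^sup>3 = y\<close> of signs becomes \<open>x\<^sup>3 s = x t\<close> in \<open>B\<close>. The element
  \<open>c = t - x\<^sup>2 s\<close> lies in the sum \<open>1 + (-x\<^sup>2)\<close> of the quotient, so its sign is \<open>1\<close> where \<open>y\<close> vanishes; and
  \<open>x c = 0\<close>, so its sign is \<open>0\<close> elsewhere.\<close>

theorem sign_complemented_if_marshall_represented:
  fixes A :: "('a, 'm) ring_scheme" and B :: "('b, 'n) ring_scheme"
  assumes A: "cring A" and B: "cring B" and S: "submonoid S B"
    and iso: "Qred (multiring_of_ring A) \<cong>\<^sub>m multiring_of_ring B /\<^sub>m S"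
  shows "sign_complemented A"
  unfolding sign_complemented_def
proof
  fix y assume y: "y \<in> carrier A"
  interpret A: cring A by (rule A)
  interpret B: cring B by (rule B)
  interpret MA: multiring "multiring_of_ring A" by (rule A.multiring_of_ring)
  interpret MB: multiring "multiring_of_ring B" by (rule B.multiring_of_ring)
  let ?M = "multiring_of_ring B /\<^sub>m S" and ?Q = "Qred (multiring_of_ring A)"
  let ?cl = "marshall_class (multiring_of_ring B) S" and ?h = "hat (multiring_of_ring A)"
  have S': "submonoid S (multiring_of_ring B)" using S by (simp add: submonoid_def)
  have SB: "S \<subseteq> carrier B" "\<one>\<^bsub>B\<^esub> \<in> S" using S by (auto simp: submonoid_def)
  obtain F G where F: "F \<in> multiring_hom ?Q ?M" and G: "G \<in> multiring_hom ?M ?Q"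
    and GF: "\<forall>a \<in> carrier ?Q. G (F a) = a" and FG: "\<forall>b \<in> carrier ?M. F (G b) = b"
    using iso unfolding multiring_isomorphic_def by blast
  have Gmult: "G (?cl a \<otimes>\<^bsub>?M\<^esub> ?cl b) = G (?cl a) \<otimes>\<^bsub>?Q\<^esub> G (?cl b)" if "a \<in> carrier B" "b \<in> carrier B" for a b
    using G that by (simp add: multiring_hom_def marshall_class_closed)
  have Gcl: "G (?cl a) \<in> carrier ?Q" if "a \<in> carrier B" for a
    using G that by (auto simp: multiring_hom_def marshall_class_closed)
  have hy: "?h y \<in> carrier ?Q" using y by (simp add: Qred_simps)
  then have "F (?h y) \<in> carrier ?M" using F by (auto simp: multiring_hom_def)
  then obtain x where x: "x \<in> carrier B" "F (?h y) = ?cl x" by (auto elim: marshall_carrierE)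
  then have Gx: "G (?cl x) = ?h y" using GF hy by metis
  have Gx2: "G (?cl (x \<otimes>\<^bsub>B\<^esub> x)) = ?h (y \<otimes>\<^bsub>A\<^esub> y)"
    using Gmult[OF x(1) x(1)] MB.marshall_mult_class[OF S', of x x] MA.hat_mult_neg(1)[of y y] x y Gx by simp
  have "G (?cl (x \<otimes>\<^bsub>B\<^esub> x \<otimes>\<^bsub>B\<^esub> x)) = ?h (y \<otimes>\<^bsub>A\<^esub> y \<otimes>\<^bsub>A\<^esub> y)"
    using Gmult[of "x \<otimes>\<^bsub>B\<^esub> x" x] MB.marshall_mult_class[OF S', of "x \<otimes>\<^bsub>B\<^esub> x" x]
      MA.hat_mult_neg(1)[of "y \<otimes>\<^bsub>A\<^esub> y" y] x y Gx Gx2 by simp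
  also have "\<dots> = ?h y"
    unfolding hat_eq_iff using y A.ordering_vals A.ordering_mult by fastforce
  finally have "F (G (?cl (x \<otimes>\<^bsub>B\<^esub> x \<otimes>\<^bsub>B\<^esub> x))) = F (G (?cl x))" unfolding Gx by simp
  then have "?cl (x \<otimes>\<^bsub>B\<^esub> x \<otimes>\<^bsub>B\<^esub> x) = ?cl x"
    using FG x(1) by (simp add: marshall_class_closed)
  then have "x \<in> ?cl (x \<otimes>\<^bsub>B\<^esub> x \<otimes>\<^bsub>B\<^esub> x)"
    using MB.marshall_class_in[OF S', of x] x(1) by simp
  then obtain s t where st: "s \<in> S" "t \<in> S" "x \<otimes>\<^bsub>B\<^esub> x \<otimes>\<^bsub>B\<^esub> x \<otimes>\<^bsub>B\<^esub> s = x \<otimes>\<^bsub>B\<^esub> t"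
    unfolding marshall_class_def by (auto elim!: MB.marshall_relE)
  have stB: "s \<in> carrier B" "t \<in> carrier B" using st SB by auto
  define c where "c = t \<oplus>\<^bsub>B\<^esub> (\<ominus>\<^bsub>B\<^esub> (x \<otimes>\<^bsub>B\<^esub> x)) \<otimes>\<^bsub>B\<^esub> s"
  have c: "c \<in> carrier B" using x stB by (simp add: c_def)
  have "x \<otimes>\<^bsub>B\<^esub> c = x \<otimes>\<^bsub>B\<^esub> t \<ominus>\<^bsub>B\<^esub> x \<otimes>\<^bsub>B\<^esub> x \<otimes>\<^bsub>B\<^esub> x \<otimes>\<^bsub>B\<^esub> s"
    using x(1) stB by (simp add: c_def B.r_distr B.minus_eq B.l_minus B.r_minus B.m_ac)
  then have xc: "x \<otimes>\<^bsub>B\<^esub> c = \<zero>\<^bsub>B\<^esub>" unfolding st(3) using x(1) stB by (simp add: B.minus_eq B.r_neg)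
  have "?cl c \<in> ?cl \<one>\<^bsub>B\<^esub> \<boxplus>\<^bsub>?M\<^esub> ?cl (\<ominus>\<^bsub>B\<^esub> (x \<otimes>\<^bsub>B\<^esub> x))"
    using x(1) c stB by (intro MB.marshall_maddI[OF S' _ _ _ SB(2) st(2,1)]) (simp_all add: c_def)
  then have "G (?cl c) \<in> G (?cl \<one>\<^bsub>B\<^esub>) \<boxplus>\<^bsub>?Q\<^esub> G (?cl (\<ominus>\<^bsub>B\<^esub> (x \<otimes>\<^bsub>B\<^esub> x)))"
    using G c x(1) unfolding multiring_hom_def by (simp add: marshall_class_closed)
  moreover have "G (?cl \<one>\<^bsub>B\<^esub>) = ?h \<one>\<^bsub>A\<^esub>"
    using G by (simp add: multiring_hom_def marshall_quotient_simps Qred_simps)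
  moreover have "G (?cl (\<ominus>\<^bsub>B\<^esub> (x \<otimes>\<^bsub>B\<^esub> x))) = ?h (\<ominus>\<^bsub>A\<^esub> (y \<otimes>\<^bsub>A\<^esub> y))"
  proof -
    have "?cl (\<ominus>\<^bsub>B\<^esub> (x \<otimes>\<^bsub>B\<^esub> x)) = \<boxminus>\<^bsub>?M\<^esub> ?cl (x \<otimes>\<^bsub>B\<^esub> x)"
      using MB.marshall_neg_class[OF S', of "x \<otimes>\<^bsub>B\<^esub> x"] x(1) by simp
    then have "G (?cl (\<ominus>\<^bsub>B\<^esub> (x \<otimes>\<^bsub>B\<^esub> x))) = \<boxminus>\<^bsub>?Q\<^esub> G (?cl (x \<otimes>\<^bsub>B\<^esub> x))"
      using G x(1) by (simp add: multiring_hom_def marshall_class_closed)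
    then show ?thesis unfolding Gx2 using MA.hat_mult_neg(2)[of "y \<otimes>\<^bsub>A\<^esub> y"] y by simp
  qed
  ultimately obtain a b d where abd: "a \<in> carrier A" "b \<in> carrier A" "d \<in> carrier A" "G (?cl c) = ?h a"
    "?h b = ?h \<one>\<^bsub>A\<^esub>" "?h d = ?h (\<ominus>\<^bsub>A\<^esub> (y \<otimes>\<^bsub>A\<^esub> y))" "a = b \<oplus>\<^bsub>A\<^esub> d"
    unfolding Qred_madd_iff by (auto dest: sym)
  have "?h (y \<otimes>\<^bsub>A\<^esub> a) = ?h \<zero>\<^bsub>A\<^esub>"
  proof -
    have "?h (y \<otimes>\<^bsub>A\<^esub> a) = G (?cl x) \<otimes>\<^bsub>?Q\<^esub> G (?cl c)"
      using MA.hat_mult_neg(1)[of y a] y abd Gx by simp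
    also have "\<dots> = G (?cl \<zero>\<^bsub>B\<^esub>)"
      using Gmult[OF x(1) c] MB.marshall_mult_class[OF S', of x c] x(1) c xc by simp
    also have "\<dots> = ?h \<zero>\<^bsub>A\<^esub>"
      using G by (simp add: multiring_hom_def marshall_quotient_simps Qred_simps)
    finally show ?thesis .
  qed
  then have ya: "\<sigma> y * \<sigma> a = 0" if "\<sigma> \<in> orderings A" for \<sigma>
    using that y abd(1) by (simp add: hat_eq_iff)
  have "\<sigma> a = 1 - \<sigma> y * \<sigma> y" if \<sigma>: "\<sigma> \<in> orderings A" for \<sigma>
  proof (cases "\<sigma> y = 0")
    case True
    have "\<sigma> d = \<sigma> (\<ominus>\<^bsub>A\<^esub> (y \<otimes>\<^bsub>A\<^esub> y))" "\<sigma> b = \<sigma> \<one>\<^bsub>A\<^esub>"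
      using abd(5,6) \<sigma> unfolding hat_eq_iff by blast+
    then have "\<sigma> d = 0" "\<sigma> b = 1" using True y \<sigma> by simp_all
    then show ?thesis using A.ordering_add_zero(2)[OF \<sigma> abd(3,2)] abd(7) True by simp
  next
    case False
    then show ?thesis using ya[OF \<sigma>] A.ordering_square[OF \<sigma> y] by simp
  qed
  then show "\<exists>z \<in> carrier A. \<forall>\<sigma> \<in> orderings A. \<sigma> z = 1 - \<sigma> y * \<sigma> y" using abd(1) by blast
qed

text \<open>The isomorphism sends the sign function of \<open>a \<in> A\<close> to the class \<open>cl a\<close> of \<open>a\<close> in the quotient of
  \<open>V A\<close>. Classes are determined by signs at the orderings of \<open>A\<close> (\<open>rel_iff\<close>), which gives injectivity;
  surjectivity and the reflection of sums are the two uses of \<open>signs_of_sections_from_ring\<close>.\<close>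

theorem Qred_isomorphic_V_quotient:
  assumes A: "cring A" and compl: "sign_complemented A"
  shows "Qred (multiring_of_ring A) \<cong>\<^sub>m
    multiring_of_ring (V A) /\<^sub>m one_plus_sums_of_squares (multiring_of_ring (V A))"
proof -
  interpret A: cring A by (rule A)
  interpret V: cring "V A" by (rule A.cring_V)
  interpret MA: multiring "multiring_of_ring A" by (rule A.multiring_of_ring)
  interpret MV: multiring "multiring_of_ring (V A)" by (rule V.multiring_of_ring)
  define T where "T = one_plus_sum_squares (V A)"
  let ?M = "multiring_of_ring (V A) /\<^sub>m T" and ?Q = "Qred (multiring_of_ring A)"
  let ?h = "hat (multiring_of_ring A)"
  define cl where "cl = (\<lambda>a. marshall_class (multiring_of_ring (V A)) T (A.embed a))"
  have T: "submonoid T (multiring_of_ring (V A))"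
    unfolding T_def by (rule V.submonoid_one_plus_sum_squares)
  have one: "\<one>\<^bsub>V A\<^esub> \<in> T" unfolding T_def by (rule V.one_in_one_plus_sum_squares)
  have signs: "A.extend \<sigma> (f \<otimes>\<^bsub>V A\<^esub> s) = A.extend \<sigma> f"
    if "\<sigma> \<in> orderings A" "f \<in> carrier (V A)" "s \<in> T" for \<sigma> f s
    using that V.ordering_one_plus_sum_squares[OF A.extend_ordering] V.one_plus_sum_squares_closed
    by (simp add: A.extend_mult T_def)
  have rel_iff: "(f, g) \<in> marshall_rel (multiring_of_ring (V A)) T \<longleftrightarrow>
      (\<forall>\<sigma> \<in> orderings A. A.extend \<sigma> f = A.extend \<sigma> g)"
    if fg: "f \<in> carrier (V A)" "g \<in> carrier (V A)" for f g
  proof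
    assume "(f, g) \<in> marshall_rel (multiring_of_ring (V A)) T"
    then obtain s t where "s \<in> T" "t \<in> T" "f \<otimes>\<^bsub>V A\<^esub> s = g \<otimes>\<^bsub>V A\<^esub> t"
      by (auto elim: MV.marshall_relE)
    then show "\<forall>\<sigma> \<in> orderings A. A.extend \<sigma> f = A.extend \<sigma> g" using signs fg by metis
  next
    assume *: "\<forall>\<sigma> \<in> orderings A. A.extend \<sigma> f = A.extend \<sigma> g"
    have "\<tau> f = \<tau> g" if "\<tau> \<in> orderings (V A)" for \<tau>
      using * A.extend_restr[OF that] A.restr_ordering[OF that] fg by metis
    then obtain s t where "s \<in> T" "t \<in> T" "f \<otimes>\<^bsub>V A\<^esub> s = g \<otimes>\<^bsub>V A\<^esub> t"
      unfolding T_def by (rule marshall_equivalent_if_same_signs[OF A.von_neumann_regular_V fg])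
    then show "(f, g) \<in> marshall_rel (multiring_of_ring (V A)) T"
      using fg by (intro MV.marshall_relI) simp_all
  qed
  have rel_embed: "f \<in> marshall_class (multiring_of_ring (V A)) T (A.embed a) \<longleftrightarrow>
      f \<in> carrier (V A) \<and> (\<forall>\<sigma> \<in> orderings A. A.extend \<sigma> f = \<sigma> a)" if "a \<in> carrier A" for a f
  proof -
    have "f \<in> marshall_class (multiring_of_ring (V A)) T (A.embed a) \<Longrightarrow> f \<in> carrier (V A)"
      unfolding marshall_class_def by (auto elim: MV.marshall_relE)
    then show ?thesis
      using rel_iff[of "A.embed a" f] that unfolding marshall_class_def
      by (auto simp: A.embed_closed A.extend_embed)
  qed
  have cl_closed: "cl a \<in> carrier ?M" if "a \<in> carrier A" for a
    using that by (simp add: cl_def marshall_class_closed A.embed_closed)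
  have cl_eq_iff: "cl a = cl b \<longleftrightarrow> ?h a = ?h b" if "a \<in> carrier A" "b \<in> carrier A" for a b
  proof
    assume "cl a = cl b"
    then have "A.embed a \<in> cl b"
      using MV.marshall_class_in[OF T, of "A.embed a"] that by (simp add: cl_def A.embed_closed)
    then show "?h a = ?h b" using that by (simp add: cl_def rel_embed hat_eq_iff A.extend_embed)
  next
    assume "?h a = ?h b"
    then have "(A.embed a, A.embed b) \<in> marshall_rel (multiring_of_ring (V A)) T"
      using that by (simp add: rel_iff A.embed_closed A.extend_embed hat_eq_iff)
    then show "cl a = cl b" unfolding cl_def by (rule MV.marshall_class_eq[OF T])
  qed
  have cl_surj: "\<exists>a \<in> carrier A. X = cl a" if "X \<in> carrier ?M" for X
  proof -
    obtain f where f: "f \<in> carrier (V A)" "X = marshall_class (multiring_of_ring (V A)) T f"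
      using \<open>X \<in> carrier ?M\<close> by (auto elim: marshall_carrierE)
    obtain a where a: "a \<in> carrier A" "\<forall>\<sigma> \<in> orderings A. \<sigma> a = A.extend \<sigma> f"
      using A.signs_of_sections_from_ring[OF compl f(1) f(1)] by metis
    then have "(f, A.embed a) \<in> marshall_rel (multiring_of_ring (V A)) T"
      using f by (simp add: rel_iff A.embed_closed A.extend_embed)
    then have "X = cl a" unfolding f(2) cl_def by (rule MV.marshall_class_eq[OF T])
    then show ?thesis using a by blast
  qed
  have cl_mult: "cl a \<otimes>\<^bsub>?M\<^esub> cl b = cl (a \<otimes>\<^bsub>A\<^esub> b)" if "a \<in> carrier A" "b \<in> carrier A" for a b
    using MV.marshall_mult_class[OF T, of "A.embed a" "A.embed b"] that
    by (simp add: cl_def A.embed_closed A.embed_mult)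
  have cl_neg: "\<boxminus>\<^bsub>?M\<^esub> cl a = cl (\<ominus>\<^bsub>A\<^esub> a)" if "a \<in> carrier A" for a
    using MV.marshall_neg_class[OF T, of "A.embed a"] that
    by (simp add: cl_def A.embed_closed A.embed_neg)
  have cl_add: "cl a \<in> cl b \<boxplus>\<^bsub>?M\<^esub> cl c \<longleftrightarrow> ?h a \<in> ?h b \<boxplus>\<^bsub>?Q\<^esub> ?h c"
    if abc: "a \<in> carrier A" "b \<in> carrier A" "c \<in> carrier A" for a b c
  proof
    assume "?h a \<in> ?h b \<boxplus>\<^bsub>?Q\<^esub> ?h c"
    then obtain a' b' c' where *: "a' \<in> carrier A" "b' \<in> carrier A" "c' \<in> carrier A"
      "?h a = ?h a'" "?h b = ?h b'" "?h c = ?h c'" "a' = b' \<oplus>\<^bsub>A\<^esub> c'"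
      unfolding Qred_madd_iff by auto
    then have "cl a = cl a'" "cl b = cl b'" "cl c = cl c'" using cl_eq_iff abc by blast+
    moreover have "cl a' \<in> cl b' \<boxplus>\<^bsub>?M\<^esub> cl c'"
      unfolding cl_def using *
      by (intro MV.marshall_maddI[OF T _ _ _ one one one]) (simp_all add: A.embed_closed A.embed_add)
    ultimately show "cl a \<in> cl b \<boxplus>\<^bsub>?M\<^esub> cl c" by simp
  next
    assume "cl a \<in> cl b \<boxplus>\<^bsub>?M\<^esub> cl c"
    then obtain f g h s t u where *: "f \<in> cl a" "g \<in> cl b" "h \<in> cl c" "s \<in> T" "t \<in> T" "u \<in> T"
      "f \<otimes>\<^bsub>V A\<^esub> s = g \<otimes>\<^bsub>V A\<^esub> t \<oplus>\<^bsub>V A\<^esub> h \<otimes>\<^bsub>V A\<^esub> u"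
      by (auto simp: marshall_quotient_def)
    have C: "f \<in> carrier (V A)" "g \<in> carrier (V A)" "h \<in> carrier (V A)"
      using *(1-3) abc by (simp_all add: cl_def rel_embed)
    have C': "s \<in> carrier (V A)" "t \<in> carrier (V A)" "u \<in> carrier (V A)"
      using *(4-6) V.one_plus_sum_squares_closed by (simp_all add: T_def)
    have gt: "g \<otimes>\<^bsub>V A\<^esub> t \<in> carrier (V A)" and hu: "h \<otimes>\<^bsub>V A\<^esub> u \<in> carrier (V A)"
      using C C' by simp_all
    obtain b' c' where b': "b' \<in> carrier A" "c' \<in> carrier A"
      "\<forall>\<sigma> \<in> orderings A. \<sigma> b' = A.extend \<sigma> (g \<otimes>\<^bsub>V A\<^esub> t) \<and> \<sigma> c' = A.extend \<sigma> (h \<otimes>\<^bsub>V A\<^esub> u) \<and>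
        \<sigma> (b' \<oplus>\<^bsub>A\<^esub> c') = A.extend \<sigma> (g \<otimes>\<^bsub>V A\<^esub> t \<oplus>\<^bsub>V A\<^esub> h \<otimes>\<^bsub>V A\<^esub> u)"
      by (rule A.signs_of_sections_from_ring[OF compl gt hu])
    have "\<sigma> b' = \<sigma> b \<and> \<sigma> c' = \<sigma> c \<and> \<sigma> (b' \<oplus>\<^bsub>A\<^esub> c') = \<sigma> a" if \<sigma>: "\<sigma> \<in> orderings A" for \<sigma>
    proof -
      have "A.extend \<sigma> f = \<sigma> a" "A.extend \<sigma> g = \<sigma> b" "A.extend \<sigma> h = \<sigma> c"
        using *(1-3) abc \<sigma> by (simp_all add: cl_def rel_embed)
      then show ?thesis
        using bspec[OF b'(3) \<sigma>] signs[OF \<sigma> C(1) *(4)] signs[OF \<sigma> C(2) *(5)] signs[OF \<sigma> C(3) *(6)]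
        unfolding *(7)[symmetric] by simp
    qed
    then have "?h a = ?h (b' \<oplus>\<^bsub>A\<^esub> c')" "?h b = ?h b'" "?h c = ?h c'" unfolding hat_eq_iff by metis+
    then show "?h a \<in> ?h b \<boxplus>\<^bsub>?Q\<^esub> ?h c" unfolding Qred_madd_iff using b'(1,2) by auto
  qed
  define F where "F = (\<lambda>h. cl (SOME a. a \<in> carrier A \<and> ?h a = h))"
  define G where "G = (\<lambda>X. ?h (SOME a. a \<in> carrier A \<and> cl a = X))"
  have F: "F (?h a) = cl a" if "a \<in> carrier A" for a
  proof -
    have "(SOME b. b \<in> carrier A \<and> ?h b = ?h a) \<in> carrier A \<and> ?h (SOME b. b \<in> carrier A \<and> ?h b = ?h a) = ?h a"
      by (rule someI[of _ a]) (use that in simp)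
    then show ?thesis unfolding F_def using cl_eq_iff that by blast
  qed
  have G: "G (cl a) = ?h a" if "a \<in> carrier A" for a
  proof -
    have "(SOME b. b \<in> carrier A \<and> cl b = cl a) \<in> carrier A \<and> cl (SOME b. b \<in> carrier A \<and> cl b = cl a) = cl a"
      by (rule someI[of _ a]) (use that in simp)
    then show ?thesis unfolding G_def using cl_eq_iff that by blast
  qed
  have hat_mult: "?h a \<otimes>\<^bsub>?Q\<^esub> ?h b = ?h (a \<otimes>\<^bsub>A\<^esub> b)" "\<boxminus>\<^bsub>?Q\<^esub> ?h a = ?h (\<ominus>\<^bsub>A\<^esub> a)"
    if "a \<in> carrier A" "b \<in> carrier A" for a b
    using MA.hat_mult_neg[of a b] that by simp_all
  have units: "mzero ?M = cl \<zero>\<^bsub>A\<^esub>" "\<one>\<^bsub>?M\<^esub> = cl \<one>\<^bsub>A\<^esub>"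
    by (simp_all add: cl_def marshall_quotient_simps A.V_one_eq A.V_zero_eq)
  have "F \<in> multiring_hom ?Q ?M"
    unfolding multiring_hom_def
    by (auto simp: Qred_simps F cl_closed cl_add hat_mult cl_mult cl_neg units)
  moreover have "G \<in> multiring_hom ?M ?Q"
  proof -
    have "G X \<in> carrier ?Q" if "X \<in> carrier ?M" for X
      using cl_surj[OF that] by (auto simp: G Qred_simps)
    moreover have "G X \<in> G Y \<boxplus>\<^bsub>?Q\<^esub> G Z"
      if "X \<in> carrier ?M" "Y \<in> carrier ?M" "Z \<in> carrier ?M" "X \<in> Y \<boxplus>\<^bsub>?M\<^esub> Z" for X Y Z
      using cl_surj[OF that(1)] cl_surj[OF that(2)] cl_surj[OF that(3)] that(4) by (auto simp: G cl_add)
    moreover have "G (X \<otimes>\<^bsub>?M\<^esub> Y) = G X \<otimes>\<^bsub>?Q\<^esub> G Y" if "X \<in> carrier ?M" "Y \<in> carrier ?M" for X Y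
      using cl_surj[OF that(1)] cl_surj[OF that(2)] by (auto simp: G cl_mult hat_mult)
    moreover have "G (\<boxminus>\<^bsub>?M\<^esub> X) = \<boxminus>\<^bsub>?Q\<^esub> G X" if "X \<in> carrier ?M" for X
      using cl_surj[OF that(1)] by (auto simp: G cl_neg hat_mult)
    ultimately show ?thesis
      unfolding multiring_hom_def by (auto simp: units G Qred_simps)
  qed
  moreover have "\<forall>h \<in> carrier ?Q. G (F h) = h" by (auto simp: Qred_simps F G)
  moreover have "\<forall>X \<in> carrier ?M. F (G X) = X"
  proof
    fix X assume "X \<in> carrier ?M"
    from cl_surj[OF this] show "F (G X) = X" by (auto simp: F G)
  qed
  ultimately show ?thesis
    unfolding multiring_isomorphic_def T_def by blast
qed

theorem corollary4p13:
  fixes A :: "('a, 'm) ring_scheme"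
    and B :: "('b, 'n) ring_scheme"
    and S :: "'b set"
  assumes "cring A"
    and "semi_real (multiring_of_ring A)"
    and "cring B"
    and "submonoid S B"
    and "Qred (multiring_of_ring A) \<cong>\<^sub>m multiring_of_ring B /\<^sub>m S"
  shows "von_neumann_regular (V A) \<and>
    Qred (multiring_of_ring A) \<cong>\<^sub>m
      multiring_of_ring (V A) /\<^sub>m one_plus_sums_of_squares (multiring_of_ring (V A))"
  using cring.von_neumann_regular_V[OF assms(1)]
    Qred_isomorphic_V_quotient[OF assms(1) sign_complemented_if_marshall_represented[OF assms(1,3,4,5)]]
  by blast

end
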